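(* Let $\mathbf{k}$ be a commutative unitary ring, $\lambda\in\mathbf{k}$, and let $M$ be a $\mathbf{k}$-module. Let $\mathrm{Sh}^{NC}(M)=\bigoplus_{F\in\mathcal{F}}M^{\otimes F}$, with the product $\overline{\diamond}$, the linear operator $P_M$ and the module map $j_M:M\to \mathrm{Sh}^{NC}(M)$ defined in the context. Then: (a) The pair $(\mathrm{Sh}^{NC}(M),\overline{\diamond})$ is a unitary associative algebra. (b) The triple $(\mathrm{Sh}^{NC}(M),\overline{\diamond},P_M)$ is a unitary Rota--Baxter algebra of weight $\lambda$. (c) The quadruple $(\mathrm{Sh}^{NC}(M),\overline{\diamond},P_M,j_M)$ is the free unitary Rota--Baxter algebra of weight $\lambda$ on the module $M$. More precisely, for any unitary Rota--Baxter algebra $(R,P)$ of weight $\lambda$ and any $\mathbf{k}$-module morphism $f:M\to R$, there is a unique unitary Rota--Baxter algebra morphism $\bar f:\mathrm{Sh}^{NC}(M)\to R$ such that $f=\bar f\circ j_M$.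
   Context: Rota--Baxter algebra of weight $\lambda$: an associative $\mathbf{k}$-algebra $R$ with a $\mathbf{k}$-linear map $P:R\to R$ such that $P(x)P(y)=P\big(P(x)y+xP(y)+\lambda xy\big)$ for all $x,y\in R$; it is unitary if $R$ has an identity. A morphism of unitary Rota--Baxter algebras is a unit-preserving $\mathbf{k}$-algebra homomorphism commuting with the operators. Forests: $\mathcal{T}$ is the set of planar rooted trees; $\bullet$ is the tree with a single vertex. $\mathcal{F}$ is the free semigroup generated by $\mathcal{T}$, with product (concatenation) denoted $\sqcup$; its elements $T_1\sqcup\cdots\sqcup T_b$ ($b\ge 1$, $T_i\in\mathcal{T}$) are called planar rooted forests. The grafting $\lfloor T_1\sqcup\cdots\sqcup T_b\rfloor$ is the tree obtained by adding a new root together with an edge from the new root to the root of each $T_i$ (keeping the order). Every tree is either $\bullet$ or of the form $\lfloor \overline{F}\rfloor$ for a unique forest $\overline{F}$. The depth of a tree is the length of the longest path from its root to a leaf; the depth $\mathrm{d}(F)$ of a forest is the maximal depth of its trees. $\ell(F)$ denotes the number of leaves of $F$ (the vertex of $\bullet$ is a leaf, so $\ell(\bullet)=1$). The product $\sqcup$ and the grafting $\lfloor\ \rfloor$ are extended (bi)linearly to $\mathbf{k}\,\mathcal{F}$, the free $\mathbf{k}$-module on $\mathcal F$. Product $\diamond$ on $\mathbf{k}\,\mathcal{F}$: defined on $\mathcal{F}\times\mathcal{F}$ by induction on $\mathrm{d}(F)+\mathrm{d}(F')$ and extended bilinearly. For trees $F,F'$: $F\diamond\bullet=F$, $\bullet\diamond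 F'=F'$, and if $F=\lfloor\overline{F}\rfloor$, $F'=\lfloor\overline{F}'\rfloor$ then $$F\diamond F'=\lfloor\lfloor\overline{F}\rfloor\diamond\overline{F}'\rfloor+\lfloor\overline{F}\diamond\lfloor\overline{F}'\rfloor\rfloor+\lambda\lfloor\overline{F}\diamond\overline{F}'\rfloor .$$ For forests $F=T_1\sqcup\cdots\sqcup T_b$ and $F'=T'_1\sqcup\cdots\sqcup T'_{b'}$, $F\diamond F'=T_1\sqcup\cdots\sqcup T_{b-1}\sqcup(T_b\diamond T'_1)\sqcup T'_2\sqcup\cdots\sqcup T'_{b'}$. The element $F\diamond F'$ is a linear combination of forests each having $\ell(F)+\ell(F')-1$ leaves. Decorated forests: for $F\in\mathcal{F}$, $M^{\otimes F}=\{(F;\mathfrak m)\mid \mathfrak m\in M^{\otimes(\ell(F)-1)}\}$ is a copy of the $\mathbf{k}$-module $M^{\otimes(\ell(F)-1)}$ labelled by $F$, with $M^{\otimes 0}=\mathbf{k}$. If $\sum_i c_iF_i\in\mathbf{k}\,\mathcal F$ with all $F_i$ having the same number $\ell$ of leaves and $\mathfrak m\in M^{\otimes(\ell-1)}$, then $(\sum_i c_iF_i;\mathfrak m):=\sum_i c_i(F_i;\mathfrak m)$. Product: $(F;\mathfrak m)\,\overline{\diamond}\,(F';\mathfrak m')=(F\diamond F';\mathfrak m\,\overline{\otimes}\,\mathfrak m')$, extended biadditively, where $\overline{\otimes}$ is the product of the tensor algebra $T(M)=\bigoplus_{n\ge0}M^{\otimes n}$ (concatenation of tensors, with degree-0 elements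 acting as scalars). Operator: $P_M(F;\mathfrak m)=(\lfloor F\rfloor;\mathfrak m)$ (note $\ell(\lfloor F\rfloor)=\ell(F)$), extended additively. The map $j_M:M\to\mathrm{Sh}^{NC}(M)$ is $a\mapsto(\bullet\sqcup\bullet;a)$. *)

theory Defs
  imports "HOL-Algebra.Module" "HOL-Algebra.AbelCoset" "HOL-Library.FuncSet"
begin

section \<open>Rota--Baxter algebras\<close>

text \<open>The library locale \<open>algebra\<close> only covers commutative algebras.  The identity is the \<open>one\<close> field
  of the record; \<open>ring\<close> and \<open>cring\<close> do not exclude the zero ring.\<close>

locale unital_algebra = module R A + ring A for R (structure) and A (structure) +
  assumes smult_mult_left:
      "\<lbrakk>a \<in> carrier R; x \<in> carrier A; y \<in> carrier A\<rbrakk>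
        \<Longrightarrow> (a \<odot>\<^bsub>A\<^esub> x) \<otimes>\<^bsub>A\<^esub> y = a \<odot>\<^bsub>A\<^esub> (x \<otimes>\<^bsub>A\<^esub> y)"
    and smult_mult_right:
      "\<lbrakk>a \<in> carrier R; x \<in> carrier A; y \<in> carrier A\<rbrakk>
        \<Longrightarrow> x \<otimes>\<^bsub>A\<^esub> (a \<odot>\<^bsub>A\<^esub> y) = a \<odot>\<^bsub>A\<^esub> (x \<otimes>\<^bsub>A\<^esub> y)"

definition mod_hom ::
  "('k, 'a) ring_scheme \<Rightarrow> ('k, 'm, 'b) module_scheme \<Rightarrow> ('k, 'n, 'c) module_scheme \<Rightarrow> ('m \<Rightarrow> 'n) set"
  where "mod_hom K M N =
    {f. f \<in> carrier M \<rightarrow> carrier N \<and>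
        (\<forall>x\<in>carrier M. \<forall>y\<in>carrier M. f (x \<oplus>\<^bsub>M\<^esub> y) = f x \<oplus>\<^bsub>N\<^esub> f y) \<and>
        (\<forall>a\<in>carrier K. \<forall>x\<in>carrier M. f (a \<odot>\<^bsub>M\<^esub> x) = a \<odot>\<^bsub>N\<^esub> f x)}"

locale rota_baxter_algebra = unital_algebra K R
  for K :: "('k, 'a) ring_scheme" and lam :: 'k
    and R :: "('k, 'r, 'b) module_scheme" and P :: "'r \<Rightarrow> 'r" +
  assumes weight_closed: "lam \<in> carrier K"
    and operator_linear: "P \<in> mod_hom K R R"
    and rota_baxter: "\<lbrakk>x \<in> carrier R; y \<in> carrier R\<rbrakk> \<Longrightarrow>
      P x \<otimes>\<^bsub>R\<^esub> P y = P (P x \<otimes>\<^bsub>R\<^esub> y \<oplus>\<^bsub>R\<^esub> x \<otimes>\<^bsub>R\<^esub> P y \<oplus>\<^bsub>R\<^esub> lam \<odot>\<^bsub>R\<^esub> (x \<otimes>\<^bsub>R\<^esub> y))"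

definition rb_hom ::
  "('k, 'a) ring_scheme \<Rightarrow> ('k, 's, 'b) module_scheme \<Rightarrow> ('s \<Rightarrow> 's)
    \<Rightarrow> ('k, 'r, 'c) module_scheme \<Rightarrow> ('r \<Rightarrow> 'r) \<Rightarrow> ('s \<Rightarrow> 'r) set"
  where "rb_hom K S Q R P =
    {g. g \<in> ring_hom S R \<and> g \<in> mod_hom K S R \<and> (\<forall>x\<in>carrier S. g (Q x) = P (g x))}"

section \<open>Direct sums, free modules, quotient modules\<close>

text \<open>Structures that are used only as modules are given the type of module records; their
  multiplicative fields carry no meaning and are left \<open>undefined\<close>.\<close>

definition direct_sum :: "'i set \<Rightarrow> ('i \<Rightarrow> ('k, 'b) module) \<Rightarrow> ('k, 'i \<Rightarrow> 'b) module"
  where "direct_sum I N =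
    \<lparr>carrier = {x \<in> \<Pi>\<^sub>E i\<in>I. carrier (N i). finite {i \<in> I. x i \<noteq> \<zero>\<^bsub>N i\<^esub>}},
     mult = undefined, one = undefined,
     zero = (\<lambda>i\<in>I. \<zero>\<^bsub>N i\<^esub>),
     add = (\<lambda>x y. \<lambda>i\<in>I. x i \<oplus>\<^bsub>N i\<^esub> y i),
     smult = (\<lambda>a x. \<lambda>i\<in>I. a \<odot>\<^bsub>N i\<^esub> x i)\<rparr>"

definition self_module :: "('k, 'a) ring_scheme \<Rightarrow> ('k, 'k) module"
  where "self_module K =
    \<lparr>carrier = carrier K, mult = mult K, one = one K, zero = zero K, add = add K, smult = mult K\<rparr>"

definition free_module :: "('k, 'a) ring_scheme \<Rightarrow> 'i set \<Rightarrow> ('k, 'i \<Rightarrow> 'k) module"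
  where "free_module K X = direct_sum X (\<lambda>_. self_module K)"

definition basis_elt :: "('k, 'a) ring_scheme \<Rightarrow> 'i set \<Rightarrow> 'i \<Rightarrow> ('i \<Rightarrow> 'k)"
  where "basis_elt K X i = (\<lambda>j\<in>X. if j = i then \<one>\<^bsub>K\<^esub> else \<zero>\<^bsub>K\<^esub>)"

definition submodule_generated ::
  "('k, 'a) ring_scheme \<Rightarrow> ('k, 'b, 'c) module_scheme \<Rightarrow> 'b set \<Rightarrow> 'b set"
  where "submodule_generated K V S = \<Inter>{N. submodule N K V \<and> S \<subseteq> N}"

definition quotient_module :: "('k, 'b, 'c) module_scheme \<Rightarrow> 'b set \<Rightarrow> ('k, 'b set) module"
  where "quotient_module V N =
    \<lparr>carrier = a_rcosets\<^bsub>V\<^esub> N, mult = undefined, one = undefined,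
     zero = N, add = set_add V,
     smult = (\<lambda>a X. \<Union>x\<in>X. N +>\<^bsub>V\<^esub> (a \<odot>\<^bsub>V\<^esub> x))\<rparr>"

section \<open>Tensor powers\<close>

text \<open>The \<open>n\<close>-th tensor power of \<open>M\<close> is the free module on \<open>M\<^sup>n\<close> modulo the submodule generated by the
  multilinearity relations.  For \<open>n = 0\<close> there are no relations and a single word, so the result is
  a copy of the ground ring, a scalar \<open>c\<close> being the class of \<open>c\<close> times the empty word; for \<open>n = 1\<close> it
  is a copy of \<open>M\<close>, an element \<open>a\<close> being the class of the word \<open>[a]\<close>.\<close>

definition words :: "('k, 'm, 'b) module_scheme \<Rightarrow> nat \<Rightarrow> 'm list set"
  where "words M n = {w. set w \<subseteq> carrier M \<and> length w = n}"

definition multilinear_relations ::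
  "('k, 'a) ring_scheme \<Rightarrow> ('k, 'm, 'b) module_scheme \<Rightarrow> nat \<Rightarrow> ('m list \<Rightarrow> 'k) set"
  where "multilinear_relations K M n =
    (let V = free_module K (words M n); e = basis_elt K (words M n) in
      {e (u @ [x \<oplus>\<^bsub>M\<^esub> y] @ v) \<ominus>\<^bsub>V\<^esub> (e (u @ [x] @ v) \<oplus>\<^bsub>V\<^esub> e (u @ [y] @ v)) | u v x y.
         x \<in> carrier M \<and> y \<in> carrier M \<and> set u \<subseteq> carrier M \<and> set v \<subseteq> carrier M \<and>
         length u + 1 + length v = n} \<union>
      {e (u @ [a \<odot>\<^bsub>M\<^esub> x] @ v) \<ominus>\<^bsub>V\<^esub> a \<odot>\<^bsub>V\<^esub> e (u @ [x] @ v) | u v a x.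
         a \<in> carrier K \<and> x \<in> carrier M \<and> set u \<subseteq> carrier M \<and> set v \<subseteq> carrier M \<and>
         length u + 1 + length v = n})"

definition tensor_null ::
  "('k, 'a) ring_scheme \<Rightarrow> ('k, 'm, 'b) module_scheme \<Rightarrow> nat \<Rightarrow> ('m list \<Rightarrow> 'k) set"
  where "tensor_null K M n =
    submodule_generated K (free_module K (words M n)) (multilinear_relations K M n)"

definition tensor_power ::
  "('k, 'a) ring_scheme \<Rightarrow> ('k, 'm, 'b) module_scheme \<Rightarrow> nat \<Rightarrow> ('k, ('m list \<Rightarrow> 'k) set) module"
  where "tensor_power K M n = quotient_module (free_module K (words M n)) (tensor_null K M n)"

text \<open>\<open>pure_tensor K M [a\<^sub>1, \<dots>, a\<^sub>n]\<close> is the tensor of \<open>a\<^sub>1, \<dots>, a\<^sub>n\<close>, in the power of degree \<open>n\<close>.\<close>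

definition pure_tensor ::
  "('k, 'a) ring_scheme \<Rightarrow> ('k, 'm, 'b) module_scheme \<Rightarrow> 'm list \<Rightarrow> ('m list \<Rightarrow> 'k) set"
  where "pure_tensor K M w =
    tensor_null K M (length w) +>\<^bsub>free_module K (words M (length w))\<^esub>
      basis_elt K (words M (length w)) w"

text \<open>A word of length \<open>m + n\<close> is in a unique way the concatenation of a word of length \<open>m\<close> and one of
  length \<open>n\<close>, so the following is the bilinear extension of concatenation.\<close>

definition concat_product ::
  "('k, 'a) ring_scheme \<Rightarrow> ('k, 'm, 'b) module_scheme \<Rightarrow> nat \<Rightarrow> nat
    \<Rightarrow> ('m list \<Rightarrow> 'k) \<Rightarrow> ('m list \<Rightarrow> 'k) \<Rightarrow> ('m list \<Rightarrow> 'k)"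
  where "concat_product K M m n p q =
    (\<lambda>w\<in>words M (m + n). p (take m w) \<otimes>\<^bsub>K\<^esub> q (drop m w))"

text \<open>The product of the tensor algebra from degrees \<open>m\<close> and \<open>n\<close> to degree \<open>m + n\<close>, defined on cosets in the
  manner of \<open>rcoset_mult\<close>: all products of representatives lie in the same coset.\<close>

definition tensor_mult ::
  "('k, 'a) ring_scheme \<Rightarrow> ('k, 'm, 'b) module_scheme \<Rightarrow> nat \<Rightarrow> nat
    \<Rightarrow> ('m list \<Rightarrow> 'k) set \<Rightarrow> ('m list \<Rightarrow> 'k) set \<Rightarrow> ('m list \<Rightarrow> 'k) set"
  where "tensor_mult K M m n X Y =
    (\<Union>p\<in>X. \<Union>q\<in>Y. tensor_null K M (m + n) +>\<^bsub>free_module K (words M (m + n))\<^esub>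
                      concat_product K M m n p q)"

section \<open>Planar rooted forests\<close>

text \<open>\<open>Node []\<close> is the one-vertex tree, and \<open>Node F\<close> with \<open>F \<noteq> []\<close> is the grafting of the forest \<open>F\<close>.
  The free semigroup on the trees consists of the nonempty lists, with \<open>@\<close> as product.\<close>

datatype ptree = Node "ptree list"

type_synonym pforest = "ptree list"

abbreviation bullet :: ptree where "bullet \<equiv> Node []"

definition forests :: "pforest set" where "forests = {F. F \<noteq> []}"

fun tree_leaves :: "ptree \<Rightarrow> nat" where
  "tree_leaves (Node ts) = (if ts = [] then 1 else sum_list (map tree_leaves ts))"

definition leaves :: "pforest \<Rightarrow> nat" where "leaves F = sum_list (map tree_leaves F)"

text \<open>The linear extension to the free module on the forests of a map \<open>\<phi>\<close> from forests to \<open>V\<close>.\<close>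

definition forest_lin ::
  "('k, 'a) ring_scheme \<Rightarrow> ('k, 'b, 'c) module_scheme \<Rightarrow> (pforest \<Rightarrow> 'b) \<Rightarrow> (pforest \<Rightarrow> 'k) \<Rightarrow> 'b"
  where "forest_lin K V \<phi> c = (\<Oplus>\<^bsub>V\<^esub>F\<in>{F \<in> forests. c F \<noteq> \<zero>\<^bsub>K\<^esub>}. c F \<odot>\<^bsub>V\<^esub> \<phi> F)"

abbreviation forest_module :: "('k, 'a) ring_scheme \<Rightarrow> ('k, pforest \<Rightarrow> 'k) module" where
  "forest_module K \<equiv> free_module K forests"

abbreviation forest_basis :: "('k, 'a) ring_scheme \<Rightarrow> pforest \<Rightarrow> (pforest \<Rightarrow> 'k)" where
  "forest_basis K \<equiv> basis_elt K forests"

definition graft_lin :: "('k, 'a) ring_scheme \<Rightarrow> (pforest \<Rightarrow> 'k) \<Rightarrow> (pforest \<Rightarrow> 'k)" where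
  "graft_lin K = forest_lin K (forest_module K) (\<lambda>F. forest_basis K [Node F])"

text \<open>The product on trees and on forests, valued in the free module on the forests.  On forests
  \<open>T\<^sub>1 \<dots> T\<^sub>b\<close> and \<open>T'\<^sub>1 \<dots> T'\<^sub>c\<close> it replaces the adjacent trees \<open>T\<^sub>b\<close>, \<open>T'\<^sub>1\<close> by their product.  The value
  on the empty list, which is not a forest, is irrelevant.\<close>

function (sequential)
  tree_diamond :: "('k, 'a) ring_scheme \<Rightarrow> 'k \<Rightarrow> ptree \<Rightarrow> ptree \<Rightarrow> (pforest \<Rightarrow> 'k)" and
  diamond :: "('k, 'a) ring_scheme \<Rightarrow> 'k \<Rightarrow> pforest \<Rightarrow> pforest \<Rightarrow> (pforest \<Rightarrow> 'k)"
where
  "tree_diamond K lam (Node F) (Node F') =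
    (if F' = [] then forest_basis K [Node F]
     else if F = [] then forest_basis K [Node F']
     else graft_lin K (diamond K lam [Node F] F')
            \<oplus>\<^bsub>forest_module K\<^esub> graft_lin K (diamond K lam F [Node F'])
            \<oplus>\<^bsub>forest_module K\<^esub> lam \<odot>\<^bsub>forest_module K\<^esub> graft_lin K (diamond K lam F F'))"
| "diamond K lam F F' =
    (if F = [] \<or> F' = [] then \<zero>\<^bsub>forest_module K\<^esub>
     else forest_lin K (forest_module K) (\<lambda>G. forest_basis K (butlast F @ G @ tl F'))
            (tree_diamond K lam (last F) (hd F')))"
  by pat_completeness auto

lemma size_member_Node: "t \<in> set ts \<Longrightarrow> size t < size (Node ts)"
  by (induction ts) auto

termination
proof (relation "measure (\<lambda>p. case p of
      Inl (K, lam, T, T') \<Rightarrow> 2 * (size T + size T')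
    | Inr (K, lam, F, F') \<Rightarrow> 2 * (size (last F) + size (hd F')) + 1)", goal_cases)
  case (2 K lam F F')
  then show ?case using size_member_Node[of "hd F'" F'] by simp
next
  case (3 K lam F F')
  then show ?case using size_member_Node[of "last F" F] by simp
next
  case (4 K lam F F')
  then show ?case
    using size_member_Node[of "hd F'" F'] size_member_Node[of "last F" F] by simp
qed simp_all

section \<open>The noncommutative shuffle algebra\<close>

definition decorations ::
  "('k, 'a) ring_scheme \<Rightarrow> ('k, 'm, 'b) module_scheme \<Rightarrow> pforest \<Rightarrow> ('k, ('m list \<Rightarrow> 'k) set) module"
  where "decorations K M F = tensor_power K M (leaves F - 1)"

definition shNC_module ::
  "('k, 'a) ring_scheme \<Rightarrow> ('k, 'm, 'b) module_scheme
    \<Rightarrow> ('k, pforest \<Rightarrow> ('m list \<Rightarrow> 'k) set) module"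
  where "shNC_module K M = direct_sum forests (decorations K M)"

text \<open>\<open>decorated K M F t\<close> is the element \<open>(F; t)\<close> of the direct sum, and \<open>decorated_lin K M c t\<close> is
  \<open>(\<Sum>\<^sub>F c\<^sub>F F; t)\<close>.\<close>

definition decorated ::
  "('k, 'a) ring_scheme \<Rightarrow> ('k, 'm, 'b) module_scheme \<Rightarrow> pforest \<Rightarrow> ('m list \<Rightarrow> 'k) set
    \<Rightarrow> (pforest \<Rightarrow> ('m list \<Rightarrow> 'k) set)"
  where "decorated K M F t = (\<lambda>G\<in>forests. if G = F then t else \<zero>\<^bsub>decorations K M G\<^esub>)"

definition decorated_lin ::
  "('k, 'a) ring_scheme \<Rightarrow> ('k, 'm, 'b) module_scheme \<Rightarrow> (pforest \<Rightarrow> 'k) \<Rightarrow> ('m list \<Rightarrow> 'k) set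
    \<Rightarrow> (pforest \<Rightarrow> ('m list \<Rightarrow> 'k) set)"
  where "decorated_lin K M c t = forest_lin K (shNC_module K M) (\<lambda>F. decorated K M F t) c"

definition forest_support ::
  "('k, 'a) ring_scheme \<Rightarrow> ('k, 'm, 'b) module_scheme
    \<Rightarrow> (pforest \<Rightarrow> ('m list \<Rightarrow> 'k) set) \<Rightarrow> pforest set"
  where "forest_support K M x = {F \<in> forests. x F \<noteq> \<zero>\<^bsub>decorations K M F\<^esub>}"

text \<open>An element \<open>x\<close> of the direct sum is the sum of the \<open>(F; x F)\<close> over its support; the product and
  the operator are the (bi)additive extensions of their values on such elements.\<close>

definition shNC_mult ::
  "('k, 'a) ring_scheme \<Rightarrow> 'k \<Rightarrow> ('k, 'm, 'b) module_scheme
    \<Rightarrow> (pforest \<Rightarrow> ('m list \<Rightarrow> 'k) set) \<Rightarrow> (pforest \<Rightarrow> ('m list \<Rightarrow> 'k) set)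
    \<Rightarrow> (pforest \<Rightarrow> ('m list \<Rightarrow> 'k) set)"
  where "shNC_mult K lam M x y =
    (\<Oplus>\<^bsub>shNC_module K M\<^esub>F\<in>forest_support K M x. \<Oplus>\<^bsub>shNC_module K M\<^esub>F'\<in>forest_support K M y.
       decorated_lin K M (diamond K lam F F')
         (tensor_mult K M (leaves F - 1) (leaves F' - 1) (x F) (y F')))"

definition shNC ::
  "('k, 'a) ring_scheme \<Rightarrow> 'k \<Rightarrow> ('k, 'm, 'b) module_scheme
    \<Rightarrow> ('k, pforest \<Rightarrow> ('m list \<Rightarrow> 'k) set) module"
  where "shNC K lam M = (shNC_module K M)
    \<lparr>mult := shNC_mult K lam M, one := decorated K M [bullet] (pure_tensor K M [])\<rparr>"

definition shNC_op ::
  "('k, 'a) ring_scheme \<Rightarrow> ('k, 'm, 'b) module_scheme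
    \<Rightarrow> (pforest \<Rightarrow> ('m list \<Rightarrow> 'k) set) \<Rightarrow> (pforest \<Rightarrow> ('m list \<Rightarrow> 'k) set)"
  where "shNC_op K M x =
    (\<Oplus>\<^bsub>shNC_module K M\<^esub>F\<in>forest_support K M x. decorated K M [Node F] (x F))"

definition shNC_incl ::
  "('k, 'a) ring_scheme \<Rightarrow> ('k, 'm, 'b) module_scheme \<Rightarrow> 'm \<Rightarrow> (pforest \<Rightarrow> ('m list \<Rightarrow> 'k) set)"
  where "shNC_incl K M a = decorated K M [bullet, bullet] (pure_tensor K M [a])"

end

theory Submission
  imports Defs "HOL-Library.Multiset"
begin

text \<open>
  Write \<open>(F; w)\<close> for the forest \<open>F\<close> decorated by the pure tensor of the letters of a word \<open>w\<close>.  These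
  elements span the algebra (lemma \<open>Sh_hom_eq\<close>), and the product, the operator and all maps that occur
  below are linear in each argument, so every identity has to be checked on them only.

  On the elements \<open>(F; w)\<close> the decorations are merely concatenated, and all the content lies in the
  product of forests.  Its coefficients are sums of powers of \<open>\<lambda>\<close>, so it is described by a finite
  multiset of pairs \<open>(i, G)\<close>, each standing for \<open>\<lambda>\<^sup>i G\<close>; this multiset depends neither on the ring nor on
  the module.  Associativity is thereby an identity between multisets (\<open>tree_expansion_assoc\<close>): for three
  grafted trees both sides expand into seven products of smaller forests, which agree pairwise by
  induction.  The Rota--Baxter identity (\<open>rota_baxter_gen\<close>) is the recursive clause by which the product
  of two grafted trees is defined.

  For the universal property, a decorated forest is read as an expression in the target algebra \<open>R\<close>: the
  one-vertex tree is \<open>1\<close>, grafting is the operator \<open>P\<close>, and neighbouring trees are multiplied with the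
  factor \<open>f a\<close> between them, where \<open>a\<close> is the decoration at that place (\<open>forest_eval\<close>).  The value is
  multilinear in the decorations, so it extends to a linear map.  This map is multiplicative
  (\<open>ev_tree_expansion\<close>, \<open>ev_forest_expansion\<close>), because the Rota--Baxter identity in \<open>R\<close> has the same three
  terms as the recursion of the product.  It is the only morphism with the prescribed values on \<open>M\<close>, since
  every \<open>(F; w)\<close> arises from \<open>1\<close> and the elements \<open>j a\<close> by products and the operator (\<open>rb_hom_gen\<close>).
\<close>

section \<open>Linear maps\<close>

lemma mod_homI:
  assumes "\<And>x. x \<in> carrier M \<Longrightarrow> f x \<in> carrier N"
    and "\<And>x y. x \<in> carrier M \<Longrightarrow> y \<in> carrier M \<Longrightarrow> f (x \<oplus>\<^bsub>M\<^esub> y) = f x \<oplus>\<^bsub>N\<^esub> f y"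
    and "\<And>a x. a \<in> carrier K \<Longrightarrow> x \<in> carrier M \<Longrightarrow> f (a \<odot>\<^bsub>M\<^esub> x) = a \<odot>\<^bsub>N\<^esub> f x"
  shows "f \<in> mod_hom K M N"
  using assms by (auto simp: mod_hom_def)

lemma
  assumes "f \<in> mod_hom K M N"
  shows mod_hom_closed: "x \<in> carrier M \<Longrightarrow> f x \<in> carrier N"
    and mod_hom_add: "x \<in> carrier M \<Longrightarrow> y \<in> carrier M \<Longrightarrow> f (x \<oplus>\<^bsub>M\<^esub> y) = f x \<oplus>\<^bsub>N\<^esub> f y"
    and mod_hom_smult: "a \<in> carrier K \<Longrightarrow> x \<in> carrier M \<Longrightarrow> f (a \<odot>\<^bsub>M\<^esub> x) = a \<odot>\<^bsub>N\<^esub> f x"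
  using assms by (auto simp: mod_hom_def)

lemma mod_hom_zero:
  assumes "f \<in> mod_hom K M N" "module K M" "module K N"
  shows "f \<zero>\<^bsub>M\<^esub> = \<zero>\<^bsub>N\<^esub>"
proof -
  interpret M: module K M by fact
  interpret N: module K N by fact
  have "f (\<zero>\<^bsub>K\<^esub> \<odot>\<^bsub>M\<^esub> \<zero>\<^bsub>M\<^esub>) = \<zero>\<^bsub>K\<^esub> \<odot>\<^bsub>N\<^esub> f \<zero>\<^bsub>M\<^esub>"
    by (rule mod_hom_smult[OF assms(1)]) simp_all
  then show ?thesis using mod_hom_closed[OF assms(1), of "\<zero>\<^bsub>M\<^esub>"] by simp
qed

lemma mod_hom_comp:
  "g \<in> mod_hom K N V \<Longrightarrow> f \<in> mod_hom K M N \<Longrightarrow> (\<lambda>x. g (f x)) \<in> mod_hom K M V"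
  by (auto simp: mod_hom_def Pi_iff)

lemma mod_hom_add_fun:
  assumes "module K V" "f \<in> mod_hom K M V" "g \<in> mod_hom K M V"
  shows "(\<lambda>x. f x \<oplus>\<^bsub>V\<^esub> g x) \<in> mod_hom K M V"
proof -
  interpret module K V by fact
  show ?thesis
    using assms(2,3) by (auto simp: mod_hom_def Pi_iff M.a_ac smult_r_distr)
qed

lemma mod_hom_smult_fun:
  assumes "module K V" "f \<in> mod_hom K M V" "a \<in> carrier K"
  shows "(\<lambda>x. a \<odot>\<^bsub>V\<^esub> f x) \<in> mod_hom K M V"
proof -
  interpret module K V by fact
  show ?thesis
    using assms(2,3)
    by (auto simp: mod_hom_def Pi_iff smult_r_distr smult_assoc1[symmetric] R.m_comm)
qed

lemma mod_hom_zero_fun: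
  assumes "module K V"
  shows "(\<lambda>x. \<zero>\<^bsub>V\<^esub>) \<in> mod_hom K M V"
proof -
  interpret module K V by fact
  show ?thesis by (auto simp: mod_hom_def)
qed

lemma mod_hom_finsum_fun:
  assumes "module K V" "\<And>i. i \<in> A \<Longrightarrow> f i \<in> mod_hom K M V"
  shows "(\<lambda>x. finsum V (\<lambda>i. f i x) A) \<in> mod_hom K M V"
proof -
  interpret module K V by fact
  have cl: "f i x \<in> carrier V" if "i \<in> A" "x \<in> carrier M" for i x
    using mod_hom_closed[OF assms(2)[OF that(1)] that(2)] .
  show ?thesis
  proof (rule mod_homI)
    fix x assume "x \<in> carrier M"
    then show "(\<Oplus>\<^bsub>V\<^esub>i\<in>A. f i x) \<in> carrier V" using cl by (intro M.finsum_closed) auto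
  next
    fix a x assume a: "a \<in> carrier K" "x \<in> carrier M"
    show "(\<Oplus>\<^bsub>V\<^esub>i\<in>A. f i (a \<odot>\<^bsub>M\<^esub> x)) = a \<odot>\<^bsub>V\<^esub> (\<Oplus>\<^bsub>V\<^esub>i\<in>A. f i x)"
    proof (cases "finite A")
      case True
      have "(\<Oplus>\<^bsub>V\<^esub>i\<in>A. f i (a \<odot>\<^bsub>M\<^esub> x)) = (\<Oplus>\<^bsub>V\<^esub>i\<in>A. a \<odot>\<^bsub>V\<^esub> f i x)"
        using cl a by (intro M.finsum_cong') (simp_all add: mod_hom_smult[OF assms(2)])
      then show ?thesis
        using True cl a by (simp add: finsum_smult_ldistr Pi_def)
    qed (simp add: a M.finsum_infinite)
  next
    fix x y assume a: "x \<in> carrier M" "y \<in> carrier M"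
    have "(\<Oplus>\<^bsub>V\<^esub>i\<in>A. f i (x \<oplus>\<^bsub>M\<^esub> y)) = (\<Oplus>\<^bsub>V\<^esub>i\<in>A. f i x \<oplus>\<^bsub>V\<^esub> f i y)"
      using cl a by (intro M.finsum_cong') (simp_all add: mod_hom_add[OF assms(2)])
    then show "(\<Oplus>\<^bsub>V\<^esub>i\<in>A. f i (x \<oplus>\<^bsub>M\<^esub> y)) = (\<Oplus>\<^bsub>V\<^esub>i\<in>A. f i x) \<oplus>\<^bsub>V\<^esub> (\<Oplus>\<^bsub>V\<^esub>i\<in>A. f i y)"
      using cl a by (simp add: M.finsum_addf Pi_def)
  qed
qed

lemma mod_hom_cong:
  assumes "module K M" "\<And>x. x \<in> carrier M \<Longrightarrow> f x = g x" "g \<in> mod_hom K M N"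
  shows "f \<in> mod_hom K M N"
proof -
  interpret module K M by fact
  show ?thesis using assms(2,3) by (auto simp: mod_hom_def Pi_iff)
qed

lemma preimage_submodule:
  assumes "module K M" "module K N" "f \<in> mod_hom K M N" "submodule H K N"
  shows "submodule {x \<in> carrier M. f x \<in> H} K M"
proof -
  interpret M: module K M by fact
  interpret N: module K N by fact
  note E = N.submoduleE[OF assms(4)]
  have "\<zero>\<^bsub>N\<^esub> \<in> H"
    using E(1,2) E(4)[of "\<zero>\<^bsub>K\<^esub>"] by (metis M.R.zero_closed N.smult_l_null all_not_in_conv subsetD)
  moreover have "f (\<ominus>\<^bsub>M\<^esub> x) = \<ominus>\<^bsub>N\<^esub> f x" if "x \<in> carrier M" for x
    using mod_hom_smult[OF assms(3), of "\<ominus>\<^bsub>K\<^esub> \<one>\<^bsub>K\<^esub>" x] that mod_hom_closed[OF assms(3) that]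
    by (simp add: M.smult_l_minus N.smult_l_minus)
  ultimately show ?thesis
    using assms(3) E
    by (intro M.submoduleI) (auto simp: mod_hom_add mod_hom_smult mod_hom_zero[OF assms(3,1,2)])
qed

lemma zero_submodule:
  assumes "module K M" shows "submodule {\<zero>\<^bsub>M\<^esub>} K M"
proof -
  interpret module K M by fact
  show ?thesis by (intro submoduleI) auto
qed

section \<open>Sums over multisets\<close>

text \<open>The sum runs over a multiset because a product of forests may contain the same term several
  times, and each occurrence counts.\<close>

definition msum :: "('k, 'v, 'c) module_scheme \<Rightarrow> ('x \<Rightarrow> 'v) \<Rightarrow> 'x multiset \<Rightarrow> 'v"
  where "msum V f D = (\<Oplus>\<^bsub>V\<^esub>x\<in>set_mset D. [count D x] \<cdot>\<^bsub>V\<^esub> f x)"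

lemma msum_empty [simp]:
  assumes "module K V" shows "msum V f {#} = \<zero>\<^bsub>V\<^esub>"
proof -
  interpret module K V by fact
  show ?thesis by (simp add: msum_def)
qed

lemma msum_add_mset:
  assumes "module K V" "f x \<in> carrier V" "\<And>y. y \<in># D \<Longrightarrow> f y \<in> carrier V"
  shows "msum V f (add_mset x D) = f x \<oplus>\<^bsub>V\<^esub> msum V f D"
proof -
  interpret module K V by fact
  \<comment> \<open>Splitting \<open>x\<close> off the support treats the cases that \<open>x\<close> is new and that it already occurs in
    \<open>D\<close> alike: its multiplicity in \<open>D\<close> may be \<open>0\<close>.\<close>
  define B where "B = set_mset D - {x}"
  have B: "finite B" "x \<notin> B" "\<And>y. y \<in> B \<Longrightarrow> f y \<in> carrier V" "f x \<in> carrier V"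
    using assms(2,3) by (auto simp: B_def)
  have cl: "(\<lambda>y. [count E y] \<cdot>\<^bsub>V\<^esub> f y) \<in> B \<rightarrow> carrier V" for E
    using B by auto
  have D: "msum V f D = [count D x] \<cdot>\<^bsub>V\<^esub> f x \<oplus>\<^bsub>V\<^esub> (\<Oplus>\<^bsub>V\<^esub>y\<in>B. [count D y] \<cdot>\<^bsub>V\<^esub> f y)"
  proof (cases "x \<in># D")
    case True
    then have "set_mset D = insert x B" by (auto simp: B_def)
    then show ?thesis unfolding msum_def using B cl by (simp add: M.finsum_insert)
  next
    case False
    then have "set_mset D = B" "count D x = 0" by (auto simp: B_def not_in_iff)
    then show ?thesis unfolding msum_def using B cl[of D] by (simp add: M.finsum_closed)
  qed
  have "set_mset (add_mset x D) = insert x B" by (auto simp: B_def)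
  then have "msum V f (add_mset x D)
      = [Suc (count D x)] \<cdot>\<^bsub>V\<^esub> f x \<oplus>\<^bsub>V\<^esub> (\<Oplus>\<^bsub>V\<^esub>y\<in>B. [count (add_mset x D) y] \<cdot>\<^bsub>V\<^esub> f y)"
    unfolding msum_def using B cl by (simp add: M.finsum_insert)
  also have "(\<Oplus>\<^bsub>V\<^esub>y\<in>B. [count (add_mset x D) y] \<cdot>\<^bsub>V\<^esub> f y) = (\<Oplus>\<^bsub>V\<^esub>y\<in>B. [count D y] \<cdot>\<^bsub>V\<^esub> f y)"
    using B by (intro M.finsum_cong') auto
  finally show ?thesis
    using D B cl[of D] by (simp add: M.finsum_closed M.a_ac)
qed

lemma msum_closed:
  assumes "module K V" "\<And>y. y \<in># D \<Longrightarrow> f y \<in> carrier V"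
  shows "msum V f D \<in> carrier V"
proof -
  interpret module K V by fact
  show ?thesis unfolding msum_def using assms(2) by (intro M.finsum_closed) auto
qed

lemma msum_cong:
  assumes "module K V" "\<And>y. y \<in># D \<Longrightarrow> f y \<in> carrier V" "\<And>y. y \<in># D \<Longrightarrow> f y = g y"
  shows "msum V f D = msum V g D"
proof -
  interpret module K V by fact
  show ?thesis unfolding msum_def using assms(2,3) by (intro M.finsum_cong') auto
qed

lemma msum_union:
  assumes "module K V" "\<And>y. y \<in># D + E \<Longrightarrow> f y \<in> carrier V"
  shows "msum V f (D + E) = msum V f D \<oplus>\<^bsub>V\<^esub> msum V f E"
proof -
  interpret module K V by fact
  show ?thesis
    using assms(2)
  proof (induction D)
    case empty
    then show ?case using msum_closed[OF assms(1), of E f] by (simp add: msum_empty[OF assms(1)])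
  next
    case (add x D)
    have "msum V f (D + E) = msum V f D \<oplus>\<^bsub>V\<^esub> msum V f E" using add by auto
    moreover have "msum V f D \<in> carrier V" "msum V f E \<in> carrier V" "f x \<in> carrier V"
      using add(2) by (auto intro!: msum_closed[OF assms(1)])
    moreover have "msum V f (add_mset x (D + E)) = f x \<oplus>\<^bsub>V\<^esub> msum V f (D + E)"
      "msum V f (add_mset x D) = f x \<oplus>\<^bsub>V\<^esub> msum V f D"
      using add(2) by (auto intro!: msum_add_mset[OF assms(1)])
    ultimately show ?case by (simp add: M.a_assoc)
  qed
qed

lemma msum_image:
  assumes "module K V" "\<And>y. y \<in># D \<Longrightarrow> f (h y) \<in> carrier V"
  shows "msum V f (image_mset h D) = msum V (\<lambda>x. f (h x)) D"
  using assms(2)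
proof (induction D)
  case (add x D)
  have "msum V f (add_mset (h x) (image_mset h D)) = f (h x) \<oplus>\<^bsub>V\<^esub> msum V f (image_mset h D)"
    "msum V (\<lambda>x. f (h x)) (add_mset x D) = f (h x) \<oplus>\<^bsub>V\<^esub> msum V (\<lambda>x. f (h x)) D"
    using add(2) by (auto intro!: msum_add_mset[OF assms(1)])
  then show ?case using add by simp
qed (simp add: msum_empty[OF assms(1)])

lemma mod_hom_msum:
  assumes "module K V" "module K W" "g \<in> mod_hom K V W" "\<And>y. y \<in># D \<Longrightarrow> f y \<in> carrier V"
  shows "g (msum V f D) = msum W (\<lambda>x. g (f x)) D"
  using assms(4)
  by (induction D) (simp_all add: msum_empty[OF assms(1)] msum_empty[OF assms(2)]
      msum_add_mset[OF assms(1)] msum_add_mset[OF assms(2)] mod_hom_zero[OF assms(3,1,2)]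
      mod_hom_add[OF assms(3)] mod_hom_closed[OF assms(3)] msum_closed[OF assms(1)])

lemma mod_hom_msum_fun:
  assumes "module K M" "module K V" "\<And>i. i \<in># D \<Longrightarrow> f i \<in> mod_hom K M V"
  shows "(\<lambda>x. msum V (\<lambda>i. f i x) D) \<in> mod_hom K M V"
  using assms(3)
proof (induction D)
  case empty
  then show ?case using mod_hom_zero_fun[OF assms(2)] by (simp add: msum_empty[OF assms(2)])
next
  case (add i D)
  have "(\<lambda>x. f i x \<oplus>\<^bsub>V\<^esub> msum V (\<lambda>i. f i x) D) \<in> mod_hom K M V"
    using add by (intro mod_hom_add_fun assms(2)) auto
  moreover have "msum V (\<lambda>i. f i x) (add_mset i D) = f i x \<oplus>\<^bsub>V\<^esub> msum V (\<lambda>i. f i x) D"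
    if "x \<in> carrier M" for x
    by (rule msum_add_mset[OF assms(2)]) (simp_all add: mod_hom_closed[OF add(2)] that)
  ultimately show ?case by (rule mod_hom_cong[OF assms(1), rotated])
qed

section \<open>Direct sums\<close>

lemma direct_sum_simps:
  "carrier (direct_sum I N) = {x \<in> \<Pi>\<^sub>E i\<in>I. carrier (N i). finite {i \<in> I. x i \<noteq> \<zero>\<^bsub>N i\<^esub>}}"
  "\<zero>\<^bsub>direct_sum I N\<^esub> = (\<lambda>i\<in>I. \<zero>\<^bsub>N i\<^esub>)"
  "x \<oplus>\<^bsub>direct_sum I N\<^esub> y = (\<lambda>i\<in>I. x i \<oplus>\<^bsub>N i\<^esub> y i)"
  "a \<odot>\<^bsub>direct_sum I N\<^esub> x = (\<lambda>i\<in>I. a \<odot>\<^bsub>N i\<^esub> x i)"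
  by (simp_all add: direct_sum_def)

lemma direct_sum_module:
  assumes "cring K" "\<And>i. i \<in> I \<Longrightarrow> module K (N i)"
  shows "module K (direct_sum I N)"
proof -
  interpret K: cring K by fact
  have G: "abelian_group (N i)" if "i \<in> I" for i
    using assms(2)[OF that] by (simp add: module_def)
  have M: "abelian_monoid (N i)" if "i \<in> I" for i
    using G[OF that] by (simp add: abelian_group_def)
  note closed = abelian_monoidE(1)[OF M] abelian_monoidE(2)[OF M] module.smult_closed[OF assms(2)]
  have supp_add: "finite {i \<in> I. (\<lambda>i\<in>I. x i \<oplus>\<^bsub>N i\<^esub> y i) i \<noteq> \<zero>\<^bsub>N i\<^esub>}"
    if "finite {i \<in> I. x i \<noteq> \<zero>\<^bsub>N i\<^esub>}" "finite {i \<in> I. y i \<noteq> \<zero>\<^bsub>N i\<^esub>}" for x y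
    using finite_UnI[OF that]
    by (rule rev_finite_subset) (auto simp: abelian_monoidE[OF M])
  have supp_smult: "finite {i \<in> I. (\<lambda>i\<in>I. a \<odot>\<^bsub>N i\<^esub> x i) i \<noteq> \<zero>\<^bsub>N i\<^esub>}"
    if "finite {i \<in> I. x i \<noteq> \<zero>\<^bsub>N i\<^esub>}" "a \<in> carrier K" for a x
    using that(1)
    by (rule rev_finite_subset) (auto simp: module.smult_r_null[OF assms(2)] that(2))
  show ?thesis
  proof (rule moduleI)
    show "cring K" by fact
    show "abelian_group (direct_sum I N)"
    proof (rule abelian_groupI)
      fix x assume x: "x \<in> carrier (direct_sum I N)"
      \<comment> \<open>Multiplication by \<open>-1\<close> produces the additive inverse together with its finite support.\<close>
      let ?y = "(\<ominus>\<^bsub>K\<^esub> \<one>\<^bsub>K\<^esub>) \<odot>\<^bsub>direct_sum I N\<^esub> x"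
      have "?y \<in> carrier (direct_sum I N)"
        using x supp_smult[of x "\<ominus>\<^bsub>K\<^esub> \<one>\<^bsub>K\<^esub>"] by (auto simp: direct_sum_simps closed PiE_iff)
      moreover have "?y \<oplus>\<^bsub>direct_sum I N\<^esub> x = \<zero>\<^bsub>direct_sum I N\<^esub>"
        using x by (auto simp: direct_sum_simps PiE_iff module.smult_l_minus[OF assms(2)]
            module.smult_one[OF assms(2)] abelian_group.l_neg[OF G] intro!: restrict_ext)
      ultimately show "\<exists>y\<in>carrier (direct_sum I N). y \<oplus>\<^bsub>direct_sum I N\<^esub> x = \<zero>\<^bsub>direct_sum I N\<^esub>"
        by blast
    next
      show "\<zero>\<^bsub>direct_sum I N\<^esub> \<in> carrier (direct_sum I N)"
        by (auto simp: direct_sum_simps closed)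
    next
      fix x y assume "x \<in> carrier (direct_sum I N)" "y \<in> carrier (direct_sum I N)"
      then show "x \<oplus>\<^bsub>direct_sum I N\<^esub> y \<in> carrier (direct_sum I N)"
        using supp_add[of x y] by (auto simp: direct_sum_simps closed PiE_iff)
    next
      fix x y z
      assume "x \<in> carrier (direct_sum I N)" "y \<in> carrier (direct_sum I N)"
        "z \<in> carrier (direct_sum I N)"
      then show "x \<oplus>\<^bsub>direct_sum I N\<^esub> y \<oplus>\<^bsub>direct_sum I N\<^esub> z
          = x \<oplus>\<^bsub>direct_sum I N\<^esub> (y \<oplus>\<^bsub>direct_sum I N\<^esub> z)"
        by (auto simp: direct_sum_simps PiE_iff abelian_monoidE(3)[OF M] intro!: restrict_ext)
    next
      fix x y assume "x \<in> carrier (direct_sum I N)" "y \<in> carrier (direct_sum I N)"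
      then show "x \<oplus>\<^bsub>direct_sum I N\<^esub> y = y \<oplus>\<^bsub>direct_sum I N\<^esub> x"
        by (auto simp: direct_sum_simps PiE_iff intro!: restrict_ext abelian_monoidE(5)[OF M])
    next
      fix x assume x: "x \<in> carrier (direct_sum I N)"
      have "(\<lambda>i\<in>I. (\<lambda>i\<in>I. \<zero>\<^bsub>N i\<^esub>) i \<oplus>\<^bsub>N i\<^esub> x i) = (\<lambda>i\<in>I. x i)"
        using x by (intro restrict_ext) (auto simp: direct_sum_simps intro!: abelian_monoidE(4)[OF M])
      also have "\<dots> = x" using x by (intro extensional_restrict) (simp add: direct_sum_simps PiE_iff)
      finally show "\<zero>\<^bsub>direct_sum I N\<^esub> \<oplus>\<^bsub>direct_sum I N\<^esub> x = x" by (simp only: direct_sum_simps)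
    qed
  next
    fix a x assume "a \<in> carrier K" "x \<in> carrier (direct_sum I N)"
    then show "a \<odot>\<^bsub>direct_sum I N\<^esub> x \<in> carrier (direct_sum I N)"
      using supp_smult[of x a] by (auto simp: direct_sum_simps closed PiE_iff)
  next
    fix x assume x: "x \<in> carrier (direct_sum I N)"
    have "(\<lambda>i\<in>I. \<one>\<^bsub>K\<^esub> \<odot>\<^bsub>N i\<^esub> x i) = (\<lambda>i\<in>I. x i)"
      using x by (intro restrict_ext) (auto simp: direct_sum_simps intro!: module.smult_one[OF assms(2)])
    also have "\<dots> = x" using x by (intro extensional_restrict) (simp add: direct_sum_simps PiE_iff)
    finally show "\<one>\<^bsub>K\<^esub> \<odot>\<^bsub>direct_sum I N\<^esub> x = x" by (simp only: direct_sum_simps)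
  next
    fix a b x assume "a \<in> carrier K" "b \<in> carrier K" "x \<in> carrier (direct_sum I N)"
    then show "(a \<oplus>\<^bsub>K\<^esub> b) \<odot>\<^bsub>direct_sum I N\<^esub> x
        = a \<odot>\<^bsub>direct_sum I N\<^esub> x \<oplus>\<^bsub>direct_sum I N\<^esub> b \<odot>\<^bsub>direct_sum I N\<^esub> x"
      by (auto simp: direct_sum_simps PiE_iff intro!: restrict_ext module.smult_l_distr[OF assms(2)])
  next
    fix a x y
    assume "a \<in> carrier K" "x \<in> carrier (direct_sum I N)" "y \<in> carrier (direct_sum I N)"
    then show "a \<odot>\<^bsub>direct_sum I N\<^esub> (x \<oplus>\<^bsub>direct_sum I N\<^esub> y)
        = a \<odot>\<^bsub>direct_sum I N\<^esub> x \<oplus>\<^bsub>direct_sum I N\<^esub> a \<odot>\<^bsub>direct_sum I N\<^esub> y"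
      by (auto simp: direct_sum_simps PiE_iff intro!: restrict_ext module.smult_r_distr[OF assms(2)])
  next
    fix a b x assume "a \<in> carrier K" "b \<in> carrier K" "x \<in> carrier (direct_sum I N)"
    then show "(a \<otimes>\<^bsub>K\<^esub> b) \<odot>\<^bsub>direct_sum I N\<^esub> x
        = a \<odot>\<^bsub>direct_sum I N\<^esub> (b \<odot>\<^bsub>direct_sum I N\<^esub> x)"
      by (auto simp: direct_sum_simps PiE_iff intro!: restrict_ext module.smult_assoc1[OF assms(2)])
  qed
qed

text \<open>Both \<open>basis_elt\<close> and \<open>decorated\<close> are of this form, so the facts below apply to free modules
  and to the shuffle algebra.\<close>

definition inj_at :: "'i set \<Rightarrow> ('i \<Rightarrow> ('k, 'b) module) \<Rightarrow> 'i \<Rightarrow> 'b \<Rightarrow> ('i \<Rightarrow> 'b)"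
  where "inj_at I N i t = (\<lambda>j\<in>I. if j = i then t else \<zero>\<^bsub>N j\<^esub>)"

text \<open>The map out of the direct sum with components \<open>h i\<close>. It is written as a sum over the support
  because \<open>forest_lin\<close> and \<open>shNC_op\<close> have this shape and \<open>shNC_mult\<close> is an iterated sum of it;
  their linearity thus comes from \<open>sum_lift_hom\<close>.\<close>

definition sum_lift ::
  "'i set \<Rightarrow> ('i \<Rightarrow> ('k, 'b) module) \<Rightarrow> ('k, 'v, 'c) module_scheme \<Rightarrow> ('i \<Rightarrow> 'b \<Rightarrow> 'v) \<Rightarrow> ('i \<Rightarrow> 'b) \<Rightarrow> 'v"
  where "sum_lift I N V h x = (\<Oplus>\<^bsub>V\<^esub>i\<in>{i \<in> I. x i \<noteq> \<zero>\<^bsub>N i\<^esub>}. h i (x i))"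

context
  fixes K :: "('k, 'a) ring_scheme" and I :: "'i set" and N :: "'i \<Rightarrow> ('k, 'b) module"
  assumes cring: "cring K" and summand: "\<And>i. i \<in> I \<Longrightarrow> module K (N i)"
begin

interpretation S: module K "direct_sum I N"
  by (rule direct_sum_module[OF cring summand])

lemma summand_zero [simp]: "i \<in> I \<Longrightarrow> \<zero>\<^bsub>N i\<^esub> \<in> carrier (N i)"
  using summand[of i] by (simp add: module_def abelian_group_def abelian_monoidE)

lemma inj_at_hom:
  assumes "i \<in> I" shows "inj_at I N i \<in> mod_hom K (N i) (direct_sum I N)"
proof -
  interpret Ni: module K "N i" using summand assms by blast
  have z: "\<zero>\<^bsub>N j\<^esub> \<oplus>\<^bsub>N j\<^esub> \<zero>\<^bsub>N j\<^esub> = \<zero>\<^bsub>N j\<^esub>" "a \<in> carrier K \<Longrightarrow> a \<odot>\<^bsub>N j\<^esub> \<zero>\<^bsub>N j\<^esub> = \<zero>\<^bsub>N j\<^esub>"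
    if "j \<in> I" for j a
  proof -
    interpret Nj: module K "N j" using summand that by blast
    show "\<zero>\<^bsub>N j\<^esub> \<oplus>\<^bsub>N j\<^esub> \<zero>\<^bsub>N j\<^esub> = \<zero>\<^bsub>N j\<^esub>" "a \<in> carrier K \<Longrightarrow> a \<odot>\<^bsub>N j\<^esub> \<zero>\<^bsub>N j\<^esub> = \<zero>\<^bsub>N j\<^esub>" by simp_all
  qed
  show ?thesis
  proof (rule mod_homI)
    fix t assume t: "t \<in> carrier (N i)"
    have "finite {j \<in> I. inj_at I N i t j \<noteq> \<zero>\<^bsub>N j\<^esub>}"
      by (rule finite_subset[of _ "{i}"]) (auto simp: inj_at_def)
    then show "inj_at I N i t \<in> carrier (direct_sum I N)"
      using t by (auto simp: direct_sum_simps inj_at_def)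
  qed (auto simp: direct_sum_simps inj_at_def z intro!: restrict_ext)
qed

lemma direct_sum_induct [consumes 1, case_names zero inj add]:
  assumes "x \<in> carrier (direct_sum I N)"
    and zero: "Q \<zero>\<^bsub>direct_sum I N\<^esub>"
    and inj: "\<And>i t. i \<in> I \<Longrightarrow> t \<in> carrier (N i) \<Longrightarrow> Q (inj_at I N i t)"
    and add: "\<And>x y. x \<in> carrier (direct_sum I N) \<Longrightarrow> y \<in> carrier (direct_sum I N) \<Longrightarrow>
      Q x \<Longrightarrow> Q y \<Longrightarrow> Q (x \<oplus>\<^bsub>direct_sum I N\<^esub> y)"
  shows "Q x"
proof -
  have "finite {i \<in> I. x i \<noteq> \<zero>\<^bsub>N i\<^esub>}" using assms(1) by (simp add: direct_sum_simps)
  then show ?thesis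
    using assms(1)
  proof (induction "{i \<in> I. x i \<noteq> \<zero>\<^bsub>N i\<^esub>}" arbitrary: x rule: finite_induct)
    case empty
    then have "x = \<zero>\<^bsub>direct_sum I N\<^esub>"
      by (intro ext) (auto simp: direct_sum_simps PiE_iff extensional_def)
    then show ?case using zero by simp
  next
    case (insert i J)
    have i: "i \<in> I" "x i \<in> carrier (N i)" using insert by (auto simp: direct_sum_simps)
    \<comment> \<open>The induction removes one component from the finite support.\<close>
    define y where "y = (\<lambda>j\<in>I. if j = i then \<zero>\<^bsub>N j\<^esub> else x j)"
    have J: "J = {j \<in> I. y j \<noteq> \<zero>\<^bsub>N j\<^esub>}"
      using insert(2,4) by (auto simp: y_def split: if_splits)
    then have y: "y \<in> carrier (direct_sum I N)"
      using insert(1,5) by (auto simp: direct_sum_simps y_def PiE_iff)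
    have xy: "x = inj_at I N i (x i) \<oplus>\<^bsub>direct_sum I N\<^esub> y"
    proof
      fix j
      show "x j = (inj_at I N i (x i) \<oplus>\<^bsub>direct_sum I N\<^esub> y) j"
      proof (cases "j \<in> I")
        case True
        interpret Nj: module K "N j" using summand True by blast
        have "x j \<in> carrier (N j)" using insert(5) True by (auto simp: direct_sum_simps)
        then show ?thesis
          using True by (cases "i = j") (simp_all add: direct_sum_simps inj_at_def y_def)
      next
        case False
        then show ?thesis using insert(5) by (auto simp: direct_sum_simps PiE_iff extensional_def)
      qed
    qed
    show ?case
      using add[OF mod_hom_closed[OF inj_at_hom[OF i(1)] i(2)] y inj[OF i] insert(3)[OF J y]] xy
      by simp
  qed
qed

text \<open>Zero components contribute nothing, so a larger finite index set may be used; with a common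
  one the values at different elements can be compared term by term.\<close>

lemma sum_lift_support:
  assumes "module K V" "\<And>i. i \<in> I \<Longrightarrow> h i \<in> mod_hom K (N i) V" "x \<in> carrier (direct_sum I N)"
    and "finite J" "J \<subseteq> I" "{i \<in> I. x i \<noteq> \<zero>\<^bsub>N i\<^esub>} \<subseteq> J"
  shows "sum_lift I N V h x = (\<Oplus>\<^bsub>V\<^esub>i\<in>J. h i (x i))"
proof -
  interpret module K V by fact
  have "h i \<zero>\<^bsub>N i\<^esub> = \<zero>\<^bsub>V\<^esub>" if "i \<in> I" for i
    using assms(2)[OF that] by (rule mod_hom_zero) (use that summand assms(1) in auto)
  moreover have "h i (x i) \<in> carrier V" if "i \<in> I" for i
    using that assms(3) by (intro mod_hom_closed[OF assms(2)]) (auto simp: direct_sum_simps)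
  ultimately show ?thesis
    unfolding sum_lift_def
    using assms(4-6) by (intro M.add.finprod_mono_neutral_cong) (auto intro: finite_subset)
qed

lemma sum_lift_hom:
  assumes V: "module K V" and h: "\<And>i. i \<in> I \<Longrightarrow> h i \<in> mod_hom K (N i) V"
  shows "sum_lift I N V h \<in> mod_hom K (direct_sum I N) V"
proof -
  interpret module K V by fact
  let ?S = "direct_sum I N" and ?L = "sum_lift I N V h"
  have hx: "h i (x i) \<in> carrier V" if "i \<in> I" "x \<in> carrier ?S" for i x
    using that by (intro mod_hom_closed[OF h]) (auto simp: direct_sum_simps)
  show ?thesis
  proof (rule mod_homI)
    fix x assume x: "x \<in> carrier ?S"
    then show "?L x \<in> carrier V"
      unfolding sum_lift_def using hx by (intro M.finsum_closed) auto
  next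
    fix x y assume xy: "x \<in> carrier ?S" "y \<in> carrier ?S"
    define J where "J = {i \<in> I. x i \<noteq> \<zero>\<^bsub>N i\<^esub>} \<union> {i \<in> I. y i \<noteq> \<zero>\<^bsub>N i\<^esub>}"
    have J: "finite J" "J \<subseteq> I" using xy by (auto simp: J_def direct_sum_simps)
    have "(x \<oplus>\<^bsub>?S\<^esub> y) i = \<zero>\<^bsub>N i\<^esub>" if "i \<in> I" "i \<notin> J" for i
    proof -
      interpret Ni: module K "N i" using summand that by blast
      show ?thesis using that by (auto simp: J_def direct_sum_simps)
    qed
    then have "?L (x \<oplus>\<^bsub>?S\<^esub> y) = (\<Oplus>\<^bsub>V\<^esub>i\<in>J. h i ((x \<oplus>\<^bsub>?S\<^esub> y) i))"
      by (intro sum_lift_support V h S.M.a_closed xy J) auto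
    also have "\<dots> = (\<Oplus>\<^bsub>V\<^esub>i\<in>J. h i (x i) \<oplus>\<^bsub>V\<^esub> h i (y i))"
      using J xy hx
      by (intro M.finsum_cong') (auto simp: direct_sum_simps intro!: mod_hom_add[OF h])
    also have "\<dots> = (\<Oplus>\<^bsub>V\<^esub>i\<in>J. h i (x i)) \<oplus>\<^bsub>V\<^esub> (\<Oplus>\<^bsub>V\<^esub>i\<in>J. h i (y i))"
      using J xy hx by (intro M.finsum_addf) auto
    also have "\<dots> = ?L x \<oplus>\<^bsub>V\<^esub> ?L y"
      using J xy by (subst (1 2) sum_lift_support[OF V h _ J]) (auto simp: J_def)
    finally show "?L (x \<oplus>\<^bsub>?S\<^esub> y) = ?L x \<oplus>\<^bsub>V\<^esub> ?L y" .
  next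
    fix a x assume ax: "a \<in> carrier K" "x \<in> carrier ?S"
    define J where "J = {i \<in> I. x i \<noteq> \<zero>\<^bsub>N i\<^esub>}"
    have J: "finite J" "J \<subseteq> I" using ax by (auto simp: J_def direct_sum_simps)
    have "(a \<odot>\<^bsub>?S\<^esub> x) i = \<zero>\<^bsub>N i\<^esub>" if "i \<in> I" "i \<notin> J" for i
    proof -
      interpret Ni: module K "N i" using summand that by blast
      show ?thesis using that ax by (auto simp: J_def direct_sum_simps)
    qed
    then have "?L (a \<odot>\<^bsub>?S\<^esub> x) = (\<Oplus>\<^bsub>V\<^esub>i\<in>J. h i ((a \<odot>\<^bsub>?S\<^esub> x) i))"
      by (intro sum_lift_support V h S.smult_closed ax J) auto
    also have "\<dots> = (\<Oplus>\<^bsub>V\<^esub>i\<in>J. a \<odot>\<^bsub>V\<^esub> h i (x i))"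
      using J ax hx
      by (intro M.finsum_cong') (auto simp: direct_sum_simps intro!: mod_hom_smult[OF h])
    also have "\<dots> = a \<odot>\<^bsub>V\<^esub> ?L x"
      using J ax hx by (simp add: sum_lift_def J_def[symmetric] finsum_smult_ldistr Pi_iff subset_iff)
    finally show "?L (a \<odot>\<^bsub>?S\<^esub> x) = a \<odot>\<^bsub>V\<^esub> ?L x" .
  qed
qed

lemma sum_lift_inj_at:
  assumes V: "module K V" and h: "\<And>i. i \<in> I \<Longrightarrow> h i \<in> mod_hom K (N i) V"
    and i: "i \<in> I" "t \<in> carrier (N i)"
  shows "sum_lift I N V h (inj_at I N i t) = h i t"
proof -
  interpret module K V by fact
  have "h i t \<in> carrier V" using mod_hom_closed[OF h[OF i(1)] i(2)] .
  moreover have "sum_lift I N V h (inj_at I N i t) = (\<Oplus>\<^bsub>V\<^esub>j\<in>{i}. h j (inj_at I N i t j))"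
    by (intro sum_lift_support V h mod_hom_closed[OF inj_at_hom] i)
      (auto simp: inj_at_def i split: if_splits)
  ultimately show ?thesis using i by (simp add: inj_at_def M.finsum_insert)
qed

lemma direct_sum_hom_eq:
  assumes "module K V" "f \<in> mod_hom K (direct_sum I N) V" "g \<in> mod_hom K (direct_sum I N) V"
    and "\<And>i t. i \<in> I \<Longrightarrow> t \<in> carrier (N i) \<Longrightarrow> f (inj_at I N i t) = g (inj_at I N i t)"
    and "x \<in> carrier (direct_sum I N)"
  shows "f x = g x"
  using assms(5)
  by (induction x rule: direct_sum_induct)
    (simp_all add: mod_hom_zero[OF assms(2) S.module_axioms assms(1)]
      mod_hom_zero[OF assms(3) S.module_axioms assms(1)] assms(4) mod_hom_add[OF assms(2)]
      mod_hom_add[OF assms(3)])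

end

section \<open>Free modules\<close>

lemma self_module_simps [simp]:
  "carrier (self_module K) = carrier K" "\<zero>\<^bsub>self_module K\<^esub> = \<zero>\<^bsub>K\<^esub>"
  "a \<oplus>\<^bsub>self_module K\<^esub> b = a \<oplus>\<^bsub>K\<^esub> b" "a \<odot>\<^bsub>self_module K\<^esub> b = a \<otimes>\<^bsub>K\<^esub> b"
  by (simp_all add: self_module_def)

lemma self_module_module:
  assumes "cring K" shows "module K (self_module K)"
proof -
  interpret cring K by fact
  show ?thesis
  proof (rule moduleI)
    show "abelian_group (self_module K)"
      by (rule abelian_groupI) (auto simp: a_ac intro: l_neg)
  qed (auto simp: is_cring l_distr r_distr m_assoc)
qed

definition free_lift ::
  "('k, 'a) ring_scheme \<Rightarrow> 'i set \<Rightarrow> ('k, 'v, 'c) module_scheme \<Rightarrow> ('i \<Rightarrow> 'v) \<Rightarrow> ('i \<Rightarrow> 'k) \<Rightarrow> 'v"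
  where "free_lift K X V \<phi> = sum_lift X (\<lambda>_. self_module K) V (\<lambda>i a. a \<odot>\<^bsub>V\<^esub> \<phi> i)"

lemma smult_hom:
  assumes "module K V" "v \<in> carrier V"
  shows "(\<lambda>a. a \<odot>\<^bsub>V\<^esub> v) \<in> mod_hom K (self_module K) V"
proof -
  interpret module K V by fact
  show ?thesis using assms(2) by (intro mod_homI) (simp_all add: smult_l_distr smult_assoc1)
qed

context
  fixes K :: "('k, 'a) ring_scheme" and X :: "'i set"
  assumes cring: "cring K"
begin

interpretation K: cring K by (rule cring)

lemma free_module_module: "module K (free_module K X)"
  unfolding free_module_def by (intro direct_sum_module cring self_module_module)

lemma basis_elt_inj_at: "basis_elt K X i = inj_at X (\<lambda>_. self_module K) i \<one>\<^bsub>K\<^esub>"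
  by (simp add: basis_elt_def inj_at_def cong: if_cong)

lemma basis_elt_closed: "i \<in> X \<Longrightarrow> basis_elt K X i \<in> carrier (free_module K X)"
  unfolding basis_elt_inj_at free_module_def
  using mod_hom_closed[OF inj_at_hom[OF cring self_module_module[OF cring]], of i X "\<one>\<^bsub>K\<^esub>"] by simp

lemma inj_at_basis:
  assumes "i \<in> X" "a \<in> carrier K"
  shows "inj_at X (\<lambda>_. self_module K) i a = a \<odot>\<^bsub>free_module K X\<^esub> basis_elt K X i"
proof -
  have "inj_at X (\<lambda>_. self_module K) i (a \<odot>\<^bsub>self_module K\<^esub> \<one>\<^bsub>K\<^esub>)
      = a \<odot>\<^bsub>free_module K X\<^esub> inj_at X (\<lambda>_. self_module K) i \<one>\<^bsub>K\<^esub>"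
    unfolding free_module_def
    by (rule mod_hom_smult[OF inj_at_hom[OF cring self_module_module[OF cring] assms(1)] assms(2)]) simp
  then show ?thesis using assms by (simp add: basis_elt_inj_at)
qed

lemma free_module_induct [consumes 1, case_names zero basis add]:
  assumes "c \<in> carrier (free_module K X)"
    and "Q \<zero>\<^bsub>free_module K X\<^esub>"
    and "\<And>i a. i \<in> X \<Longrightarrow> a \<in> carrier K \<Longrightarrow> Q (a \<odot>\<^bsub>free_module K X\<^esub> basis_elt K X i)"
    and "\<And>x y. x \<in> carrier (free_module K X) \<Longrightarrow> y \<in> carrier (free_module K X) \<Longrightarrow>
      Q x \<Longrightarrow> Q y \<Longrightarrow> Q (x \<oplus>\<^bsub>free_module K X\<^esub> y)"
  shows "Q c"
  using assms(1)[unfolded free_module_def]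
proof (induction c rule: direct_sum_induct[OF cring self_module_module[OF cring], consumes 1])
  case (2 i t)
  then show ?case using assms(3)[of i t] by (simp add: inj_at_basis)
qed (use assms in \<open>simp_all add: free_module_def\<close>)

lemma free_lift_hom:
  assumes "module K V" "\<And>i. i \<in> X \<Longrightarrow> \<phi> i \<in> carrier V"
  shows "free_lift K X V \<phi> \<in> mod_hom K (free_module K X) V"
  unfolding free_lift_def free_module_def
  by (intro sum_lift_hom cring self_module_module assms smult_hom)

lemma free_lift_basis:
  assumes "module K V" "\<And>i. i \<in> X \<Longrightarrow> \<phi> i \<in> carrier V" "i \<in> X"
  shows "free_lift K X V \<phi> (basis_elt K X i) = \<phi> i"
proof -
  interpret V: module K V by fact
  show ?thesis
    unfolding free_lift_def basis_elt_inj_at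
    using assms by (subst sum_lift_inj_at[OF cring self_module_module[OF cring] assms(1)])
      (auto intro: smult_hom)
qed

lemma free_module_hom_eq:
  assumes "module K V" "f \<in> mod_hom K (free_module K X) V" "g \<in> mod_hom K (free_module K X) V"
    and "\<And>i. i \<in> X \<Longrightarrow> f (basis_elt K X i) = g (basis_elt K X i)"
    and "c \<in> carrier (free_module K X)"
  shows "f c = g c"
  using assms(5)
  by (induction c rule: free_module_induct)
    (simp_all add: assms(4) mod_hom_zero[OF assms(2) free_module_module assms(1)]
      mod_hom_zero[OF assms(3) free_module_module assms(1)]
      mod_hom_add[OF assms(2)] mod_hom_add[OF assms(3)] basis_elt_closed
      mod_hom_smult[OF assms(2)] mod_hom_smult[OF assms(3)])

end

section \<open>Quotient modules\<close>

lemma submodule_generated_submodule: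
  assumes "module K V" "S \<subseteq> carrier V"
  shows "submodule (submodule_generated K V S) K V"
proof -
  interpret module K V by fact
  let ?A = "{N. submodule N K V \<and> S \<subseteq> N}"
  have z: "\<zero>\<^bsub>V\<^esub> \<in> N" if "submodule N K V" for N
    using submoduleE(1,2,4)[OF that]
    by (metis R.zero_closed smult_l_null all_not_in_conv subsetD)
  have "carrier V \<in> ?A" using carrier_is_submodule assms(2) by simp
  then show ?thesis
    unfolding submodule_generated_def
    by (intro submoduleI) (auto simp: z submoduleE)
qed

lemma submodule_generated_subset:
  "submodule N K V \<Longrightarrow> S \<subseteq> N \<Longrightarrow> submodule_generated K V S \<subseteq> N"
  by (auto simp: submodule_generated_def)

lemma submodule_generated_incl: "S \<subseteq> submodule_generated K V S"
  by (auto simp: submodule_generated_def)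

text \<open>The value at a coset is taken at a representative; the choice is irrelevant once \<open>h\<close>
  vanishes on the submodule.\<close>

definition quotient_lift :: "('v \<Rightarrow> 'w) \<Rightarrow> 'v set \<Rightarrow> 'w"
  where "quotient_lift h X = h (SOME x. x \<in> X)"

context
  fixes K :: "('k, 'a) ring_scheme" and V :: "('k, 'v, 'c) module_scheme" and N :: "'v set"
  assumes V: "module K V" and N: "submodule N K V"
begin

interpretation V: module K V by (rule V)

interpretation N: abelian_subgroup N V
  using N by (intro abelian_subgroupI3 additive_subgroup.intro V.abelian_group_axioms)
    (simp add: submodule_def)

lemma coset_add:
  "x \<in> carrier V \<Longrightarrow> y \<in> carrier V \<Longrightarrow> (N +>\<^bsub>V\<^esub> x) <+>\<^bsub>V\<^esub> (N +>\<^bsub>V\<^esub> y) = N +>\<^bsub>V\<^esub> (x \<oplus>\<^bsub>V\<^esub> y)"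
  by (rule N.a_rcos_sum)

lemma coset_eq_iff:
  assumes "x \<in> carrier V" "y \<in> carrier V"
  shows "N +>\<^bsub>V\<^esub> x = N +>\<^bsub>V\<^esub> y \<longleftrightarrow> x \<ominus>\<^bsub>V\<^esub> y \<in> N"
proof -
  have "N +>\<^bsub>V\<^esub> x = N +>\<^bsub>V\<^esub> y \<longleftrightarrow> x \<in> N +>\<^bsub>V\<^esub> y"
    using assms N.a_repr_independence'[of x y] N.a_repr_independenceD[of x y] by metis
  then show ?thesis
    using N.a_rcos_module[OF assms(2,1)] by (simp add: V.M.minus_eq)
qed

lemma coset_mem: "x \<in> carrier V \<Longrightarrow> x \<in> N +>\<^bsub>V\<^esub> x"
  by (rule N.a_rcos_self)

lemma coset_rep:
  "x \<in> carrier V \<Longrightarrow> y \<in> N +>\<^bsub>V\<^esub> x \<Longrightarrow> y \<in> carrier V \<and> N +>\<^bsub>V\<^esub> y = N +>\<^bsub>V\<^esub> x"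
  using N.a_repr_independence'[of y x] N.a_elemrcos_carrier[of x y] by simp

lemma quotient_carrier: "carrier (quotient_module V N) = (\<lambda>x. N +>\<^bsub>V\<^esub> x) ` carrier V"
  by (auto simp: quotient_module_def A_RCOSETS_def')

lemma quotient_smult:
  assumes "a \<in> carrier K" "x \<in> carrier V"
  shows "a \<odot>\<^bsub>quotient_module V N\<^esub> (N +>\<^bsub>V\<^esub> x) = N +>\<^bsub>V\<^esub> (a \<odot>\<^bsub>V\<^esub> x)"
proof -
  have "N +>\<^bsub>V\<^esub> (a \<odot>\<^bsub>V\<^esub> y) = N +>\<^bsub>V\<^esub> (a \<odot>\<^bsub>V\<^esub> x)" if "y \<in> N +>\<^bsub>V\<^esub> x" for y
  proof -
    have y: "y \<in> carrier V" "y \<ominus>\<^bsub>V\<^esub> x \<in> N"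
      using coset_rep[OF assms(2) that] coset_eq_iff[of y x] assms(2) by auto
    have "a \<odot>\<^bsub>V\<^esub> (y \<ominus>\<^bsub>V\<^esub> x) \<in> N" using y assms(1) V.submoduleE(4)[OF N] by blast
    moreover have "a \<odot>\<^bsub>V\<^esub> (y \<ominus>\<^bsub>V\<^esub> x) = a \<odot>\<^bsub>V\<^esub> y \<ominus>\<^bsub>V\<^esub> a \<odot>\<^bsub>V\<^esub> x"
      using y assms by (simp add: V.M.minus_eq V.smult_r_distr V.smult_r_minus)
    ultimately show ?thesis using y assms by (simp add: coset_eq_iff)
  qed
  then have "(\<Union>y\<in>N +>\<^bsub>V\<^esub> x. N +>\<^bsub>V\<^esub> (a \<odot>\<^bsub>V\<^esub> y)) = N +>\<^bsub>V\<^esub> (a \<odot>\<^bsub>V\<^esub> x)"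
    using coset_mem[OF assms(2)] by blast
  then show ?thesis by (simp add: quotient_module_def)
qed

lemma quotient_add:
  "x \<in> carrier V \<Longrightarrow> y \<in> carrier V \<Longrightarrow>
    (N +>\<^bsub>V\<^esub> x) \<oplus>\<^bsub>quotient_module V N\<^esub> (N +>\<^bsub>V\<^esub> y) = N +>\<^bsub>V\<^esub> (x \<oplus>\<^bsub>V\<^esub> y)"
  by (simp add: quotient_module_def coset_add)

lemma coset_null: "x \<in> N \<Longrightarrow> N +>\<^bsub>V\<^esub> x = N"
  by (rule N.a_rcos_const)

lemma quotient_zero: "\<zero>\<^bsub>quotient_module V N\<^esub> = N +>\<^bsub>V\<^esub> \<zero>\<^bsub>V\<^esub>"
  by (simp add: quotient_module_def coset_null)

lemma quotient_module_module: "module K (quotient_module V N)"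
proof (rule moduleI)
  show "cring K" by (rule V.R.is_cring)
  show "abelian_group (quotient_module V N)"
  proof (rule abelian_groupI)
    fix X assume "X \<in> carrier (quotient_module V N)"
    then obtain x where x: "x \<in> carrier V" "X = N +>\<^bsub>V\<^esub> x" by (auto simp: quotient_carrier)
    show "\<exists>Y\<in>carrier (quotient_module V N). Y \<oplus>\<^bsub>quotient_module V N\<^esub> X = \<zero>\<^bsub>quotient_module V N\<^esub>"
      using x by (intro bexI[of _ "N +>\<^bsub>V\<^esub> (\<ominus>\<^bsub>V\<^esub> x)"])
        (simp_all add: quotient_add quotient_zero quotient_carrier V.M.l_neg)
  qed (auto simp: quotient_carrier quotient_add quotient_zero V.M.a_ac)
qed (auto simp: quotient_carrier quotient_add quotient_smult V.smult_l_distr V.smult_r_distr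
    V.smult_assoc1)

lemma coset_hom: "(\<lambda>x. N +>\<^bsub>V\<^esub> x) \<in> mod_hom K V (quotient_module V N)"
  by (intro mod_homI) (auto simp: quotient_carrier quotient_add quotient_smult)

context
  fixes W :: "('k, 'w, 'd) module_scheme" and h
  assumes W: "module K W" and h: "h \<in> mod_hom K V W" and null: "\<And>x. x \<in> N \<Longrightarrow> h x = \<zero>\<^bsub>W\<^esub>"
begin

lemma quotient_lift_coset:
  assumes "x \<in> carrier V" shows "quotient_lift h (N +>\<^bsub>V\<^esub> x) = h x"
proof -
  interpret W: module K W by (rule W)
  define y where "y = (SOME y. y \<in> N +>\<^bsub>V\<^esub> x)"
  have "y \<in> N +>\<^bsub>V\<^esub> x" unfolding y_def by (rule someI) (rule coset_mem[OF assms])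
  then have y: "y \<in> carrier V" "y \<ominus>\<^bsub>V\<^esub> x \<in> N"
    using coset_rep[OF assms] coset_eq_iff[of y x] assms by auto
  have "h y = h (y \<ominus>\<^bsub>V\<^esub> x) \<oplus>\<^bsub>W\<^esub> h x"
    using y assms by (simp add: mod_hom_add[OF h, symmetric] V.M.minus_eq V.M.a_assoc V.M.l_neg)
  then show ?thesis
    using null[OF y(2)] mod_hom_closed[OF h assms] by (simp add: quotient_lift_def y_def[symmetric])
qed

lemma quotient_lift_hom: "quotient_lift h \<in> mod_hom K (quotient_module V N) W"
  by (intro mod_homI) (auto simp: quotient_carrier quotient_add quotient_smult quotient_lift_coset
      mod_hom_closed[OF h] mod_hom_add[OF h] mod_hom_smult[OF h])

end

end

section \<open>Tensor powers\<close>

text \<open>Linearity in each letter is stated for a letter between two fixed words, which is the format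
  of the multilinearity relations.\<close>

definition multilinear_map ::
  "('k, 'a) ring_scheme \<Rightarrow> ('k, 'm, 'b) module_scheme \<Rightarrow> nat \<Rightarrow> ('k, 'w, 'd) module_scheme
    \<Rightarrow> ('m list \<Rightarrow> 'w) \<Rightarrow> bool"
  where "multilinear_map K M n W \<phi> \<longleftrightarrow>
    (\<forall>w\<in>words M n. \<phi> w \<in> carrier W) \<and>
    (\<forall>u v. set u \<subseteq> carrier M \<longrightarrow> set v \<subseteq> carrier M \<longrightarrow> Suc (length u + length v) = n \<longrightarrow>
      (\<lambda>x. \<phi> (u @ x # v)) \<in> mod_hom K M W)"

lemma multilinear_map_closed: "multilinear_map K M n W \<phi> \<Longrightarrow> w \<in> words M n \<Longrightarrow> \<phi> w \<in> carrier W"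
  by (simp add: multilinear_map_def)

lemma multilinear_map_hom:
  "multilinear_map K M n W \<phi> \<Longrightarrow> set u \<subseteq> carrier M \<Longrightarrow> set v \<subseteq> carrier M \<Longrightarrow>
    Suc (length u + length v) = n \<Longrightarrow> (\<lambda>x. \<phi> (u @ x # v)) \<in> mod_hom K M W"
  by (simp add: multilinear_map_def)

context
  fixes K :: "('k, 'a) ring_scheme" and M :: "('k, 'm, 'b) module_scheme"
  assumes M: "module K M"
begin

interpretation M: module K M by (rule M)

abbreviation (input) "word_module n \<equiv> free_module K (words M n)"

lemmas word_module_module = free_module_module[OF M.R.is_cring, of "words M n" for n]
lemmas word_closed = basis_elt_closed[OF M.R.is_cring, of _ "words M n" for n]

lemma words_insert:
  "set u \<subseteq> carrier M \<Longrightarrow> set v \<subseteq> carrier M \<Longrightarrow> x \<in> carrier M \<Longrightarrow> u @ x # v \<in> words M (Suc (length u + length v))"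
  by (auto simp: words_def)

lemma multilinear_relations_closed: "multilinear_relations K M n \<subseteq> carrier (word_module n)"
proof -
  interpret F: module K "word_module n" by (rule word_module_module)
  have e: "basis_elt K (words M n) (u @ x # v) \<in> carrier (word_module n)"
    if "set u \<subseteq> carrier M" "set v \<subseteq> carrier M" "x \<in> carrier M" "Suc (length u + length v) = n" for u v x
    using word_closed[OF words_insert[OF that(1-3)]] that(4) by simp
  show ?thesis
    unfolding multilinear_relations_def Let_def
    by (rule subsetI, elim UnE CollectE exE conjE) (simp_all add: e)
qed

lemma tensor_null_submodule: "submodule (tensor_null K M n) K (word_module n)"
  unfolding tensor_null_def
  by (intro submodule_generated_submodule word_module_module multilinear_relations_closed)

lemma tensor_power_module: "module K (tensor_power K M n)"
  unfolding tensor_power_def by (intro quotient_module_module word_module_module tensor_null_submodule)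

lemma tensor_power_carrier:
  "carrier (tensor_power K M n) = (\<lambda>p. tensor_null K M n +>\<^bsub>word_module n\<^esub> p) ` carrier (word_module n)"
  unfolding tensor_power_def by (rule quotient_carrier[OF word_module_module tensor_null_submodule])

lemma tensor_coset_hom:
  "(\<lambda>p. tensor_null K M n +>\<^bsub>word_module n\<^esub> p) \<in> mod_hom K (word_module n) (tensor_power K M n)"
  unfolding tensor_power_def by (rule coset_hom[OF word_module_module tensor_null_submodule])

lemma pure_tensor_coset:
  "w \<in> words M n \<Longrightarrow> pure_tensor K M w = tensor_null K M n +>\<^bsub>word_module n\<^esub> basis_elt K (words M n) w"
  by (auto simp: pure_tensor_def words_def)

lemma pure_tensor_closed: "w \<in> words M n \<Longrightarrow> pure_tensor K M w \<in> carrier (tensor_power K M n)"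
  by (simp add: pure_tensor_coset tensor_power_carrier word_closed)

lemma tensor_power_hom_eq:
  assumes W: "module K W" and f: "f \<in> mod_hom K (tensor_power K M n) W"
    and g: "g \<in> mod_hom K (tensor_power K M n) W"
    and eq: "\<And>w. w \<in> words M n \<Longrightarrow> f (pure_tensor K M w) = g (pure_tensor K M w)"
    and t: "t \<in> carrier (tensor_power K M n)"
  shows "f t = g t"
proof -
  obtain p where p: "p \<in> carrier (word_module n)" "t = tensor_null K M n +>\<^bsub>word_module n\<^esub> p"
    using t by (auto simp: tensor_power_carrier)
  show ?thesis
    unfolding p(2)
    by (rule free_module_hom_eq[OF M.R.is_cring W mod_hom_comp[OF f tensor_coset_hom]
          mod_hom_comp[OF g tensor_coset_hom] _ p(1)])
      (simp add: pure_tensor_coset[symmetric] eq)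
qed

lemma multilinear_pure_tensor: "multilinear_map K M n (tensor_power K M n) (pure_tensor K M)"
  unfolding multilinear_map_def
proof (intro conjI allI impI ballI)
  fix w assume "w \<in> words M n"
  then show "pure_tensor K M w \<in> carrier (tensor_power K M n)" by (rule pure_tensor_closed)
next
  fix u v assume uv: "set u \<subseteq> carrier M" "set v \<subseteq> carrier M" "Suc (length u + length v) = n"
  interpret F: module K "word_module n" by (rule word_module_module)
  let ?e = "basis_elt K (words M n)"
  have w: "u @ x # v \<in> words M n" if "x \<in> carrier M" for x
    using words_insert[OF uv(1,2) that] uv(3) by simp
  note null = subsetD[OF submodule_generated_incl[of "multilinear_relations K M n" K "word_module n",
        folded tensor_null_def]]
  note coset = pure_tensor_coset[OF w] and e = word_closed[OF w]
  note eqI = coset_eq_iff[OF word_module_module tensor_null_submodule]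
  show "(\<lambda>x. pure_tensor K M (u @ x # v)) \<in> mod_hom K M (tensor_power K M n)"
  proof (rule mod_homI)
    fix x assume x: "x \<in> carrier M"
    then show "pure_tensor K M (u @ x # v) \<in> carrier (tensor_power K M n)"
      by (intro pure_tensor_closed w)
  next
    fix x y assume xy: "x \<in> carrier M" "y \<in> carrier M"
    have "?e (u @ (x \<oplus>\<^bsub>M\<^esub> y) # v) \<ominus>\<^bsub>word_module n\<^esub> (?e (u @ x # v) \<oplus>\<^bsub>word_module n\<^esub> ?e (u @ y # v))
        \<in> multilinear_relations K M n"
      unfolding multilinear_relations_def Let_def using uv xy
      by (intro UnI1 CollectI exI[of _ u] exI[of _ v] exI[of _ x] exI[of _ y]) simp
    then have "pure_tensor K M (u @ (x \<oplus>\<^bsub>M\<^esub> y) # v) = tensor_null K M n +>\<^bsub>word_module n\<^esub>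
        (?e (u @ x # v) \<oplus>\<^bsub>word_module n\<^esub> ?e (u @ y # v))"
      using xy by (subst coset) (simp_all add: eqI e null)
    then show "pure_tensor K M (u @ (x \<oplus>\<^bsub>M\<^esub> y) # v)
        = pure_tensor K M (u @ x # v) \<oplus>\<^bsub>tensor_power K M n\<^esub> pure_tensor K M (u @ y # v)"
      using xy by (simp add: coset e mod_hom_add[OF tensor_coset_hom])
  next
    fix a x assume ax: "a \<in> carrier K" "x \<in> carrier M"
    have "?e (u @ (a \<odot>\<^bsub>M\<^esub> x) # v) \<ominus>\<^bsub>word_module n\<^esub> a \<odot>\<^bsub>word_module n\<^esub> ?e (u @ x # v)
        \<in> multilinear_relations K M n"
      unfolding multilinear_relations_def Let_def using uv ax
      by (intro UnI2 CollectI exI[of _ u] exI[of _ v] exI[of _ a] exI[of _ x]) simp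
    then have "pure_tensor K M (u @ (a \<odot>\<^bsub>M\<^esub> x) # v) = tensor_null K M n +>\<^bsub>word_module n\<^esub>
        (a \<odot>\<^bsub>word_module n\<^esub> ?e (u @ x # v))"
      using ax by (subst coset) (simp_all add: eqI e null)
    then show "pure_tensor K M (u @ (a \<odot>\<^bsub>M\<^esub> x) # v)
        = a \<odot>\<^bsub>tensor_power K M n\<^esub> pure_tensor K M (u @ x # v)"
      using ax by (simp add: coset e mod_hom_smult[OF tensor_coset_hom])
  qed
qed

lemma tensor_null_least:
  assumes "submodule H K (word_module n)"
    and "\<And>u v x y. x \<in> carrier M \<Longrightarrow> y \<in> carrier M \<Longrightarrow> set u \<subseteq> carrier M \<Longrightarrow> set v \<subseteq> carrier M \<Longrightarrow>
      Suc (length u + length v) = n \<Longrightarrow>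
      basis_elt K (words M n) (u @ (x \<oplus>\<^bsub>M\<^esub> y) # v) \<ominus>\<^bsub>word_module n\<^esub>
       (basis_elt K (words M n) (u @ x # v) \<oplus>\<^bsub>word_module n\<^esub> basis_elt K (words M n) (u @ y # v)) \<in> H"
    and "\<And>u v a x. a \<in> carrier K \<Longrightarrow> x \<in> carrier M \<Longrightarrow> set u \<subseteq> carrier M \<Longrightarrow> set v \<subseteq> carrier M \<Longrightarrow>
      Suc (length u + length v) = n \<Longrightarrow>
      basis_elt K (words M n) (u @ (a \<odot>\<^bsub>M\<^esub> x) # v) \<ominus>\<^bsub>word_module n\<^esub>
       a \<odot>\<^bsub>word_module n\<^esub> basis_elt K (words M n) (u @ x # v) \<in> H"
  shows "tensor_null K M n \<subseteq> H"
  unfolding tensor_null_def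
  by (rule submodule_generated_subset[OF assms(1)])
    (use assms(2,3) in \<open>auto simp: multilinear_relations_def Let_def\<close>)

text \<open>The kernel of \<open>g\<close> is a submodule that contains the multilinearity relations, hence also the
  submodule generated by them.\<close>

lemma multilinear_null:
  assumes W: "module K W" and \<phi>: "multilinear_map K M n W \<phi>"
    and g: "g \<in> mod_hom K (word_module n) W"
    and g\<phi>: "\<And>w. w \<in> words M n \<Longrightarrow> g (basis_elt K (words M n) w) = \<phi> w"
    and p: "p \<in> tensor_null K M n"
  shows "g p = \<zero>\<^bsub>W\<^esub>"
proof -
  interpret W: module K W by (rule W)
  interpret F: module K "word_module n" by (rule word_module_module)
  let ?H = "{p \<in> carrier (word_module n). g p \<in> {\<zero>\<^bsub>W\<^esub>}}"
  have minus: "p \<ominus>\<^bsub>word_module n\<^esub> q \<in> ?H"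
    if "p \<in> carrier (word_module n)" "q \<in> carrier (word_module n)" "g p = g q" for p q
  proof -
    have "g p = g ((p \<ominus>\<^bsub>word_module n\<^esub> q) \<oplus>\<^bsub>word_module n\<^esub> q)"
      using that by (simp add: F.M.minus_eq F.M.a_assoc F.M.l_neg)
    also have "\<dots> = g (p \<ominus>\<^bsub>word_module n\<^esub> q) \<oplus>\<^bsub>W\<^esub> g q"
      using that by (intro mod_hom_add[OF g]) auto
    finally show ?thesis
      using that mod_hom_closed[OF g] by (simp add: W.M.add.r_cancel_one')
  qed
  have "tensor_null K M n \<subseteq> ?H"
  proof (rule tensor_null_least)
    show "submodule ?H K (word_module n)"
      by (rule preimage_submodule[OF word_module_module W g zero_submodule[OF W]])
  next
    fix u v x y
    assume a: "x \<in> carrier M" "y \<in> carrier M" "set u \<subseteq> carrier M" "set v \<subseteq> carrier M"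
      "Suc (length u + length v) = n"
    then have w: "u @ z # v \<in> words M n" if "z \<in> carrier M" for z
      using words_insert that by blast
    have "(\<lambda>x. \<phi> (u @ x # v)) \<in> mod_hom K M W" using \<phi> a by (simp add: multilinear_map_def)
    from mod_hom_add[OF this a(1,2)]
    show "basis_elt K (words M n) (u @ (x \<oplus>\<^bsub>M\<^esub> y) # v) \<ominus>\<^bsub>word_module n\<^esub>
       (basis_elt K (words M n) (u @ x # v) \<oplus>\<^bsub>word_module n\<^esub> basis_elt K (words M n) (u @ y # v)) \<in> ?H"
      using a by (intro minus) (simp_all add: w word_closed mod_hom_add[OF g] g\<phi>)
  next
    fix u v c x
    assume a: "c \<in> carrier K" "x \<in> carrier M" "set u \<subseteq> carrier M" "set v \<subseteq> carrier M"
      "Suc (length u + length v) = n"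
    then have w: "u @ z # v \<in> words M n" if "z \<in> carrier M" for z
      using words_insert that by blast
    have "(\<lambda>x. \<phi> (u @ x # v)) \<in> mod_hom K M W" using \<phi> a by (simp add: multilinear_map_def)
    from mod_hom_smult[OF this a(1,2)]
    show "basis_elt K (words M n) (u @ (c \<odot>\<^bsub>M\<^esub> x) # v) \<ominus>\<^bsub>word_module n\<^esub>
       c \<odot>\<^bsub>word_module n\<^esub> basis_elt K (words M n) (u @ x # v) \<in> ?H"
      using a by (intro minus) (simp_all add: w word_closed mod_hom_smult[OF g] g\<phi>)
  qed
  then show ?thesis using p by blast
qed

definition tensor_lift :: "nat \<Rightarrow> ('k, 'w, 'd) module_scheme \<Rightarrow> ('m list \<Rightarrow> 'w) \<Rightarrow> ('m list \<Rightarrow> 'k) set \<Rightarrow> 'w"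
  where "tensor_lift n W \<phi> = quotient_lift (free_lift K (words M n) W \<phi>)"

lemma
  assumes W: "module K W" and \<phi>: "multilinear_map K M n W \<phi>"
  shows tensor_lift_hom: "tensor_lift n W \<phi> \<in> mod_hom K (tensor_power K M n) W"
    and tensor_lift_pure: "w \<in> words M n \<Longrightarrow> tensor_lift n W \<phi> (pure_tensor K M w) = \<phi> w"
proof -
  have cl: "\<And>w. w \<in> words M n \<Longrightarrow> \<phi> w \<in> carrier W" using \<phi> by (simp add: multilinear_map_def)
  note h = free_lift_hom[OF M.R.is_cring W, OF cl]
  note b = free_lift_basis[OF M.R.is_cring W, OF cl]
  note null = multilinear_null[OF W \<phi> h b]
  show "tensor_lift n W \<phi> \<in> mod_hom K (tensor_power K M n) W"
    unfolding tensor_lift_def tensor_power_def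
    by (rule quotient_lift_hom[OF word_module_module tensor_null_submodule W h null])
  show "tensor_lift n W \<phi> (pure_tensor K M w) = \<phi> w" if w: "w \<in> words M n"
    unfolding tensor_lift_def pure_tensor_coset[OF w]
    by (subst quotient_lift_coset[OF word_module_module tensor_null_submodule W h null])
      (simp_all add: word_closed w b)
qed


lemma word_module_simps:
  "carrier (word_module n) = {p \<in> words M n \<rightarrow>\<^sub>E carrier K. finite {w \<in> words M n. p w \<noteq> \<zero>\<^bsub>K\<^esub>}}"
  "p \<oplus>\<^bsub>word_module n\<^esub> q = (\<lambda>w\<in>words M n. p w \<oplus>\<^bsub>K\<^esub> q w)"
  "a \<odot>\<^bsub>word_module n\<^esub> p = (\<lambda>w\<in>words M n. a \<otimes>\<^bsub>K\<^esub> p w)"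
  by (simp_all add: free_module_def direct_sum_simps)

lemma words_append: "u \<in> words M m \<Longrightarrow> v \<in> words M n \<Longrightarrow> u @ v \<in> words M (m + n)"
  by (auto simp: words_def)

lemma words_take_drop: "w \<in> words M (m + n) \<Longrightarrow> take m w \<in> words M m \<and> drop m w \<in> words M n"
  by (auto simp: words_def dest: in_set_takeD in_set_dropD)

lemma word_module_coeff: "p \<in> carrier (word_module n) \<Longrightarrow> w \<in> words M n \<Longrightarrow> p w \<in> carrier K"
  by (auto simp: word_module_simps)

lemma concat_product_closed:
  assumes p: "p \<in> carrier (word_module m)" and q: "q \<in> carrier (word_module n)"
  shows "concat_product K M m n p q \<in> carrier (word_module (m + n))"
proof -
  let ?r = "concat_product K M m n p q"
  have "{w \<in> words M (m + n). ?r w \<noteq> \<zero>\<^bsub>K\<^esub>}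
      \<subseteq> (\<lambda>(u, v). u @ v) ` ({u \<in> words M m. p u \<noteq> \<zero>\<^bsub>K\<^esub>} \<times> {v \<in> words M n. q v \<noteq> \<zero>\<^bsub>K\<^esub>})"
  proof
    fix w assume "w \<in> {w \<in> words M (m + n). ?r w \<noteq> \<zero>\<^bsub>K\<^esub>}"
    then have w: "w \<in> words M (m + n)" "p (take m w) \<otimes>\<^bsub>K\<^esub> q (drop m w) \<noteq> \<zero>\<^bsub>K\<^esub>"
      by (auto simp: concat_product_def)
    then have "p (take m w) \<noteq> \<zero>\<^bsub>K\<^esub>" "q (drop m w) \<noteq> \<zero>\<^bsub>K\<^esub>"
      using words_take_drop[OF w(1)] word_module_coeff[OF p] word_module_coeff[OF q] by force+
    then show "w \<in> (\<lambda>(u, v). u @ v) ` ({u \<in> words M m. p u \<noteq> \<zero>\<^bsub>K\<^esub>} \<times> {v \<in> words M n. q v \<noteq> \<zero>\<^bsub>K\<^esub>})"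
      using words_take_drop[OF w(1)] by (intro image_eqI[of _ _ "(take m w, drop m w)"]) auto
  qed
  moreover have "finite \<dots>" using p q by (auto simp: word_module_simps)
  ultimately have "finite {w \<in> words M (m + n). ?r w \<noteq> \<zero>\<^bsub>K\<^esub>}" by (rule finite_subset)
  then show ?thesis
    using words_take_drop word_module_coeff[OF p] word_module_coeff[OF q]
    by (auto simp: word_module_simps concat_product_def)
qed

lemma concat_product_hom_left:
  assumes "q \<in> carrier (word_module n)"
  shows "(\<lambda>p. concat_product K M m n p q) \<in> mod_hom K (word_module m) (word_module (m + n))"
proof (rule mod_homI)
  fix p p' assume p: "p \<in> carrier (word_module m)" "p' \<in> carrier (word_module m)"
  show "concat_product K M m n (p \<oplus>\<^bsub>word_module m\<^esub> p') q
      = concat_product K M m n p q \<oplus>\<^bsub>word_module (m + n)\<^esub> concat_product K M m n p' q"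
    using words_take_drop word_module_coeff[OF p(1)] word_module_coeff[OF p(2)]
      word_module_coeff[OF assms]
    by (auto simp: word_module_simps(2) concat_product_def M.R.l_distr intro!: restrict_ext)
next
  fix a p assume p: "a \<in> carrier K" "p \<in> carrier (word_module m)"
  show "concat_product K M m n (a \<odot>\<^bsub>word_module m\<^esub> p) q
      = a \<odot>\<^bsub>word_module (m + n)\<^esub> concat_product K M m n p q"
    using p(1) words_take_drop word_module_coeff[OF p(2)] word_module_coeff[OF assms]
    by (auto simp: word_module_simps(3) concat_product_def M.R.m_assoc intro!: restrict_ext)
qed (rule concat_product_closed[OF _ assms])

lemma concat_product_hom_right:
  assumes "p \<in> carrier (word_module m)"
  shows "concat_product K M m n p \<in> mod_hom K (word_module n) (word_module (m + n))"
proof (rule mod_homI)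
  fix q q' assume q: "q \<in> carrier (word_module n)" "q' \<in> carrier (word_module n)"
  show "concat_product K M m n p (q \<oplus>\<^bsub>word_module n\<^esub> q')
      = concat_product K M m n p q \<oplus>\<^bsub>word_module (m + n)\<^esub> concat_product K M m n p q'"
    using words_take_drop word_module_coeff[OF q(1)] word_module_coeff[OF q(2)]
      word_module_coeff[OF assms]
    by (auto simp: word_module_simps(2) concat_product_def M.R.r_distr intro!: restrict_ext)
next
  fix a q assume q: "a \<in> carrier K" "q \<in> carrier (word_module n)"
  show "concat_product K M m n p (a \<odot>\<^bsub>word_module n\<^esub> q)
      = a \<odot>\<^bsub>word_module (m + n)\<^esub> concat_product K M m n p q"
    using q(1) words_take_drop word_module_coeff[OF q(2)] word_module_coeff[OF assms]
    by (auto simp: word_module_simps(3) concat_product_def M.R.m_lcomm intro!: restrict_ext)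
qed (rule concat_product_closed[OF assms])

text \<open>A word of length \<open>m + n\<close> can be cut after \<open>m\<close> letters in one way only.\<close>

lemma concat_product_basis:
  assumes "u \<in> words M m" "v \<in> words M n"
  shows "concat_product K M m n (basis_elt K (words M m) u) (basis_elt K (words M n) v)
    = basis_elt K (words M (m + n)) (u @ v)"
  unfolding concat_product_def basis_elt_def
proof (rule restrict_ext)
  fix w assume w: "w \<in> words M (m + n)"
  have "w = u @ v \<longleftrightarrow> take m w = u \<and> drop m w = v"
    using assms(1) append_eq_conv_conj[of u v w] by (auto simp: words_def)
  then show "(\<lambda>j\<in>words M m. if j = u then \<one>\<^bsub>K\<^esub> else \<zero>\<^bsub>K\<^esub>) (take m w)
      \<otimes>\<^bsub>K\<^esub> (\<lambda>j\<in>words M n. if j = v then \<one>\<^bsub>K\<^esub> else \<zero>\<^bsub>K\<^esub>) (drop m w)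
    = (if w = u @ v then \<one>\<^bsub>K\<^esub> else \<zero>\<^bsub>K\<^esub>)"
    using words_take_drop[OF w] by simp
qed

abbreviation (input) "tensor_concat m n p q \<equiv>
  tensor_null K M (m + n) +>\<^bsub>word_module (m + n)\<^esub> concat_product K M m n p q"

lemma tensor_concat_hom_left:
  "q \<in> carrier (word_module n) \<Longrightarrow>
    (\<lambda>p. tensor_concat m n p q) \<in> mod_hom K (word_module m) (tensor_power K M (m + n))"
  by (rule mod_hom_comp[OF tensor_coset_hom concat_product_hom_left])

lemma tensor_concat_hom_right:
  "p \<in> carrier (word_module m) \<Longrightarrow>
    tensor_concat m n p \<in> mod_hom K (word_module n) (tensor_power K M (m + n))"
  by (rule mod_hom_comp[OF tensor_coset_hom concat_product_hom_right])

lemma tensor_concat_basis: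
  "u \<in> words M m \<Longrightarrow> v \<in> words M n \<Longrightarrow>
    tensor_concat m n (basis_elt K (words M m) u) (basis_elt K (words M n) v) = pure_tensor K M (u @ v)"
  by (simp add: concat_product_basis pure_tensor_coset[OF words_append])

text \<open>By linearity \<open>p\<close> may be taken to be a single word \<open>u\<close>. Then the map in question sends a word
  \<open>v\<close> to the pure tensor of \<open>u @ v\<close>, which is multilinear in \<open>v\<close>.\<close>

lemma tensor_concat_null_right:
  assumes p: "p \<in> carrier (word_module m)" and q: "q \<in> tensor_null K M n"
  shows "tensor_concat m n p q = \<zero>\<^bsub>tensor_power K M (m + n)\<^esub>"
proof (rule free_module_hom_eq[OF M.R.is_cring tensor_power_module _ mod_hom_zero_fun _ p])
  interpret F: module K "word_module n" by (rule word_module_module)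
  have "q \<in> carrier (word_module n)" using q F.submoduleE(1)[OF tensor_null_submodule] by blast
  then show "(\<lambda>p. tensor_concat m n p q) \<in> mod_hom K (word_module m) (tensor_power K M (m + n))"
    by (rule tensor_concat_hom_left)
  fix u assume u: "u \<in> words M m"
  show "tensor_concat m n (basis_elt K (words M m) u) q = \<zero>\<^bsub>tensor_power K M (m + n)\<^esub>"
  proof (rule multilinear_null[OF tensor_power_module _ tensor_concat_hom_right[OF word_closed[OF u]] _ q])
    show "multilinear_map K M n (tensor_power K M (m + n)) (\<lambda>v. pure_tensor K M (u @ v))"
      unfolding multilinear_map_def
    proof (intro conjI allI impI ballI)
      fix v v' assume v: "set v \<subseteq> carrier M" "set v' \<subseteq> carrier M" "Suc (length v + length v') = n"
      have "(\<lambda>x. pure_tensor K M ((u @ v) @ x # v')) \<in> mod_hom K M (tensor_power K M (m + n))"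
        using u v by (intro multilinear_map_hom[OF multilinear_pure_tensor]) (auto simp: words_def)
      then show "(\<lambda>x. pure_tensor K M (u @ v @ x # v')) \<in> mod_hom K M (tensor_power K M (m + n))"
        by simp
    qed (intro pure_tensor_closed words_append u)
  qed (rule tensor_concat_basis[OF u])
qed (rule tensor_power_module)

lemma tensor_concat_null_left:
  assumes p: "p \<in> tensor_null K M m" and q: "q \<in> carrier (word_module n)"
  shows "tensor_concat m n p q = \<zero>\<^bsub>tensor_power K M (m + n)\<^esub>"
proof (rule free_module_hom_eq[OF M.R.is_cring tensor_power_module _ mod_hom_zero_fun _ q])
  interpret F: module K "word_module m" by (rule word_module_module)
  have "p \<in> carrier (word_module m)" using p F.submoduleE(1)[OF tensor_null_submodule] by blast
  then show "tensor_concat m n p \<in> mod_hom K (word_module n) (tensor_power K M (m + n))"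
    by (rule tensor_concat_hom_right)
  fix v assume v: "v \<in> words M n"
  show "tensor_concat m n p (basis_elt K (words M n) v) = \<zero>\<^bsub>tensor_power K M (m + n)\<^esub>"
  proof (rule multilinear_null[OF tensor_power_module _ tensor_concat_hom_left[OF word_closed[OF v]] _ p])
    show "multilinear_map K M m (tensor_power K M (m + n)) (\<lambda>u. pure_tensor K M (u @ v))"
      unfolding multilinear_map_def
    proof (intro conjI allI impI ballI)
      fix u u' assume u: "set u \<subseteq> carrier M" "set u' \<subseteq> carrier M" "Suc (length u + length u') = m"
      have "(\<lambda>x. pure_tensor K M (u @ x # (u' @ v))) \<in> mod_hom K M (tensor_power K M (m + n))"
        using u v by (intro multilinear_map_hom[OF multilinear_pure_tensor]) (auto simp: words_def)
      then show "(\<lambda>x. pure_tensor K M ((u @ x # u') @ v)) \<in> mod_hom K M (tensor_power K M (m + n))"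
        by simp
    qed (intro pure_tensor_closed words_append v)
  qed (rule tensor_concat_basis[OF _ v])
qed (rule tensor_power_module)

text \<open>Changing a representative changes the concatenation product by a product with a null factor,
  which is null; so the union in the definition of \<open>tensor_mult\<close> is a union of equal cosets.\<close>

lemma tensor_mult_coset:
  assumes p: "p \<in> carrier (word_module m)" and q: "q \<in> carrier (word_module n)"
  shows "tensor_mult K M m n (tensor_null K M m +>\<^bsub>word_module m\<^esub> p) (tensor_null K M n +>\<^bsub>word_module n\<^esub> q)
    = tensor_concat m n p q"
proof -
  interpret Fm: module K "word_module m" by (rule word_module_module)
  interpret Fn: module K "word_module n" by (rule word_module_module)
  interpret T: module K "tensor_power K M (m + n)" by (rule tensor_power_module)
  note rep = coset_rep[OF word_module_module tensor_null_submodule]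
  note eq_iff = coset_eq_iff[OF word_module_module tensor_null_submodule]
  note mem = coset_mem[OF word_module_module tensor_null_submodule]
  have "tensor_concat m n p' q' = tensor_concat m n p q"
    if p': "p' \<in> tensor_null K M m +>\<^bsub>word_module m\<^esub> p" and q': "q' \<in> tensor_null K M n +>\<^bsub>word_module n\<^esub> q"
    for p' q'
  proof -
    have c: "p' \<in> carrier (word_module m)" "q' \<in> carrier (word_module n)"
      using rep[OF p p'] rep[OF q q'] by auto
    have d: "p' \<ominus>\<^bsub>word_module m\<^esub> p \<in> tensor_null K M m" "q' \<ominus>\<^bsub>word_module n\<^esub> q \<in> tensor_null K M n"
      using rep[OF p p'] rep[OF q q'] eq_iff[OF c(1) p] eq_iff[OF c(2) q] by auto
    have "tensor_concat m n p' q' = tensor_concat m n ((p' \<ominus>\<^bsub>word_module m\<^esub> p) \<oplus>\<^bsub>word_module m\<^esub> p) q'"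
      using c p by (simp add: Fm.M.minus_eq Fm.M.a_assoc Fm.M.l_neg)
    also have "\<dots> = tensor_concat m n p q'"
      using c p mod_hom_closed[OF tensor_concat_hom_left[OF c(2)] p]
      by (simp add: mod_hom_add[OF tensor_concat_hom_left] tensor_concat_null_left[OF d(1)])
    also have "\<dots> = tensor_concat m n p ((q' \<ominus>\<^bsub>word_module n\<^esub> q) \<oplus>\<^bsub>word_module n\<^esub> q)"
      using c q by (simp add: Fn.M.minus_eq Fn.M.a_assoc Fn.M.l_neg)
    also have "\<dots> = tensor_concat m n p q"
      using c p q mod_hom_closed[OF tensor_concat_hom_right[OF p] q]
      by (simp add: mod_hom_add[OF tensor_concat_hom_right] tensor_concat_null_right[OF p d(2)])
    finally show ?thesis .
  qed
  then show ?thesis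
    unfolding tensor_mult_def using mem[OF p] mem[OF q] by blast
qed

lemma tensor_mult_hom_left:
  assumes "t \<in> carrier (tensor_power K M n)"
  shows "(\<lambda>s. tensor_mult K M m n s t) \<in> mod_hom K (tensor_power K M m) (tensor_power K M (m + n))"
proof -
  interpret F: module K "word_module m" by (rule word_module_module)
  obtain q where q: "q \<in> carrier (word_module n)" "t = tensor_null K M n +>\<^bsub>word_module n\<^esub> q"
    using assms by (auto simp: tensor_power_carrier)
  show ?thesis
    by (rule mod_homI) (auto simp: tensor_power_carrier[of m] q tensor_mult_coset
        mod_hom_closed[OF tensor_concat_hom_left[OF q(1)]]
        mod_hom_add[OF tensor_coset_hom[of m], symmetric] mod_hom_add[OF tensor_concat_hom_left[OF q(1)]]
        mod_hom_smult[OF tensor_coset_hom[of m], symmetric] mod_hom_smult[OF tensor_concat_hom_left[OF q(1)]])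
qed

lemma tensor_mult_hom_right:
  assumes "s \<in> carrier (tensor_power K M m)"
  shows "tensor_mult K M m n s \<in> mod_hom K (tensor_power K M n) (tensor_power K M (m + n))"
proof -
  interpret F: module K "word_module n" by (rule word_module_module)
  obtain p where p: "p \<in> carrier (word_module m)" "s = tensor_null K M m +>\<^bsub>word_module m\<^esub> p"
    using assms by (auto simp: tensor_power_carrier)
  show ?thesis
    by (rule mod_homI) (auto simp: tensor_power_carrier[of n] p tensor_mult_coset
        mod_hom_closed[OF tensor_concat_hom_right[OF p(1)]]
        mod_hom_add[OF tensor_coset_hom[of n], symmetric] mod_hom_add[OF tensor_concat_hom_right[OF p(1)]]
        mod_hom_smult[OF tensor_coset_hom[of n], symmetric] mod_hom_smult[OF tensor_concat_hom_right[OF p(1)]])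
qed

lemma tensor_mult_pure:
  "u \<in> words M m \<Longrightarrow> v \<in> words M n \<Longrightarrow>
    tensor_mult K M m n (pure_tensor K M u) (pure_tensor K M v) = pure_tensor K M (u @ v)"
  by (simp only: pure_tensor_coset tensor_mult_coset word_closed tensor_concat_basis words_append)

end

section \<open>Weighted combinations\<close>

text \<open>A multiset of pairs \<open>(i, x)\<close> stands for the formal sum of the \<open>\<lambda>\<^sup>i x\<close>. In this form the
  product of forests can be studied without a ground ring.\<close>

type_synonym 'x wcomb = "(nat \<times> 'x) multiset"

definition wmap :: "('x \<Rightarrow> 'y) \<Rightarrow> 'x wcomb \<Rightarrow> 'y wcomb"
  where "wmap h D = image_mset (apsnd h) D"

definition wshift :: "nat \<Rightarrow> 'x wcomb \<Rightarrow> 'x wcomb"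
  where "wshift k D = image_mset (apfst ((+) k)) D"

text \<open>The linear extension of \<open>f\<close>. Exponents add up because \<open>\<lambda>\<^sup>i \<lambda>\<^sup>j = \<lambda>\<^bsup>i+j\<^esup>\<close>.\<close>

definition wbind :: "'x wcomb \<Rightarrow> ('x \<Rightarrow> 'y wcomb) \<Rightarrow> 'y wcomb"
  where "wbind D f = (\<Sum>(i, x)\<in>#D. wshift i (f x))"

lemma wmap_simps [simp]:
  "wmap h {#} = {#}" "wmap h (add_mset (i, x) D) = add_mset (i, h x) (wmap h D)"
  "wmap h (D + E) = wmap h D + wmap h E"
  by (simp_all add: wmap_def)

lemma wshift_simps [simp]:
  "wshift k {#} = {#}" "wshift k (add_mset (i, x) D) = add_mset (k + i, x) (wshift k D)"
  "wshift k (D + E) = wshift k D + wshift k E"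
  by (simp_all add: wshift_def)

lemma wbind_simps [simp]:
  "wbind {#} f = {#}" "wbind (add_mset (i, x) D) f = wshift i (f x) + wbind D f"
  "wbind (D + E) f = wbind D f + wbind E f"
  by (simp_all add: wbind_def)

lemma wcomb_induct [case_names empty add]:
  assumes "Q {#}" and "\<And>i x D. Q D \<Longrightarrow> Q (add_mset (i, x) D)"
  shows "Q D"
  using assms by (induction D) auto

lemma wshift_wshift [simp]: "wshift i (wshift j D) = wshift (i + j) D"
  by (induction D rule: wcomb_induct) (simp_all add: add.assoc)

lemma wshift_0 [simp]: "wshift 0 D = D"
  by (induction D rule: wcomb_induct) simp_all

lemma wmap_wmap [simp]: "wmap g (wmap h D) = wmap (\<lambda>x. g (h x)) D"
  by (induction D rule: wcomb_induct) simp_all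

lemma wmap_wshift: "wmap h (wshift k D) = wshift k (wmap h D)"
  by (induction D rule: wcomb_induct) simp_all

lemma wbind_wmap: "wbind (wmap h D) f = wbind D (\<lambda>x. f (h x))"
  by (induction D rule: wcomb_induct) simp_all

lemma wmap_wbind: "wmap h (wbind D f) = wbind D (\<lambda>x. wmap h (f x))"
  by (induction D rule: wcomb_induct) (simp_all add: wmap_wshift)

lemma wbind_wshift: "wbind (wshift k D) f = wshift k (wbind D f)"
  by (induction D rule: wcomb_induct) simp_all

lemma wshift_wbind: "wbind D (\<lambda>x. wshift k (f x)) = wshift k (wbind D f)"
  by (induction D rule: wcomb_induct) (simp_all add: add.commute)

lemma wbind_add: "wbind D (\<lambda>x. f x + g x) = wbind D f + wbind D g"
  by (induction D rule: wcomb_induct) (simp_all add: ac_simps)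

lemma wbind_cong: "(\<And>i x. (i, x) \<in># D \<Longrightarrow> f x = g x) \<Longrightarrow> wbind D f = wbind D g"
  by (induction D rule: wcomb_induct) (simp_all, metis)

lemma wbind_commute: "wbind D (\<lambda>x. wmap (h x) E) = wbind E (\<lambda>y. wmap (\<lambda>x. h x y) D)"
proof (induction D rule: wcomb_induct)
  case empty
  show ?case by (induction E rule: wcomb_induct) simp_all
next
  case (add i x D)
  have "wbind E (\<lambda>y. wmap (\<lambda>x. h x y) (add_mset (i, x) D))
      = wshift i (wmap (h x) E) + wbind E (\<lambda>y. wmap (\<lambda>x. h x y) D)"
    by (induction E rule: wcomb_induct) (simp_all add: ac_simps)
  then show ?case using add by simp
qed

section \<open>The formal product of forests\<close>

text \<open>The recursion of \<open>tree_diamond\<close> with formal coefficients. The product of two trees only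
  involves forests with a single tree, so the values are combinations of trees; the three summands
  are the three terms of the Rota--Baxter identity.\<close>

function tree_expansion :: "ptree \<Rightarrow> ptree \<Rightarrow> ptree wcomb" where
  "tree_expansion (Node F) (Node G) =
    (if G = [] then {#(0, Node F)#} else if F = [] then {#(0, Node G)#}
     else wmap (\<lambda>T. Node (T # tl G)) (tree_expansion (Node F) (hd G))
        + wmap (\<lambda>T. Node (butlast F @ [T])) (tree_expansion (last F) (Node G))
        + wshift 1 (wmap (\<lambda>T. Node (butlast F @ T # tl G)) (tree_expansion (last F) (hd G))))"
  by pat_completeness auto
termination
proof (relation "measure (\<lambda>(S, T). size S + size T)", goal_cases)
  case (2 F G)
  then show ?case using size_member_Node[of "hd G" G] by simp
next
  case (3 F G)
  then show ?case using size_member_Node[of "last F" F] by simp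
next
  case (4 F G)
  then show ?case
    using size_member_Node[of "hd G" G] size_member_Node[of "last F" F] by simp
qed simp_all

declare tree_expansion.simps [simp del]

definition forest_expansion :: "pforest \<Rightarrow> pforest \<Rightarrow> pforest wcomb"
  where "forest_expansion F G = wmap (\<lambda>T. butlast F @ T # tl G) (tree_expansion (last F) (hd G))"

lemma tree_expansion_bullet_right [simp]: "tree_expansion S bullet = {#(0, S)#}"
  by (cases S) (simp add: tree_expansion.simps)

lemma tree_expansion_bullet_left [simp]: "tree_expansion bullet S = {#(0, S)#}"
  by (cases S) (simp add: tree_expansion.simps)

lemma tree_expansion_graft:
  "F \<noteq> [] \<Longrightarrow> G \<noteq> [] \<Longrightarrow> tree_expansion (Node F) (Node G) =
    wmap Node (forest_expansion [Node F] G + forest_expansion F [Node G] + wshift 1 (forest_expansion F G))"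
  by (simp add: tree_expansion.simps[of F G] forest_expansion_def wmap_wshift)

lemma forest_expansion_nonempty: "(i, X) \<in># forest_expansion F G \<Longrightarrow> X \<noteq> []"
  by (auto simp: forest_expansion_def wmap_def)

text \<open>If \<open>G\<close> has at least two trees, the two products alter different trees and do not interfere
  with each other. If \<open>G = [g]\<close>, three trees meet, and the claim is associativity for them.\<close>

lemma forest_expansion_assoc_aux:
  assumes "F \<noteq> []" "G \<noteq> []" "H \<noteq> []"
    and assoc: "\<And>g. G = [g] \<Longrightarrow>
      wbind (tree_expansion (last F) g) (\<lambda>X. tree_expansion X (hd H)) = wbind (tree_expansion g (hd H)) (\<lambda>X. tree_expansion (last F) X)"
  shows "wbind (forest_expansion F G) (\<lambda>X. forest_expansion X H) = wbind (forest_expansion G H) (forest_expansion F)"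
proof (cases "tl G = []")
  case True
  then obtain g where G: "G = [g]" using assms(2) by (cases G) auto
  have "wbind (forest_expansion F G) (\<lambda>X. forest_expansion X H) = wmap (\<lambda>T. butlast F @ T # tl H)
      (wbind (tree_expansion (last F) g) (\<lambda>X. tree_expansion X (hd H)))"
    by (simp add: G forest_expansion_def wbind_wmap wmap_wbind butlast_append)
  also have "\<dots> = wbind (forest_expansion G H) (forest_expansion F)"
    by (simp add: G forest_expansion_def wbind_wmap wmap_wbind assoc)
  finally show ?thesis .
next
  case False
  then obtain g G' z where G: "G = g # G' @ [z]"
    using assms(2) by (metis list.exhaust_sel rev_exhaust)
  show ?thesis
    by (simp add: G forest_expansion_def wbind_wmap wmap_wbind butlast_append)
      (rule wbind_commute)
qed

text \<open>For grafted trees \<open>S = Node F\<close>, \<open>T = Node G\<close>, \<open>U = Node H\<close> the recursion gives \<open>ST = \<lfloor>D\<rfloor>\<close>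
  with \<open>D = SG + FT + \<lambda>FG\<close> and \<open>TU = \<lfloor>E\<rfloor>\<close> with \<open>E = TH + GU + \<lambda>GH\<close>. Hence \<open>(ST)U\<close> is the grafting
  of \<open>(ST)H + DU + \<lambda>DH\<close> and \<open>S(TU)\<close> that of \<open>SE + F(TU) + \<lambda>FE\<close>. After inserting \<open>D\<close> and \<open>E\<close>, the
  two sums agree term by term by associativity for smaller triples.\<close>

lemma tree_expansion_assoc:
  "wbind (tree_expansion S T) (\<lambda>X. tree_expansion X U) = wbind (tree_expansion T U) (\<lambda>X. tree_expansion S X)"
proof (induction "size S + size T + size U" arbitrary: S T U rule: less_induct)
  case less
  obtain F G H where N: "S = Node F" "T = Node G" "U = Node H"
    by (meson ptree.exhaust)
  show ?case
  proof (cases "F = [] \<or> G = [] \<or> H = []")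
    case True
    have "wbind D (\<lambda>X. {#(0, X)#}) = D" for D :: "ptree wcomb"
      by (induction D rule: wcomb_induct) simp_all
    moreover have "tree_expansion bullet = (\<lambda>X. {#(0, X)#})"
      by (rule ext) simp
    ultimately show ?thesis using True N by auto
  next
    case False
    have hl: "hd G \<in> set G" "last F \<in> set F" "last G \<in> set G" "hd H \<in> set H" using False by auto
    note sz = size_member_Node[OF hl(1)] size_member_Node[OF hl(2)] size_member_Node[OF hl(3)]
      size_member_Node[OF hl(4)]
    have assoc: "wbind (forest_expansion A B) (\<lambda>X. forest_expansion X C) = wbind (forest_expansion B C) (forest_expansion A)"
      if "A \<noteq> []" "B \<noteq> []" "C \<noteq> []"
        "size (last A) + size (hd B) + size (hd C) < size S + size T + size U" for A B C
      using that by (intro forest_expansion_assoc_aux less) auto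
    note a = assoc[of "[S]" "[T]" H] assoc[of "[S]" G "[U]"] assoc[of F "[T]" "[U]"]
      assoc[of F G "[U]"] assoc[of "[S]" G H] assoc[of F "[T]" H] assoc[of F G H]
    define D where "D = forest_expansion [S] G + forest_expansion F [T] + wshift 1 (forest_expansion F G)"
    define E where "E = forest_expansion [T] H + forest_expansion G [U] + wshift 1 (forest_expansion G H)"
    have ST: "tree_expansion S T = wmap Node D" and TU: "tree_expansion T U = wmap Node E"
      using False by (simp_all add: N D_def E_def tree_expansion_graft)
    have neD: "Y \<noteq> []" if "(i, Y) \<in># D" for i Y
      using that by (auto simp: D_def wshift_def dest: forest_expansion_nonempty)
    have neE: "Y \<noteq> []" if "(i, Y) \<in># E" for i Y
      using that by (auto simp: E_def wshift_def dest: forest_expansion_nonempty)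
    \<comment> \<open>\<open>(ST)H\<close> and \<open>F(TU)\<close> are kept unexpanded: they are matched with the terms \<open>S(TH)\<close> of \<open>SE\<close>
      and \<open>(FT)U\<close> of \<open>DU\<close>.\<close>
    have D1: "wbind D (\<lambda>Y. forest_expansion [Node Y] H) = wbind (forest_expansion [S] [T]) (\<lambda>X. forest_expansion X H)"
      by (simp add: forest_expansion_def[of "[S]" "[T]"] ST wbind_wmap)
    have E1: "wbind E (\<lambda>Y. forest_expansion F [Node Y]) = wbind (forest_expansion [T] [U]) (forest_expansion F)"
      by (simp add: forest_expansion_def[of "[T]" "[U]"] TU wbind_wmap)
    have "wbind (tree_expansion S T) (\<lambda>X. tree_expansion X U)
        = wbind D (\<lambda>Y. wmap Node (forest_expansion [Node Y] H + forest_expansion Y [U] + wshift 1 (forest_expansion Y H)))"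
      using False neD unfolding ST wbind_wmap N(3)
      by (intro wbind_cong) (metis tree_expansion_graft)
    also have "\<dots> = wmap Node (wbind (forest_expansion [S] [T]) (\<lambda>X. forest_expansion X H) + wbind D (\<lambda>Y. forest_expansion Y [U])
         + wshift 1 (wbind D (\<lambda>Y. forest_expansion Y H)))"
      by (simp only: wmap_wbind[symmetric] wbind_add wshift_wbind D1)
    also have "\<dots> = wmap Node (wbind E (\<lambda>Y. forest_expansion [S] Y) + wbind (forest_expansion [T] [U]) (forest_expansion F)
         + wshift 1 (wbind E (\<lambda>Y. forest_expansion F Y)))"
      using False sz a by (simp add: D_def E_def N wbind_wshift ac_simps)
    also have "\<dots> = wbind E (\<lambda>Y. wmap Node (forest_expansion [S] Y + forest_expansion F [Node Y] + wshift 1 (forest_expansion F Y)))"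
      by (simp only: wmap_wbind[symmetric] wbind_add wshift_wbind E1)
    also have "\<dots> = wbind (tree_expansion T U) (\<lambda>X. tree_expansion S X)"
      using False neE unfolding TU wbind_wmap N(1)
      by (intro wbind_cong) (metis tree_expansion_graft)
    finally show ?thesis .
  qed
qed

lemma forest_expansion_assoc:
  "F \<noteq> [] \<Longrightarrow> G \<noteq> [] \<Longrightarrow> H \<noteq> [] \<Longrightarrow>
    wbind (forest_expansion F G) (\<lambda>X. forest_expansion X H) = wbind (forest_expansion G H) (forest_expansion F)"
  by (intro forest_expansion_assoc_aux tree_expansion_assoc)

lemma leaves_simps [simp]:
  "leaves [] = 0" "leaves (T # F) = tree_leaves T + leaves F" "leaves (F @ G) = leaves F + leaves G"
  by (simp_all add: leaves_def)

lemma tree_leaves_Node: "tree_leaves (Node F) = (if F = [] then 1 else leaves F)"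
  by (simp add: leaves_def)

lemma tree_leaves_pos: "0 < tree_leaves T"
proof (induction T)
  case (Node F)
  then show ?case by (cases F) auto
qed

declare tree_leaves.simps [simp del]

lemma leaves_pos: "F \<noteq> [] \<Longrightarrow> 0 < leaves F"
  by (cases F) (simp_all add: tree_leaves_pos)

lemma butlast_last_leaves: "F \<noteq> [] \<Longrightarrow> leaves F = leaves (butlast F) + tree_leaves (last F)"
  by (induction F rule: rev_induct) simp_all

lemma hd_tl_leaves: "F \<noteq> [] \<Longrightarrow> leaves F = tree_leaves (hd F) + leaves (tl F)"
  by (cases F) simp_all

lemma tree_leaves_tree_expansion: "(i, X) \<in># tree_expansion S T \<Longrightarrow> Suc (tree_leaves X) = tree_leaves S + tree_leaves T"
proof (induction S T arbitrary: i X rule: tree_expansion.induct)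
  case (1 F G)
  show ?case
  proof (cases "F = [] \<or> G = []")
    case True
    then show ?thesis using 1(4) by (auto simp: tree_leaves_Node)
  next
    case False
    then consider
        (left) T where "X = Node (T # tl G)" "(i, T) \<in># tree_expansion (Node F) (hd G)"
      | (right) T where "X = Node (butlast F @ [T])" "(i, T) \<in># tree_expansion (last F) (Node G)"
      | (both) j T where "X = Node (butlast F @ T # tl G)" "(j, T) \<in># tree_expansion (last F) (hd G)"
      using 1(4) unfolding tree_expansion.simps[of F G] by (auto simp: wmap_def wshift_def)
    then show ?thesis
    proof cases
      case left
      then show ?thesis
        using 1(1)[OF _ _ left(2)] False hd_tl_leaves[of G] by (simp add: tree_leaves_Node)
    next
      case right
      then show ?thesis
        using 1(2)[OF _ _ right(2)] False butlast_last_leaves[of F] by (simp add: tree_leaves_Node)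
    next
      case both
      then show ?thesis
        using 1(3)[OF _ _ both(2)] False butlast_last_leaves[of F] hd_tl_leaves[of G]
        by (simp add: tree_leaves_Node)
    qed
  qed
qed

lemma leaves_forest_expansion:
  "F \<noteq> [] \<Longrightarrow> G \<noteq> [] \<Longrightarrow> (i, X) \<in># forest_expansion F G \<Longrightarrow> Suc (leaves X) = leaves F + leaves G"
  using tree_leaves_tree_expansion[of _ _ "last F" "hd G"] butlast_last_leaves[of F] hd_tl_leaves[of G]
  by (fastforce simp: forest_expansion_def wmap_def)

text \<open>Single trees are kept apart from longer forests because a decoration sits between any two
  neighbouring trees, whereas grafting adds none.\<close>

lemma forest_induct [consumes 1, case_names bullet graft Cons]:
  assumes "F \<noteq> []"
    and bullet: "Q [bullet]"
    and graft: "\<And>F. F \<noteq> [] \<Longrightarrow> Q F \<Longrightarrow> Q [Node F]"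
    and Cons: "\<And>S G. G \<noteq> [] \<Longrightarrow> Q [S] \<Longrightarrow> Q G \<Longrightarrow> Q (S # G)"
  shows "Q F"
  using assms(1)
proof (induction "size_list size F" arbitrary: F rule: less_induct)
  case less
  then obtain F' G where F: "F = Node F' # G" by (metis list.exhaust ptree.exhaust)
  show ?case
  proof (cases "G = []")
    case True
    then show ?thesis using bullet graft less(1)[of F'] by (cases "F' = []") (simp_all add: F)
  next
    case False
    have "0 < size_list size G" using False by (cases G) simp_all
    then show ?thesis
      using False less(1)[of "[Node F']"] less(1)[of G] Cons by (simp add: F)
  qed
qed


section \<open>Weighted sums\<close>

text \<open>The element of \<open>V\<close> that a weighted combination stands for, with \<open>lam\<close> in place of \<open>\<lambda>\<close> and \<open>\<phi>
  x\<close> in place of \<open>x\<close>.\<close>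

definition wsum ::
  "('k, 'a) ring_scheme \<Rightarrow> 'k \<Rightarrow> ('k, 'v, 'c) module_scheme \<Rightarrow> ('x \<Rightarrow> 'v) \<Rightarrow> 'x wcomb \<Rightarrow> 'v"
  where "wsum K lam V \<phi> D = msum V (\<lambda>(i, x). (lam [^]\<^bsub>K\<^esub> i) \<odot>\<^bsub>V\<^esub> \<phi> x) D"

context
  fixes K :: "('k, 'a) ring_scheme" and lam :: 'k
  assumes cring: "cring K" and lam: "lam \<in> carrier K"
begin

interpretation K: cring K by (rule cring)

context
  fixes V :: "('k, 'v, 'c) module_scheme"
  assumes V: "module K V"
begin

interpretation V: module K V by (rule V)

lemma wsum_empty [simp]: "wsum K lam V \<phi> {#} = \<zero>\<^bsub>V\<^esub>"
  by (simp add: wsum_def msum_empty[OF V])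

lemma wsum_add_mset:
  assumes "\<phi> x \<in> carrier V" "\<And>i x. (i, x) \<in># D \<Longrightarrow> \<phi> x \<in> carrier V"
  shows "wsum K lam V \<phi> (add_mset (i, x) D) = (lam [^]\<^bsub>K\<^esub> i) \<odot>\<^bsub>V\<^esub> \<phi> x \<oplus>\<^bsub>V\<^esub> wsum K lam V \<phi> D"
  unfolding wsum_def using assms lam by (subst msum_add_mset[OF V]) auto

lemma wsum_closed:
  "(\<And>i x. (i, x) \<in># D \<Longrightarrow> \<phi> x \<in> carrier V) \<Longrightarrow> wsum K lam V \<phi> D \<in> carrier V"
  unfolding wsum_def using lam by (intro msum_closed[OF V]) auto

lemma wsum_single: "\<phi> x \<in> carrier V \<Longrightarrow> wsum K lam V \<phi> {#(0, x)#} = \<phi> x"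
  using wsum_add_mset[of \<phi> x "{#}" 0] by simp

lemma wsum_cong:
  assumes "\<And>i x. (i, x) \<in># D \<Longrightarrow> \<phi> x \<in> carrier V" "\<And>i x. (i, x) \<in># D \<Longrightarrow> \<phi> x = \<psi> x"
  shows "wsum K lam V \<phi> D = wsum K lam V \<psi> D"
  unfolding wsum_def using assms lam by (intro msum_cong[OF V]) auto

lemma wsum_union:
  assumes "\<And>i x. (i, x) \<in># D \<Longrightarrow> \<phi> x \<in> carrier V" "\<And>i x. (i, x) \<in># E \<Longrightarrow> \<phi> x \<in> carrier V"
  shows "wsum K lam V \<phi> (D + E) = wsum K lam V \<phi> D \<oplus>\<^bsub>V\<^esub> wsum K lam V \<phi> E"
  unfolding wsum_def using assms lam by (intro msum_union[OF V]) auto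

lemma wsum_wmap:
  assumes "\<And>i x. (i, x) \<in># D \<Longrightarrow> \<phi> (h x) \<in> carrier V"
  shows "wsum K lam V \<phi> (wmap h D) = wsum K lam V (\<lambda>x. \<phi> (h x)) D"
  unfolding wsum_def wmap_def using assms lam
  by (subst msum_image[OF V]) (auto simp: case_prod_unfold)

lemma wsum_wshift:
  assumes "\<And>i x. (i, x) \<in># D \<Longrightarrow> \<phi> x \<in> carrier V"
  shows "wsum K lam V \<phi> (wshift k D) = (lam [^]\<^bsub>K\<^esub> k) \<odot>\<^bsub>V\<^esub> wsum K lam V \<phi> D"
  using assms
proof (induction D rule: wcomb_induct)
  case empty
  then show ?case using lam by simp
next
  case (add i x D)
  have D: "\<And>i x. (i, x) \<in># D \<Longrightarrow> \<phi> x \<in> carrier V" and x: "\<phi> x \<in> carrier V"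
    using add(2) by auto
  have "\<And>i x. (i, x) \<in># wshift k D \<Longrightarrow> \<phi> x \<in> carrier V" using D by (auto simp: wshift_def)
  then show ?case
    using add(1)[OF D] x lam wsum_closed[OF D, of D]
    by (simp add: wsum_add_mset[of \<phi>, OF x] wsum_add_mset[of \<phi>, OF x D] V.smult_r_distr V.smult_assoc1[symmetric]
        K.nat_pow_mult)
qed

lemma wsum_rota_baxter:
  assumes "\<And>i x. (i, x) \<in># D + E + wshift 1 C \<Longrightarrow> \<phi> x \<in> carrier V"
  shows "wsum K lam V \<phi> (D + E + wshift 1 C)
    = wsum K lam V \<phi> D \<oplus>\<^bsub>V\<^esub> wsum K lam V \<phi> E \<oplus>\<^bsub>V\<^esub> lam \<odot>\<^bsub>V\<^esub> wsum K lam V \<phi> C"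
proof -
  have C: "\<phi> x \<in> carrier V" if "(i, x) \<in># C" for i x
    using assms[of "1 + i" x] that by (force simp: wshift_def)
  have "wsum K lam V \<phi> (wshift 1 C) = lam \<odot>\<^bsub>V\<^esub> wsum K lam V \<phi> C"
    using wsum_wshift[of C \<phi> 1, OF C] lam by simp
  moreover have "wsum K lam V \<phi> (D + E) = wsum K lam V \<phi> D \<oplus>\<^bsub>V\<^esub> wsum K lam V \<phi> E"
    using assms by (intro wsum_union) auto
  moreover have "wsum K lam V \<phi> (D + E + wshift 1 C)
      = wsum K lam V \<phi> (D + E) \<oplus>\<^bsub>V\<^esub> wsum K lam V \<phi> (wshift 1 C)"
    using assms by (intro wsum_union) auto
  ultimately show ?thesis by simp
qed

lemma wsum_wbind:
  assumes "\<And>i x j y. (i, x) \<in># D \<Longrightarrow> (j, y) \<in># f x \<Longrightarrow> \<phi> y \<in> carrier V"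
  shows "wsum K lam V \<phi> (wbind D f) = wsum K lam V (\<lambda>x. wsum K lam V \<phi> (f x)) D"
  using assms
proof (induction D rule: wcomb_induct)
  case empty
  then show ?case by simp
next
  case (add i x D)
  have D: "\<And>i x j y. (i, x) \<in># D \<Longrightarrow> (j, y) \<in># f x \<Longrightarrow> \<phi> y \<in> carrier V"
    and x: "\<And>j y. (j, y) \<in># f x \<Longrightarrow> \<phi> y \<in> carrier V"
    using add(2) by auto
  let ?\<psi> = "\<lambda>x. wsum K lam V \<phi> (f x)"
  have "\<And>j y. (j, y) \<in># wbind D f \<Longrightarrow> \<phi> y \<in> carrier V" "\<And>j y. (j, y) \<in># wshift i (f x) \<Longrightarrow> \<phi> y \<in> carrier V"
    using D x by (auto simp: wbind_def wshift_def)
  then have "wsum K lam V \<phi> (wbind (add_mset (i, x) D) f)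
      = (lam [^]\<^bsub>K\<^esub> i) \<odot>\<^bsub>V\<^esub> ?\<psi> x \<oplus>\<^bsub>V\<^esub> wsum K lam V \<phi> (wbind D f)"
    by (simp add: wsum_union wsum_wshift x)
  moreover have "wsum K lam V ?\<psi> (add_mset (i, x) D)
      = (lam [^]\<^bsub>K\<^esub> i) \<odot>\<^bsub>V\<^esub> ?\<psi> x \<oplus>\<^bsub>V\<^esub> wsum K lam V ?\<psi> D"
  proof (rule wsum_add_mset[where \<phi> = ?\<psi>])
    show "?\<psi> x \<in> carrier V" by (rule wsum_closed) (rule x)
    show "?\<psi> y \<in> carrier V" if "(j, y) \<in># D" for j y by (rule wsum_closed) (rule D[OF that])
  qed
  moreover have "wsum K lam V \<phi> (wbind D f) = wsum K lam V ?\<psi> D"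
    by (rule add(1)) (rule D)
  ultimately show ?case by simp
qed

lemma mod_hom_wsum:
  assumes "module K W" "g \<in> mod_hom K V W" "\<And>i x. (i, x) \<in># D \<Longrightarrow> \<phi> x \<in> carrier V"
  shows "g (wsum K lam V \<phi> D) = wsum K lam W (\<lambda>x. g (\<phi> x)) D"
proof -
  interpret W: module K W by fact
  have "g (wsum K lam V \<phi> D) = msum W (\<lambda>p. g (case p of (i, x) \<Rightarrow> (lam [^]\<^bsub>K\<^esub> i) \<odot>\<^bsub>V\<^esub> \<phi> x)) D"
    unfolding wsum_def using assms(3) lam by (intro mod_hom_msum[OF V assms(1,2)]) auto
  also have "\<dots> = wsum K lam W (\<lambda>x. g (\<phi> x)) D"
    unfolding wsum_def
  proof (rule msum_cong[OF assms(1)])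
    fix p assume "p \<in># D"
    then obtain i x where p: "p = (i, x)" "\<phi> x \<in> carrier V" using assms(3) by (cases p) auto
    show "g (case p of (i, x) \<Rightarrow> (lam [^]\<^bsub>K\<^esub> i) \<odot>\<^bsub>V\<^esub> \<phi> x) \<in> carrier W"
      using p lam by (auto intro!: mod_hom_closed[OF assms(2)])
    show "g (case p of (i, x) \<Rightarrow> (lam [^]\<^bsub>K\<^esub> i) \<odot>\<^bsub>V\<^esub> \<phi> x)
        = (case p of (i, x) \<Rightarrow> (lam [^]\<^bsub>K\<^esub> i) \<odot>\<^bsub>W\<^esub> g (\<phi> x))"
      using p lam by (simp add: mod_hom_smult[OF assms(2)])
  qed
  finally show ?thesis .
qed

lemma mod_hom_wsum_fun:
  assumes "module K W" "\<And>i x. (i, x) \<in># D \<Longrightarrow> \<phi> x \<in> mod_hom K W V"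
  shows "(\<lambda>t. wsum K lam V (\<lambda>x. \<phi> x t) D) \<in> mod_hom K W V"
proof -
  have "(\<lambda>t. case p of (i, x) \<Rightarrow> (lam [^]\<^bsub>K\<^esub> i) \<odot>\<^bsub>V\<^esub> \<phi> x t) \<in> mod_hom K W V" if "p \<in># D" for p
    using that assms(2) lam by (cases p) (auto intro!: mod_hom_smult_fun[OF V])
  then show ?thesis
    unfolding wsum_def by (rule mod_hom_msum_fun[OF assms(1) V])
qed

end

section \<open>The product of forests as an expansion\<close>

declare diamond.simps [simp del]

lemma forest_lin_free_lift: "forest_lin K V \<phi> = free_lift K forests V \<phi>"
  by (simp add: fun_eq_iff forest_lin_def free_lift_def sum_lift_def)

lemmas forest_module_module = free_module_module[OF cring, of forests]

lemma forest_basis_closed [simp]: "F \<noteq> [] \<Longrightarrow> forest_basis K F \<in> carrier (forest_module K)"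
  by (rule basis_elt_closed[OF cring]) (simp add: forests_def)

lemma forest_lin_wsum:
  assumes V: "module K V" and \<phi>: "\<And>F. F \<noteq> [] \<Longrightarrow> \<phi> F \<in> carrier V"
    and D: "\<And>i x. (i, x) \<in># D \<Longrightarrow> h x \<noteq> []"
  shows "forest_lin K V \<phi> (wsum K lam (forest_module K) (\<lambda>x. forest_basis K (h x)) D)
    = wsum K lam V (\<lambda>x. \<phi> (h x)) D"
proof -
  have \<phi>': "\<And>F. F \<in> forests \<Longrightarrow> \<phi> F \<in> carrier V" using \<phi> by (simp add: forests_def)
  have "forest_lin K V \<phi> (wsum K lam (forest_module K) (\<lambda>x. forest_basis K (h x)) D)
      = wsum K lam V (\<lambda>x. forest_lin K V \<phi> (forest_basis K (h x))) D"
    unfolding forest_lin_free_lift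
    using D by (intro mod_hom_wsum[OF forest_module_module V free_lift_hom[OF cring V \<phi>']]
        forest_basis_closed)
  also have "\<dots> = wsum K lam V (\<lambda>x. \<phi> (h x)) D"
  proof (rule wsum_cong[OF V])
    fix i x assume "(i, x) \<in># D"
    then have "h x \<in> forests" using D by (auto simp: forests_def)
    then show "forest_lin K V \<phi> (forest_basis K (h x)) = \<phi> (h x)"
      unfolding forest_lin_free_lift using \<phi>' by (intro free_lift_basis cring V)
    with \<open>h x \<in> forests\<close> show "forest_lin K V \<phi> (forest_basis K (h x)) \<in> carrier V"
      using \<phi>' by simp
  qed
  finally show ?thesis .
qed

lemma diamond_wsum_aux:
  assumes "F \<noteq> []" "G \<noteq> []"
    and "tree_diamond K lam (last F) (hd G)
      = wsum K lam (forest_module K) (\<lambda>X. forest_basis K [X]) (tree_expansion (last F) (hd G))"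
  shows "diamond K lam F G = wsum K lam (forest_module K) (forest_basis K) (forest_expansion F G)"
proof -
  let ?c = "\<lambda>X. butlast F @ X # tl G"
  have "diamond K lam F G = wsum K lam (forest_module K) (\<lambda>X. forest_basis K (butlast F @ [X] @ tl G))
      (tree_expansion (last F) (hd G))"
    unfolding diamond.simps[of K lam F G] assms(3)
    using assms(1,2)
      forest_lin_wsum[OF forest_module_module, of "\<lambda>X. forest_basis K (butlast F @ X @ tl G)"
        _ "\<lambda>X. [X]"]
    by simp
  also have "\<dots> = wsum K lam (forest_module K) (forest_basis K) (forest_expansion F G)"
    unfolding forest_expansion_def by (subst wsum_wmap[OF forest_module_module]) simp_all
  finally show ?thesis .
qed

lemma graft_lin_wsum:
  "(\<And>i x. (i, x) \<in># D \<Longrightarrow> x \<noteq> []) \<Longrightarrow>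
    graft_lin K (wsum K lam (forest_module K) (forest_basis K) D)
      = wsum K lam (forest_module K) (\<lambda>F. forest_basis K [Node F]) D"
  unfolding graft_lin_def
  using forest_lin_wsum[OF forest_module_module, of "\<lambda>F. forest_basis K [Node F]" D "\<lambda>x. x"]
  by simp

text \<open>Both sides obey the same recursion, since \<open>graft_lin\<close> and \<open>forest_lin\<close> act on weighted sums
  term by term.\<close>

lemma tree_diamond_wsum:
  "tree_diamond K lam S T = wsum K lam (forest_module K) (\<lambda>X. forest_basis K [X]) (tree_expansion S T)"
proof (induction S T rule: tree_expansion.induct)
  case (1 F G)
  interpret FM: module K "forest_module K" by (rule forest_module_module)
  note single = wsum_single[OF forest_module_module]
  show ?case
  proof (cases "F = [] \<or> G = []")
    case True
    then show ?thesis by (auto simp: single)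
  next
    case False
    let ?g = "wsum K lam (forest_module K) (\<lambda>F. forest_basis K [Node F])"
    have "diamond K lam [Node F] G = wsum K lam (forest_module K) (forest_basis K) (forest_expansion [Node F] G)"
      "diamond K lam F [Node G] = wsum K lam (forest_module K) (forest_basis K) (forest_expansion F [Node G])"
      "diamond K lam F G = wsum K lam (forest_module K) (forest_basis K) (forest_expansion F G)"
      using False 1 by (simp_all add: diamond_wsum_aux)
    then have "tree_diamond K lam (Node F) (Node G) = ?g (forest_expansion [Node F] G)
        \<oplus>\<^bsub>forest_module K\<^esub> ?g (forest_expansion F [Node G]) \<oplus>\<^bsub>forest_module K\<^esub> lam \<odot>\<^bsub>forest_module K\<^esub> ?g (forest_expansion F G)"
      using False by (simp add: graft_lin_wsum forest_expansion_nonempty)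
    also have "\<dots> = wsum K lam (forest_module K) (\<lambda>X. forest_basis K [X]) (tree_expansion (Node F) (Node G))"
      using False lam
      by (simp add: tree_expansion_graft wsum_wmap[OF forest_module_module] wsum_union[OF forest_module_module]
          wsum_wshift[OF forest_module_module])
    finally show ?thesis .
  qed
qed

lemma diamond_wsum:
  "F \<noteq> [] \<Longrightarrow> G \<noteq> [] \<Longrightarrow>
    diamond K lam F G = wsum K lam (forest_module K) (forest_basis K) (forest_expansion F G)"
  by (intro diamond_wsum_aux tree_diamond_wsum)

end


section \<open>Evaluation of decorated forests\<close>

text \<open>A forest with \<open>n\<close> leaves carries a word of \<open>n - 1\<close> letters, one between any two consecutive
  leaves. The letters are consumed from left to right: a tree \<open>S\<close> followed by others takes the \<open>n
  - 1\<close> letters inside it, where \<open>n\<close> is its number of leaves, and the next letter links it to the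
  remaining forest. The empty list is not a forest, and its value is a default.\<close>

fun forest_eval ::
  "('k, 'r, 'c) module_scheme \<Rightarrow> ('r \<Rightarrow> 'r) \<Rightarrow> ('m \<Rightarrow> 'r) \<Rightarrow> pforest \<Rightarrow> 'm list \<Rightarrow> 'r"
where
  "forest_eval R P f [] w = \<one>\<^bsub>R\<^esub>"
| "forest_eval R P f [Node F] w = (if F = [] then \<one>\<^bsub>R\<^esub> else P (forest_eval R P f F w))"
| "forest_eval R P f (S # T # G) w =
    forest_eval R P f [S] (take (leaves [S] - 1) w) \<otimes>\<^bsub>R\<^esub> f (w ! (leaves [S] - 1))
      \<otimes>\<^bsub>R\<^esub> forest_eval R P f (T # G) (drop (leaves [S]) w)"

declare forest_eval.simps [simp del]

section \<open>The noncommutative shuffle algebra\<close>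

context
  fixes K :: "('k, 'a) ring_scheme" and lam :: 'k and M :: "('k, 'm, 'b) module_scheme"
  assumes cring: "cring K" and lam: "lam \<in> carrier K" and M: "module K M"
begin

interpretation K: cring K by (rule cring)
interpretation M: module K M by (rule M)

abbreviation (input) "Sh \<equiv> shNC_module K M"
abbreviation (input) "deg F \<equiv> leaves F - 1"
abbreviation (input) "Tens n \<equiv> tensor_power K M n"
abbreviation (input) "dwords F \<equiv> words M (leaves F - 1)"
abbreviation (input) "gen F w \<equiv> decorated K M F (pure_tensor K M w)"

lemma decorations_module: "module K (decorations K M F)"
  unfolding decorations_def by (rule tensor_power_module[OF M])

lemma Sh_module: "module K Sh"
  unfolding shNC_module_def by (intro direct_sum_module cring decorations_module)

interpretation Sh: module K Sh by (rule Sh_module)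

lemma decorated_inj_at: "decorated K M F = inj_at forests (decorations K M) F"
  by (simp add: fun_eq_iff decorated_def inj_at_def)

lemma decorated_hom: "F \<noteq> [] \<Longrightarrow> decorated K M F \<in> mod_hom K (Tens (deg F)) Sh"
  using inj_at_hom[OF cring, of forests "decorations K M" F, OF decorations_module]
  by (simp add: decorated_inj_at shNC_module_def forests_def decorations_def[of K M F])

lemma gen_closed: "F \<noteq> [] \<Longrightarrow> w \<in> dwords F \<Longrightarrow> gen F w \<in> carrier Sh"
  by (intro mod_hom_closed[OF decorated_hom] pure_tensor_closed[OF M])

lemma Sh_lift_hom:
  assumes "module K V" "\<And>F. F \<noteq> [] \<Longrightarrow> h F \<in> mod_hom K (Tens (deg F)) V"
  shows "sum_lift forests (decorations K M) V h \<in> mod_hom K Sh V"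
  unfolding shNC_module_def using assms
  by (intro sum_lift_hom cring decorations_module) (auto simp: decorations_def forests_def)

lemma Sh_lift_decorated:
  assumes "module K V" "\<And>F. F \<noteq> [] \<Longrightarrow> h F \<in> mod_hom K (Tens (deg F)) V"
    and "F \<noteq> []" "t \<in> carrier (Tens (deg F))"
  shows "sum_lift forests (decorations K M) V h (decorated K M F t) = h F t"
  unfolding decorated_inj_at using assms
  by (intro sum_lift_inj_at[OF cring decorations_module]) (auto simp: decorations_def forests_def)

text \<open>The elements \<open>(F; w)\<close> span: decorated forests span the direct sum, and pure tensors span
  each tensor power.\<close>

lemma Sh_hom_eq:
  assumes V: "module K V" and f: "f \<in> mod_hom K Sh V" and g: "g \<in> mod_hom K Sh V"
    and eq: "\<And>F w. F \<noteq> [] \<Longrightarrow> w \<in> dwords F \<Longrightarrow> f (gen F w) = g (gen F w)"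
    and x: "x \<in> carrier Sh"
  shows "f x = g x"
proof (rule direct_sum_hom_eq[OF cring decorations_module V f[unfolded shNC_module_def]
      g[unfolded shNC_module_def] _ x[unfolded shNC_module_def]])
  fix F t assume "F \<in> forests" "t \<in> carrier (decorations K M F)"
  then have F: "F \<noteq> []" and t: "t \<in> carrier (Tens (deg F))"
    by (auto simp: forests_def decorations_def)
  have "f (decorated K M F t) = g (decorated K M F t)"
    by (rule tensor_power_hom_eq[OF M V mod_hom_comp[OF f decorated_hom[OF F]]
          mod_hom_comp[OF g decorated_hom[OF F]] eq[OF F] t])
  then show "f (inj_at forests (decorations K M) F t) = g (inj_at forests (decorations K M) F t)"
    by (simp add: decorated_inj_at)
qed

text \<open>The decoration \<open>t\<close> fits only the forests with \<open>n + 1\<close> leaves. The other forests do not occur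
  in \<open>D\<close>, so on them the map \<open>G \<mapsto> (G; t)\<close> may be replaced by \<open>0\<close>, and then it has a linear
  extension to all of the free module on the forests.\<close>

lemma decorated_lin_wsum:
  assumes D: "\<And>i G. (i, G) \<in># D \<Longrightarrow> G \<noteq> [] \<and> deg G = n" and t: "t \<in> carrier (Tens n)"
  shows "decorated_lin K M (wsum K lam (forest_module K) (forest_basis K) D) t
    = wsum K lam Sh (\<lambda>G. decorated K M G t) D"
proof -
  let ?c = "wsum K lam (forest_module K) (forest_basis K) D"
  let ?\<phi> = "\<lambda>G. if deg G = n then decorated K M G t else \<zero>\<^bsub>Sh\<^esub>"
  note FM = forest_module_module[OF cring lam] and S = self_module_module[OF cring]
  interpret FM: module K "forest_module K" by (rule FM)
  interpret S: module K "self_module K" by (rule S)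
  have dec: "decorated K M G t \<in> carrier Sh" if "G \<noteq> []" "deg G = n" for G
    using mod_hom_closed[OF decorated_hom[OF that(1)]] t that(2) by simp
  have c_supp: "deg G = n" if "?c G \<noteq> \<zero>\<^bsub>K\<^esub>" "G \<in> forests" for G
  proof (rule ccontr)
    assume n: "deg G \<noteq> n"
    \<comment> \<open>The coefficient at \<open>G\<close> is a linear form, and it vanishes on every forest of \<open>D\<close>.\<close>
    have hom: "(\<lambda>c. c G) \<in> mod_hom K (forest_module K) (self_module K)"
      using that(2) by (intro mod_homI) (auto simp: free_module_def direct_sum_simps)
    have "?c G = wsum K lam (self_module K) (\<lambda>F. forest_basis K F G) D"
      using D by (intro mod_hom_wsum[OF cring lam FM S hom] forest_basis_closed[OF cring lam]) auto
    also have "\<dots> = wsum K lam (self_module K) (\<lambda>F. \<zero>\<^bsub>self_module K\<^esub>) D"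
      using that(2) D n by (intro wsum_cong[OF cring lam S]) (auto simp: basis_elt_def)
    also have "\<dots> = \<zero>\<^bsub>self_module K\<^esub>"
      using mod_hom_wsum[OF cring lam S S mod_hom_zero_fun[OF S], of D "\<lambda>_. \<zero>\<^bsub>self_module K\<^esub>"]
      by simp
    finally show False using that(1) by simp
  qed
  have "decorated_lin K M ?c t = forest_lin K Sh ?\<phi> ?c"
    unfolding decorated_lin_def forest_lin_def
  proof (rule Sh.M.finsum_cong'[OF refl])
    have c: "?c \<in> carrier (forest_module K)"
      using D by (intro wsum_closed[OF cring lam FM]) (auto simp: forest_basis_closed[OF cring lam])
    show "(\<lambda>F. ?c F \<odot>\<^bsub>Sh\<^esub> ?\<phi> F) \<in> {F \<in> forests. ?c F \<noteq> \<zero>\<^bsub>K\<^esub>} \<rightarrow> carrier Sh"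
      using c dec c_supp
      by (auto simp: free_module_def direct_sum_simps forests_def)
  qed (use c_supp in auto)
  also have "\<dots> = wsum K lam Sh ?\<phi> D"
    using forest_lin_wsum[OF cring lam Sh_module, of ?\<phi> D "\<lambda>x. x"] dec D by simp
  also have "\<dots> = wsum K lam Sh (\<lambda>G. decorated K M G t) D"
    using dec D by (intro wsum_cong[OF cring lam Sh_module]) auto
  finally show ?thesis .
qed

text \<open>A product of forests has one leaf less than its factors together, so the numbers of
  decorations add up and concatenation supplies exactly the letters needed.\<close>

lemma forest_expansion_deg:
  assumes "F \<noteq> []" "G \<noteq> []" "(i, X) \<in># forest_expansion F G"
  shows "deg X = deg F + deg G"
  using leaves_forest_expansion[OF assms] leaves_pos[OF assms(1)] leaves_pos[OF assms(2)]
    leaves_pos[OF forest_expansion_nonempty[OF assms(3)]] by simp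

definition dprod :: "pforest \<Rightarrow> pforest \<Rightarrow> ('m list \<Rightarrow> 'k) set \<Rightarrow> ('m list \<Rightarrow> 'k) set
    \<Rightarrow> (pforest \<Rightarrow> ('m list \<Rightarrow> 'k) set)"
  where "dprod F G s t = decorated_lin K M (diamond K lam F G) (tensor_mult K M (deg F) (deg G) s t)"

lemma dprod_wsum:
  assumes "F \<noteq> []" "G \<noteq> []" "s \<in> carrier (Tens (deg F))" "t \<in> carrier (Tens (deg G))"
  shows "dprod F G s t
    = wsum K lam Sh (\<lambda>X. decorated K M X (tensor_mult K M (deg F) (deg G) s t)) (forest_expansion F G)"
  unfolding dprod_def diamond_wsum[OF cring lam assms(1,2)]
  by (rule decorated_lin_wsum[OF _ mod_hom_closed[OF tensor_mult_hom_left[OF M assms(4)] assms(3)]])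
    (use forest_expansion_nonempty forest_expansion_deg[OF assms(1,2)] in blast)

lemma dprod_hom_left:
  assumes "F \<noteq> []" "G \<noteq> []" "t \<in> carrier (Tens (deg G))"
  shows "(\<lambda>s. dprod F G s t) \<in> mod_hom K (Tens (deg F)) Sh"
proof (rule mod_hom_cong[OF tensor_power_module[OF M] dprod_wsum[OF assms(1,2) _ assms(3)]])
  show "(\<lambda>s. wsum K lam Sh (\<lambda>X. decorated K M X (tensor_mult K M (deg F) (deg G) s t)) (forest_expansion F G))
      \<in> mod_hom K (Tens (deg F)) Sh"
  proof (rule mod_hom_wsum_fun[OF cring lam Sh_module tensor_power_module[OF M]])
    fix i X assume "(i, X) \<in># forest_expansion F G"
    then have "decorated K M X \<in> mod_hom K (Tens (deg F + deg G)) Sh"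
      using forest_expansion_deg[OF assms(1,2)] decorated_hom[OF forest_expansion_nonempty] by metis
    then show "(\<lambda>s. decorated K M X (tensor_mult K M (deg F) (deg G) s t)) \<in> mod_hom K (Tens (deg F)) Sh"
      by (rule mod_hom_comp[OF _ tensor_mult_hom_left[OF M assms(3)]])
  qed
qed

lemma dprod_hom_right:
  assumes "F \<noteq> []" "G \<noteq> []" "s \<in> carrier (Tens (deg F))"
  shows "dprod F G s \<in> mod_hom K (Tens (deg G)) Sh"
proof (rule mod_hom_cong[OF tensor_power_module[OF M] dprod_wsum[OF assms(1,2,3)]])
  show "(\<lambda>t. wsum K lam Sh (\<lambda>X. decorated K M X (tensor_mult K M (deg F) (deg G) s t)) (forest_expansion F G))
      \<in> mod_hom K (Tens (deg G)) Sh"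
  proof (rule mod_hom_wsum_fun[OF cring lam Sh_module tensor_power_module[OF M]])
    fix i X assume "(i, X) \<in># forest_expansion F G"
    then have "decorated K M X \<in> mod_hom K (Tens (deg F + deg G)) Sh"
      using forest_expansion_deg[OF assms(1,2)] decorated_hom[OF forest_expansion_nonempty] by metis
    then show "(\<lambda>t. decorated K M X (tensor_mult K M (deg F) (deg G) s t)) \<in> mod_hom K (Tens (deg G)) Sh"
      by (rule mod_hom_comp[OF _ tensor_mult_hom_right[OF M assms(3)]])
  qed
qed

section \<open>Associativity and the unit\<close>

abbreviation (input) "shmult \<equiv> shNC_mult K lam M"

lemma shmult_lift:
  "shmult x y = sum_lift forests (decorations K M) Sh
     (\<lambda>F s. sum_lift forests (decorations K M) Sh (\<lambda>G t. dprod F G s t) y) x"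
  by (simp add: shNC_mult_def sum_lift_def dprod_def forest_support_def)

lemma Sh_component: "y \<in> carrier Sh \<Longrightarrow> G \<in> forests \<Longrightarrow> y G \<in> carrier (Tens (deg G))"
  by (auto simp: shNC_module_def direct_sum_simps decorations_def PiE_iff)

lemma dprod_lift_hom:
  assumes "F \<noteq> []" "y \<in> carrier Sh"
  shows "(\<lambda>s. sum_lift forests (decorations K M) Sh (\<lambda>G t. dprod F G s t) y) \<in> mod_hom K (Tens (deg F)) Sh"
  unfolding sum_lift_def
  by (rule mod_hom_finsum_fun[OF Sh_module], rule dprod_hom_left)
    (use assms Sh_component in \<open>auto simp: forests_def\<close>)

lemma shmult_hom_left: "y \<in> carrier Sh \<Longrightarrow> (\<lambda>x. shmult x y) \<in> mod_hom K Sh Sh"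
  unfolding shmult_lift by (intro Sh_lift_hom Sh_module dprod_lift_hom)

lemma shmult_hom_right:
  assumes "x \<in> carrier Sh" shows "shmult x \<in> mod_hom K Sh Sh"
proof -
  have "(\<lambda>y. shmult x y) \<in> mod_hom K Sh Sh"
    unfolding shmult_lift sum_lift_def[of _ _ _ _ x]
    by (rule mod_hom_finsum_fun[OF Sh_module], rule Sh_lift_hom[OF Sh_module], rule dprod_hom_right)
      (use assms Sh_component in \<open>auto simp: forests_def\<close>)
  then show ?thesis .
qed

lemma shmult_closed: "x \<in> carrier Sh \<Longrightarrow> y \<in> carrier Sh \<Longrightarrow> shmult x y \<in> carrier Sh"
  by (rule mod_hom_closed[OF shmult_hom_right])

lemma gen_forest_expansion_closed:
  "F \<noteq> [] \<Longrightarrow> G \<noteq> [] \<Longrightarrow> w \<in> dwords F \<Longrightarrow> v \<in> dwords G \<Longrightarrow> (i, X) \<in># forest_expansion F G \<Longrightarrow>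
    gen X (w @ v) \<in> carrier Sh"
  using words_append[OF M, of w "deg F" v "deg G"] forest_expansion_deg[of F G i X]
  by (intro gen_closed forest_expansion_nonempty) auto

lemma shmult_gen:
  assumes F: "F \<noteq> []" and G: "G \<noteq> []" and w: "w \<in> dwords F" and v: "v \<in> dwords G"
  shows "shmult (gen F w) (gen G v) = wsum K lam Sh (\<lambda>X. gen X (w @ v)) (forest_expansion F G)"
proof -
  note w' = pure_tensor_closed[OF M w] and v' = pure_tensor_closed[OF M v]
  have "shmult (gen F w) (gen G v)
      = sum_lift forests (decorations K M) Sh (\<lambda>G t. dprod F G (pure_tensor K M w) t) (gen G v)"
    unfolding shmult_lift
    by (rule Sh_lift_decorated[OF Sh_module dprod_lift_hom[OF _ gen_closed[OF G v]] F w'])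
  also have "\<dots> = dprod F G (pure_tensor K M w) (pure_tensor K M v)"
    by (rule Sh_lift_decorated[OF Sh_module dprod_hom_right[OF F _ w'] G v'])
  also have "\<dots> = wsum K lam Sh (\<lambda>X. gen X (w @ v)) (forest_expansion F G)"
    unfolding dprod_wsum[OF F G w' v'] tensor_mult_pure[OF M w v] ..
  finally show ?thesis .
qed

lemma shmult_assoc_gen:
  assumes F: "F \<noteq> []" and G: "G \<noteq> []" and H: "H \<noteq> []"
    and w: "w \<in> dwords F" and v: "v \<in> dwords G" and u: "u \<in> dwords H"
  shows "shmult (shmult (gen F w) (gen G v)) (gen H u) = shmult (gen F w) (shmult (gen G v) (gen H u))"
proof -
  note wsum_cong = wsum_cong[OF cring lam Sh_module]
  note cl = gen_forest_expansion_closed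
  have l: "w @ v \<in> dwords X" if "(i, X) \<in># forest_expansion F G" for i X
    using words_append[OF M w v] forest_expansion_deg[OF F G that] by simp
  have r: "v @ u \<in> dwords X" if "(i, X) \<in># forest_expansion G H" for i X
    using words_append[OF M v u] forest_expansion_deg[OF G H that] by simp
  have "shmult (shmult (gen F w) (gen G v)) (gen H u)
      = wsum K lam Sh (\<lambda>X. shmult (gen X (w @ v)) (gen H u)) (forest_expansion F G)"
    unfolding shmult_gen[OF F G w v]
    by (rule mod_hom_wsum[OF cring lam Sh_module Sh_module shmult_hom_left[OF gen_closed[OF H u]]])
      (rule cl[OF F G w v])
  also have "\<dots> = wsum K lam Sh (\<lambda>X. wsum K lam Sh (\<lambda>Y. gen Y (w @ v @ u)) (forest_expansion X H)) (forest_expansion F G)"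
    using shmult_gen[OF forest_expansion_nonempty H l u] 
    by (intro wsum_cong shmult_closed cl[OF F G w v] gen_closed[OF H u]) auto
  also have "\<dots> = wsum K lam Sh (\<lambda>Y. gen Y (w @ v @ u)) (wbind (forest_expansion F G) (\<lambda>X. forest_expansion X H))"
    using cl[OF forest_expansion_nonempty H l u] by (subst wsum_wbind[OF cring lam Sh_module]) auto
  also have "\<dots> = wsum K lam Sh (\<lambda>Y. gen Y (w @ v @ u)) (wbind (forest_expansion G H) (forest_expansion F))"
    by (simp add: forest_expansion_assoc[OF F G H])
  also have "\<dots> = wsum K lam Sh (\<lambda>X. wsum K lam Sh (\<lambda>Y. gen Y (w @ v @ u)) (forest_expansion F X)) (forest_expansion G H)"
    using cl[OF F forest_expansion_nonempty w r] by (subst wsum_wbind[OF cring lam Sh_module]) auto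
  also have "\<dots> = wsum K lam Sh (\<lambda>X. shmult (gen F w) (gen X (v @ u))) (forest_expansion G H)"
    using shmult_gen[OF F forest_expansion_nonempty w r] cl[OF F forest_expansion_nonempty w r]
    by (intro wsum_cong wsum_closed[OF cring lam Sh_module]) auto
  also have "\<dots> = shmult (gen F w) (shmult (gen G v) (gen H u))"
    unfolding shmult_gen[OF G H v u]
    by (rule mod_hom_wsum[OF cring lam Sh_module Sh_module shmult_hom_right[OF gen_closed[OF F w]],
          symmetric]) (rule cl[OF G H v u])
  finally show ?thesis .
qed

text \<open>Both sides are linear in each argument, which allows replacing \<open>z\<close>, then \<open>y\<close>, then \<open>x\<close> by
  elements \<open>(F; w)\<close>.\<close>

lemma shmult_assoc:
  assumes x: "x \<in> carrier Sh" and y: "y \<in> carrier Sh" and z: "z \<in> carrier Sh"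
  shows "shmult (shmult x y) z = shmult x (shmult y z)"
proof -
  note L = shmult_hom_left and R = shmult_hom_right
  have 1: "shmult (shmult (gen F w) (gen G v)) z = shmult (gen F w) (shmult (gen G v) z)"
    if "F \<noteq> []" "w \<in> dwords F" "G \<noteq> []" "v \<in> dwords G" for F w G v
    by (rule Sh_hom_eq[OF Sh_module R[OF shmult_closed] mod_hom_comp[OF R R] _ z])
      (use that shmult_assoc_gen in \<open>simp_all add: gen_closed\<close>)
  have 2: "shmult (shmult (gen F w) y) z = shmult (gen F w) (shmult y z)"
    if "F \<noteq> []" "w \<in> dwords F" for F w
    by (rule Sh_hom_eq[OF Sh_module mod_hom_comp[OF L R] mod_hom_comp[OF R L] _ y])
      (use that 1 z in \<open>simp_all add: gen_closed\<close>)
  show ?thesis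
    by (rule Sh_hom_eq[OF Sh_module mod_hom_comp[OF L L] L[OF shmult_closed] _ x])
      (use 2 y z in simp_all)
qed

abbreviation (input) "shone \<equiv> gen [bullet] []"

lemma tree_leaves_bullet [simp]: "tree_leaves bullet = 1"
  by (simp add: tree_leaves_Node)

lemma leaves_bullet: "leaves [bullet, bullet] = 2"
  by simp

lemma Nil_words [simp]: "[] \<in> words M 0"
  by (simp add: words_def)

lemma forest_expansion_one [simp]: "F \<noteq> [] \<Longrightarrow> forest_expansion [bullet] F = {#(0, F)#}" "F \<noteq> [] \<Longrightarrow> forest_expansion F [bullet] = {#(0, F)#}"
  by (simp_all add: forest_expansion_def)

lemma shone_closed: "shone \<in> carrier Sh"
  by (intro gen_closed) simp_all

lemma shmult_one:
  assumes "x \<in> carrier Sh" shows "shmult shone x = x" "shmult x shone = x"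
proof -
  have id: "(\<lambda>x. x) \<in> mod_hom K Sh Sh" by (simp add: mod_hom_def)
  show "shmult shone x = x"
    by (rule Sh_hom_eq[OF Sh_module shmult_hom_right[OF shone_closed] id _ assms])
      (simp add: shmult_gen wsum_single[OF cring lam Sh_module] gen_closed)
  show "shmult x shone = x"
    by (rule Sh_hom_eq[OF Sh_module shmult_hom_left[OF shone_closed] id _ assms])
      (simp add: shmult_gen wsum_single[OF cring lam Sh_module] gen_closed)
qed

lemma shNC_simps:
  "carrier (shNC K lam M) = carrier Sh" "x \<oplus>\<^bsub>shNC K lam M\<^esub> y = x \<oplus>\<^bsub>Sh\<^esub> y"
  "\<zero>\<^bsub>shNC K lam M\<^esub> = \<zero>\<^bsub>Sh\<^esub>" "a \<odot>\<^bsub>shNC K lam M\<^esub> x = a \<odot>\<^bsub>Sh\<^esub> x"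
  "x \<otimes>\<^bsub>shNC K lam M\<^esub> y = shmult x y" "\<one>\<^bsub>shNC K lam M\<^esub> = shone"
  by (simp_all add: shNC_def)

lemma mod_hom_shNC:
  "mod_hom K (shNC K lam M) V = mod_hom K Sh V" "mod_hom K V (shNC K lam M) = mod_hom K V Sh"
  by (simp_all add: mod_hom_def shNC_simps)

lemma shNC_is_module: "module K (shNC K lam M)"
proof (rule moduleI)
  have "add_monoid (shNC K lam M) = add_monoid Sh" by (simp add: shNC_def)
  then show "abelian_group (shNC K lam M)"
    using Sh.M.abelian_group_axioms
    by (simp add: abelian_group_def abelian_group_axioms_def abelian_monoid_def)
qed (simp_all add: shNC_simps cring Sh.smult_l_distr Sh.smult_r_distr Sh.smult_assoc1)

lemma shNC_unital_algebra: "unital_algebra K (shNC K lam M)"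
proof -
  interpret A: module K "shNC K lam M" by (rule shNC_is_module)
  note [simp] = shNC_simps
  have "ring (shNC K lam M)"
  proof (rule ringI)
    show "abelian_group (shNC K lam M)" by (rule A.M.abelian_group_axioms)
    show "monoid (shNC K lam M)"
      by (rule monoidI) (simp_all add: shmult_closed shone_closed shmult_assoc shmult_one)
  qed (simp_all add: mod_hom_add[OF shmult_hom_left] mod_hom_add[OF shmult_hom_right])
  then show ?thesis
    by (intro unital_algebra.intro unital_algebra_axioms.intro shNC_is_module)
      (simp_all add: mod_hom_smult[OF shmult_hom_left] mod_hom_smult[OF shmult_hom_right])
qed

section \<open>The Rota--Baxter operator\<close>

abbreviation (input) "shop \<equiv> shNC_op K M"

lemma leaves_graft: "F \<noteq> [] \<Longrightarrow> leaves [Node F] = leaves F"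
  by (simp add: tree_leaves_Node)

lemma shop_lift: "shop = sum_lift forests (decorations K M) Sh (\<lambda>F t. decorated K M [Node F] t)"
  by (simp add: fun_eq_iff shNC_op_def sum_lift_def forest_support_def)

lemma decorated_graft_hom: "F \<noteq> [] \<Longrightarrow> decorated K M [Node F] \<in> mod_hom K (Tens (deg F)) Sh"
  using decorated_hom[of "[Node F]"] by (metis leaves_graft list.distinct(1))

lemma shop_hom: "shop \<in> mod_hom K Sh Sh"
  unfolding shop_lift by (intro Sh_lift_hom Sh_module decorated_graft_hom)

lemma shop_gen: "F \<noteq> [] \<Longrightarrow> w \<in> dwords F \<Longrightarrow> shop (gen F w) = gen [Node F] w"
  unfolding shop_lift
  by (rule Sh_lift_decorated[OF Sh_module decorated_graft_hom]) (simp_all add: pure_tensor_closed[OF M])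

lemma forest_expansion_graft: "F \<noteq> [] \<Longrightarrow> G \<noteq> [] \<Longrightarrow> forest_expansion [Node F] [Node G]
    = wmap (\<lambda>X. [Node X]) (forest_expansion [Node F] G + forest_expansion F [Node G] + wshift 1 (forest_expansion F G))"
  by (simp add: forest_expansion_def[of "[Node F]" "[Node G]"] tree_expansion_graft wmap_wshift)

text \<open>The left side is \<open>(\<lfloor>F\<rfloor> \<diamond> \<lfloor>G\<rfloor>; wv)\<close>, and the recursive clause of the product writes it as a
  grafting of the three products on the right.\<close>

lemma rota_baxter_gen:
  assumes F: "F \<noteq> []" and G: "G \<noteq> []" and w: "w \<in> dwords F" and v: "v \<in> dwords G"
  shows "shmult (shop (gen F w)) (shop (gen G v))
    = shop (shmult (shop (gen F w)) (gen G v) \<oplus>\<^bsub>Sh\<^esub> shmult (gen F w) (shop (gen G v))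
        \<oplus>\<^bsub>Sh\<^esub> lam \<odot>\<^bsub>Sh\<^esub> shmult (gen F w) (gen G v))"
proof -
  let ?D = "forest_expansion [Node F] G + forest_expansion F [Node G] + wshift 1 (forest_expansion F G)"
  have w': "w \<in> dwords [Node F]" and v': "v \<in> dwords [Node G]"
    using w v by (simp_all only: leaves_graft[OF F] leaves_graft[OF G])
  have D: "X \<noteq> []" "w @ v \<in> dwords X" if "(i, X) \<in># ?D" for i X
  proof -
    from that consider "(i, X) \<in># forest_expansion [Node F] G" | "(i, X) \<in># forest_expansion F [Node G]"
      | j where "(j, X) \<in># forest_expansion F G" by (auto simp: wshift_def)
    then have "X \<noteq> [] \<and> deg X = deg F + deg G"
      using F G forest_expansion_nonempty forest_expansion_deg[of "[Node F]" G] forest_expansion_deg[of F "[Node G]"] forest_expansion_deg[of F G]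
      by cases (metis leaves_graft list.distinct(1))+
    then show "X \<noteq> []" "w @ v \<in> dwords X" using words_append[OF M w v] by simp_all
  qed
  have cl: "gen X (w @ v) \<in> carrier Sh" if "(i, X) \<in># ?D" for i X
    by (rule gen_closed) (use D[OF that] in simp_all)
  have "shmult (shop (gen F w)) (shop (gen G v))
      = wsum K lam Sh (\<lambda>X. gen X (w @ v)) (forest_expansion [Node F] [Node G])"
    unfolding shop_gen[OF F w] shop_gen[OF G v] by (rule shmult_gen[OF _ _ w' v']) simp_all
  also have "\<dots> = wsum K lam Sh (\<lambda>X. gen [Node X] (w @ v)) ?D"
    unfolding forest_expansion_graft[OF F G]
    by (rule wsum_wmap[OF cring lam Sh_module], rule gen_closed)
      (use D leaves_graft in \<open>simp, metis\<close>)
  also have "\<dots> = wsum K lam Sh (\<lambda>X. shop (gen X (w @ v))) ?D"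
  proof (rule wsum_cong[OF cring lam Sh_module, symmetric])
    fix i X assume "(i, X) \<in># ?D"
    then show "shop (gen X (w @ v)) \<in> carrier Sh" "shop (gen X (w @ v)) = gen [Node X] (w @ v)"
      using mod_hom_closed[OF shop_hom cl] D shop_gen by blast+
  qed
  also have "\<dots> = shop (wsum K lam Sh (\<lambda>X. gen X (w @ v)) ?D)"
    by (rule mod_hom_wsum[OF cring lam Sh_module Sh_module shop_hom cl, symmetric])
  also have "wsum K lam Sh (\<lambda>X. gen X (w @ v)) ?D
      = wsum K lam Sh (\<lambda>X. gen X (w @ v)) (forest_expansion [Node F] G) \<oplus>\<^bsub>Sh\<^esub>
        wsum K lam Sh (\<lambda>X. gen X (w @ v)) (forest_expansion F [Node G]) \<oplus>\<^bsub>Sh\<^esub>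
        lam \<odot>\<^bsub>Sh\<^esub> wsum K lam Sh (\<lambda>X. gen X (w @ v)) (forest_expansion F G)"
    by (rule wsum_rota_baxter[OF cring lam Sh_module cl])
  also have "\<dots> = shmult (shop (gen F w)) (gen G v) \<oplus>\<^bsub>Sh\<^esub> shmult (gen F w) (shop (gen G v))
        \<oplus>\<^bsub>Sh\<^esub> lam \<odot>\<^bsub>Sh\<^esub> shmult (gen F w) (gen G v)"
    using F G w v w' v' by (simp add: shop_gen shmult_gen)
  finally show ?thesis .
qed

lemma shNC_rota_baxter:
  assumes x: "x \<in> carrier Sh" and y: "y \<in> carrier Sh"
  shows "shmult (shop x) (shop y)
    = shop (shmult (shop x) y \<oplus>\<^bsub>Sh\<^esub> shmult x (shop y) \<oplus>\<^bsub>Sh\<^esub> lam \<odot>\<^bsub>Sh\<^esub> shmult x y)"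
proof -
  note L = shmult_hom_left and R = shmult_hom_right and P = shop_hom
  note cl = mod_hom_closed[OF P]
  note comp = mod_hom_comp and add = mod_hom_add_fun[OF Sh_module]
    and sc = mod_hom_smult_fun[OF Sh_module _ lam]
  have 1: "shmult (shop (gen F w)) (shop y)
      = shop (shmult (shop (gen F w)) y \<oplus>\<^bsub>Sh\<^esub> shmult (gen F w) (shop y)
          \<oplus>\<^bsub>Sh\<^esub> lam \<odot>\<^bsub>Sh\<^esub> shmult (gen F w) y)"
    if "F \<noteq> []" "w \<in> dwords F" for F w
    by (rule Sh_hom_eq[OF Sh_module comp[OF R P] comp[OF P add[OF add[OF R comp[OF R P]] sc[OF R]]] _ y])
      (use that rota_baxter_gen in \<open>simp_all add: gen_closed cl\<close>)
  show ?thesis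
    by (rule Sh_hom_eq[OF Sh_module comp[OF L P] comp[OF P add[OF add[OF comp[OF L P] L] sc[OF L]]] _ x])
      (use 1 y in \<open>simp_all add: cl\<close>)
qed

lemma shNC_rota_baxter_algebra: "rota_baxter_algebra K lam (shNC K lam M) shop"
  by (intro rota_baxter_algebra.intro rota_baxter_algebra_axioms.intro shNC_unital_algebra lam)
    (simp_all add: mod_hom_shNC shop_hom shNC_simps, use shop_hom shNC_rota_baxter in \<open>auto simp: mod_hom_def shNC_simps\<close>)

lemma incl_hom: "shNC_incl K M \<in> mod_hom K M (shNC K lam M)"
proof -
  have "(\<lambda>x. pure_tensor K M ([] @ x # [])) \<in> mod_hom K M (Tens 1)"
    by (rule multilinear_map_hom[OF multilinear_pure_tensor[OF M]]) simp_all
  moreover have "decorated K M [bullet, bullet] \<in> mod_hom K (Tens 1) Sh"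
    using decorated_hom[of "[bullet, bullet]"] by (simp only: leaves_bullet) simp
  ultimately have "(\<lambda>x. decorated K M [bullet, bullet] (pure_tensor K M ([] @ x # []))) \<in> mod_hom K M Sh"
    by (rule mod_hom_comp[rotated])
  then show ?thesis by (simp add: mod_hom_shNC shNC_incl_def[abs_def])
qed


section \<open>The universal property\<close>

lemma words_Suc_split:
  assumes "w \<in> words M (Suc (m + n))"
  shows "take m w \<in> words M m" "w ! m \<in> carrier M" "drop (Suc m) w \<in> words M n"
  using assms nth_mem[of m w] by (auto simp: words_def dest: in_set_takeD in_set_dropD)

lemma deg_Cons: "G \<noteq> [] \<Longrightarrow> deg (S # G) = Suc (deg [S] + deg G)"
  using leaves_pos[of G] tree_leaves_pos[of S] by simp

context
  fixes R :: "('k, 'r, 'c) module_scheme" and P :: "'r \<Rightarrow> 'r" and f :: "'m \<Rightarrow> 'r"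
  assumes RB: "rota_baxter_algebra K lam R P" and f: "f \<in> mod_hom K M R"
begin

interpretation R: rota_baxter_algebra K lam R P by (rule RB)

abbreviation (input) "ev \<equiv> forest_eval R P f"

lemma R_module: "module K R"
  by (rule R.module_axioms)

lemma R_mult_left_hom: "y \<in> carrier R \<Longrightarrow> (\<lambda>x. x \<otimes>\<^bsub>R\<^esub> y) \<in> mod_hom K R R"
  by (intro mod_homI) (simp_all add: R.l_distr R.smult_mult_left)

lemma R_mult_right_hom: "x \<in> carrier R \<Longrightarrow> (\<lambda>y. x \<otimes>\<^bsub>R\<^esub> y) \<in> mod_hom K R R"
  by (intro mod_homI) (simp_all add: R.r_distr R.smult_mult_right)

text \<open>A letter of the word lies in the first block, between the blocks, or in the second block.\<close>

lemma multilinear_insert: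
  assumes \<phi>: "multilinear_map K M m R \<phi>" and \<psi>: "multilinear_map K M n R \<psi>"
  shows "multilinear_map K M (Suc (m + n)) R
    (\<lambda>w. \<phi> (take m w) \<otimes>\<^bsub>R\<^esub> f (w ! m) \<otimes>\<^bsub>R\<^esub> \<psi> (drop (Suc m) w))"
  unfolding multilinear_map_def
proof (intro conjI allI impI ballI)
  fix w assume "w \<in> words M (Suc (m + n))"
  then show "\<phi> (take m w) \<otimes>\<^bsub>R\<^esub> f (w ! m) \<otimes>\<^bsub>R\<^esub> \<psi> (drop (Suc m) w) \<in> carrier R"
    by (intro R.m_closed multilinear_map_closed[OF \<phi>] multilinear_map_closed[OF \<psi>] mod_hom_closed[OF f]
        words_Suc_split)
next
  fix u v assume uv: "set u \<subseteq> carrier M" "set v \<subseteq> carrier M" "Suc (length u + length v) = Suc (m + n)"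
  have sub: "set (take i v) \<subseteq> carrier M" "set (drop i v) \<subseteq> carrier M"
    "set (take i u) \<subseteq> carrier M" "set (drop i u) \<subseteq> carrier M" for i
    using uv by (auto dest: in_set_takeD in_set_dropD)
  let ?h = "\<lambda>x. \<phi> (take m (u @ x # v)) \<otimes>\<^bsub>R\<^esub> f ((u @ x # v) ! m) \<otimes>\<^bsub>R\<^esub> \<psi> (drop (Suc m) (u @ x # v))"
  consider (left) "length u < m" | (middle) "length u = m" | (right) "m < length u" by linarith
  then show "?h \<in> mod_hom K M R"
  proof cases
    case left
    define i where "i = m - Suc (length u)"
    have m: "m = Suc (length u + i)" using left by (simp add: i_def)
    have "v ! i \<in> carrier M" "drop (Suc i) v \<in> words M n"
      using uv m nth_mem[of i v] by (auto simp: words_def dest: in_set_dropD)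
    then have "f (v ! i) \<in> carrier R" "\<psi> (drop (Suc i) v) \<in> carrier R"
      using mod_hom_closed[OF f] multilinear_map_closed[OF \<psi>] by auto
    moreover have "(\<lambda>x. \<phi> (u @ x # take i v)) \<in> mod_hom K M R"
      using uv m sub by (intro multilinear_map_hom[OF \<phi>]) auto
    ultimately have "(\<lambda>x. \<phi> (u @ x # take i v) \<otimes>\<^bsub>R\<^esub> f (v ! i) \<otimes>\<^bsub>R\<^esub> \<psi> (drop (Suc i) v)) \<in> mod_hom K M R"
      by (intro mod_hom_comp[OF R_mult_left_hom])
    moreover have "?h = (\<lambda>x. \<phi> (u @ x # take i v) \<otimes>\<^bsub>R\<^esub> f (v ! i) \<otimes>\<^bsub>R\<^esub> \<psi> (drop (Suc i) v))"
      by (simp add: m nth_append)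
    ultimately show ?thesis by simp
  next
    case middle
    have "\<phi> u \<in> carrier R" "\<psi> v \<in> carrier R"
      using uv middle by (auto intro!: multilinear_map_closed[OF \<phi>] multilinear_map_closed[OF \<psi>] simp: words_def)
    then have "(\<lambda>x. \<phi> u \<otimes>\<^bsub>R\<^esub> f x \<otimes>\<^bsub>R\<^esub> \<psi> v) \<in> mod_hom K M R"
      by (intro mod_hom_comp[OF R_mult_left_hom] mod_hom_comp[OF R_mult_right_hom] f)
    moreover have "?h = (\<lambda>x. \<phi> u \<otimes>\<^bsub>R\<^esub> f x \<otimes>\<^bsub>R\<^esub> \<psi> v)"
      using middle by auto
    ultimately show ?thesis by simp
  next
    case right
    have "take m u \<in> words M m" "u ! m \<in> carrier M"
      using uv right nth_mem[of m u] by (auto simp: words_def dest: in_set_takeD)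
    then have "\<phi> (take m u) \<otimes>\<^bsub>R\<^esub> f (u ! m) \<in> carrier R"
      using mod_hom_closed[OF f] multilinear_map_closed[OF \<phi>] by auto
    moreover have "(\<lambda>x. \<psi> (drop (Suc m) u @ x # v)) \<in> mod_hom K M R"
      using uv right sub by (intro multilinear_map_hom[OF \<psi>]) auto
    ultimately have "(\<lambda>x. \<phi> (take m u) \<otimes>\<^bsub>R\<^esub> f (u ! m) \<otimes>\<^bsub>R\<^esub> \<psi> (drop (Suc m) u @ x # v)) \<in> mod_hom K M R"
      by (rule mod_hom_comp[OF R_mult_right_hom])
    moreover have "?h = (\<lambda>x. \<phi> (take m u) \<otimes>\<^bsub>R\<^esub> f (u ! m) \<otimes>\<^bsub>R\<^esub> \<psi> (drop (Suc m) u @ x # v))"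
      using right by (simp add: nth_append)
    ultimately show ?thesis by simp
  qed
qed

lemma ev_bullet [simp]: "ev [bullet] w = \<one>\<^bsub>R\<^esub>"
  by (simp add: forest_eval.simps)

lemma ev_graft: "F \<noteq> [] \<Longrightarrow> ev [Node F] w = P (ev F w)"
  by (simp add: forest_eval.simps)

lemma ev_Cons:
  "G \<noteq> [] \<Longrightarrow> ev (S # G) w = ev [S] (take (deg [S]) w) \<otimes>\<^bsub>R\<^esub> f (w ! deg [S])
    \<otimes>\<^bsub>R\<^esub> ev G (drop (Suc (deg [S])) w)"
  using leaves_pos[of "[S]"] by (cases G) (simp_all add: forest_eval.simps(3))

lemma ev_multilinear: "F \<noteq> [] \<Longrightarrow> multilinear_map K M (deg F) R (ev F)"
proof (induction F rule: forest_induct)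
  case bullet
  show ?case by (auto simp: multilinear_map_def)
next
  case (graft F)
  have "ev [Node F] = (\<lambda>w. P (ev F w))" using graft(1) by (simp add: fun_eq_iff ev_graft)
  moreover have "multilinear_map K M (deg F) R (\<lambda>w. P (ev F w))"
    unfolding multilinear_map_def
    by (intro conjI ballI allI impI mod_hom_closed[OF R.operator_linear]
        mod_hom_comp[OF R.operator_linear] multilinear_map_closed[OF graft(2)]
        multilinear_map_hom[OF graft(2)])
  ultimately show ?case by (simp only: leaves_graft[OF graft(1)])
next
  case (Cons S G)
  have "ev (S # G) = (\<lambda>w. ev [S] (take (deg [S]) w) \<otimes>\<^bsub>R\<^esub> f (w ! deg [S]) \<otimes>\<^bsub>R\<^esub> ev G (drop (Suc (deg [S])) w))"
    by (simp only: fun_eq_iff ev_Cons[OF Cons(1)]) simp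
  then show ?case
    unfolding deg_Cons[OF Cons(1)] by (simp only: multilinear_insert[OF Cons(2,3)])
qed

lemma ev_closed [simp]: "F \<noteq> [] \<Longrightarrow> w \<in> dwords F \<Longrightarrow> ev F w \<in> carrier R"
  by (rule multilinear_map_closed[OF ev_multilinear])

lemma f_closed [simp]: "a \<in> carrier M \<Longrightarrow> f a \<in> carrier R"
  by (rule mod_hom_closed[OF f])

lemma ev_append:
  assumes "F \<noteq> []" "G \<noteq> []" "u \<in> dwords F" "a \<in> carrier M" "v \<in> dwords G"
  shows "ev (F @ G) (u @ a # v) = ev F u \<otimes>\<^bsub>R\<^esub> f a \<otimes>\<^bsub>R\<^esub> ev G v"
  using assms(1,3)
proof (induction F arbitrary: u)
  case (Cons S F)
  show ?case
  proof (cases "F = []")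
    case True
    then have len: "deg [S] = length u" using Cons(3) by (simp add: words_def)
    show ?thesis
      unfolding True append.simps ev_Cons[OF assms(2)] len nth_append_length by simp
  next
    case False
    note u = Cons(3)[unfolded deg_Cons[OF False]]
    note w = words_Suc_split[OF u]
    have len: "length u = Suc (deg [S] + deg F)" using u by (simp add: words_def)
    define k where "k = deg [S]"
    have k: "k < length u" by (simp only: len k_def less_Suc_eq_le le_add1)
    have "ev ((S # F) @ G) (u @ a # v) = ev [S] (take k (u @ a # v)) \<otimes>\<^bsub>R\<^esub> f ((u @ a # v) ! k)
        \<otimes>\<^bsub>R\<^esub> ev (F @ G) (drop (Suc k) (u @ a # v))"
      unfolding append_Cons k_def by (rule ev_Cons) (simp add: False)
    also have "\<dots> = ev [S] (take k u) \<otimes>\<^bsub>R\<^esub> f (u ! k) \<otimes>\<^bsub>R\<^esub> ev (F @ G) (drop (Suc k) u @ a # v)"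
      using k by (simp add: nth_append)
    also have "\<dots> = ev (S # F) u \<otimes>\<^bsub>R\<^esub> f a \<otimes>\<^bsub>R\<^esub> ev G v"
      unfolding k_def Cons(1)[OF False w(3)] ev_Cons[OF False]
      using False w assms by (simp add: R.m_assoc)
    finally show ?thesis .
  qed
qed simp

text \<open>The trees before the last one contribute a left factor that does not change when the last
  tree is replaced by another forest. There is no such tree if \<open>F\<close> is a single tree, and then the
  factor is \<open>1\<close>.\<close>

lemma ev_last_factor:
  assumes "F \<noteq> []" "w \<in> dwords F"
  obtains l u v where "w = u @ v" "set u \<subseteq> carrier M" "v \<in> dwords [last F]" "l \<in> carrier R"
    "length u = leaves (butlast F)"
    "\<And>H v'. H \<noteq> [] \<Longrightarrow> v' \<in> dwords H \<Longrightarrow> ev (butlast F @ H) (u @ v') = l \<otimes>\<^bsub>R\<^esub> ev H v'"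
proof (cases "butlast F = []")
  case True
  then have "F = [last F]" using assms(1) by (metis append_Nil append_butlast_last_id)
  then show ?thesis
    using that[of "[]" w "\<one>\<^bsub>R\<^esub>"] assms True by simp
next
  case False
  define n where "n = deg (butlast F)"
  have n: "Suc n = leaves (butlast F)" using leaves_pos[OF False] by (simp add: n_def)
  have "deg F = Suc (n + deg [last F])"
    using butlast_last_leaves[OF assms(1)] leaves_pos[OF False] tree_leaves_pos[of "last F"]
    by (simp add: n_def)
  then have w: "w \<in> words M (Suc (n + deg [last F]))" using assms(2) by simp
  note s = words_Suc_split[OF w]
  have len: "n < length w" using w by (simp add: words_def)
  have l: "ev (butlast F) (take n w) \<in> carrier R" "f (w ! n) \<in> carrier R"
    using s False by (simp_all add: n_def)
  show ?thesis
  proof (rule that)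
    show "w = (take n w @ [w ! n]) @ drop (Suc n) w" using len by (simp add: id_take_nth_drop)
    show "set (take n w @ [w ! n]) \<subseteq> carrier M" using s by (simp add: words_def)
    show "length (take n w @ [w ! n]) = leaves (butlast F)" using n len by simp
    show "ev (butlast F) (take n w) \<otimes>\<^bsub>R\<^esub> f (w ! n) \<in> carrier R" using l by simp
    show "drop (Suc n) w \<in> dwords [last F]" by (rule s)
    show "ev (butlast F @ H) ((take n w @ [w ! n]) @ v') = ev (butlast F) (take n w) \<otimes>\<^bsub>R\<^esub> f (w ! n) \<otimes>\<^bsub>R\<^esub> ev H v'"
      if "H \<noteq> []" "v' \<in> dwords H" for H v'
      using ev_append[OF False that(1) s(1)[unfolded n_def] s(2) that(2)] by (simp add: n_def)
  qed
qed

lemma ev_first_factor: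
  assumes "F \<noteq> []" "w \<in> dwords F"
  obtains r u v where "w = v @ u" "set u \<subseteq> carrier M" "v \<in> dwords [hd F]" "r \<in> carrier R"
    "length u = leaves (tl F)"
    "\<And>T v'. v' \<in> dwords [T] \<Longrightarrow> ev (T # tl F) (v' @ u) = ev [T] v' \<otimes>\<^bsub>R\<^esub> r"
proof (cases "tl F = []")
  case True
  then have "F = [hd F]" using assms(1) by (metis list.collapse)
  then show ?thesis
    using that[of w "[]" "\<one>\<^bsub>R\<^esub>"] assms True by simp
next
  case False
  define n where "n = deg [hd F]"
  have "deg F = Suc (n + deg (tl F))"
    using hd_tl_leaves[OF assms(1)] leaves_pos[OF False] tree_leaves_pos[of "hd F"]
    by (simp add: n_def)
  then have w: "w \<in> words M (Suc (n + deg (tl F)))" using assms(2) by simp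
  note s = words_Suc_split[OF w]
  have len: "n < length w" "length w - n = leaves (tl F)"
    using w leaves_pos[OF False] by (simp_all add: words_def)
  have r: "f (w ! n) \<in> carrier R" "ev (tl F) (drop (Suc n) w) \<in> carrier R"
    using s False by simp_all
  show ?thesis
  proof (rule that)
    show "w = take n w @ w ! n # drop (Suc n) w" using len by (simp add: id_take_nth_drop)
    show "set (w ! n # drop (Suc n) w) \<subseteq> carrier M" using s by (simp add: words_def)
    show "length (w ! n # drop (Suc n) w) = leaves (tl F)" using len by simp
    show "f (w ! n) \<otimes>\<^bsub>R\<^esub> ev (tl F) (drop (Suc n) w) \<in> carrier R" using r by simp
    show "take n w \<in> dwords [hd F]" using s(1) by (simp add: n_def)
    show "ev (T # tl F) (v' @ w ! n # drop (Suc n) w) = ev [T] v' \<otimes>\<^bsub>R\<^esub> (f (w ! n) \<otimes>\<^bsub>R\<^esub> ev (tl F) (drop (Suc n) w))"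
      if "v' \<in> dwords [T]" for T v'
      using ev_append[OF _ False that s(2) s(3)] r ev_closed[OF _ that] by (simp add: R.m_assoc)
  qed
qed

text \<open>The product alters only the last tree of \<open>F\<close> and the first tree of \<open>G\<close>. The other trees
  contribute constant outer factors \<open>l\<close> and \<open>r\<close>, so the claim for forests follows from the one for
  these two trees.\<close>

lemma ev_forest_expansion_aux:
  assumes F: "F \<noteq> []" and G: "G \<noteq> []" and w: "w \<in> dwords F" and w': "w' \<in> dwords G"
    and tree: "\<And>v v'. v \<in> dwords [last F] \<Longrightarrow> v' \<in> dwords [hd G] \<Longrightarrow>
      ev [last F] v \<otimes>\<^bsub>R\<^esub> ev [hd G] v' = wsum K lam R (\<lambda>X. ev [X] (v @ v')) (tree_expansion (last F) (hd G))"
  shows "ev F w \<otimes>\<^bsub>R\<^esub> ev G w' = wsum K lam R (\<lambda>X. ev X (w @ w')) (forest_expansion F G)"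
proof -
  obtain l u v where l: "w = u @ v" "set u \<subseteq> carrier M" "v \<in> dwords [last F]" "l \<in> carrier R"
      "length u = leaves (butlast F)"
    and evF: "\<And>H v'. H \<noteq> [] \<Longrightarrow> v' \<in> dwords H \<Longrightarrow> ev (butlast F @ H) (u @ v') = l \<otimes>\<^bsub>R\<^esub> ev H v'"
    by (rule ev_last_factor[OF F w]) blast
  obtain r u' v' where r: "w' = v' @ u'" "set u' \<subseteq> carrier M" "v' \<in> dwords [hd G]" "r \<in> carrier R"
      "length u' = leaves (tl G)"
    and evG: "\<And>T v'. v' \<in> dwords [T] \<Longrightarrow> ev (T # tl G) (v' @ u') = ev [T] v' \<otimes>\<^bsub>R\<^esub> r"
    by (rule ev_first_factor[OF G w']) blast
  have vv: "v @ v' \<in> dwords [X]" "(v @ v') @ u' \<in> dwords (X # tl G)"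
    if "(i, X) \<in># tree_expansion (last F) (hd G)" for i X
  proof -
    have n: "Suc (leaves [X]) = leaves [last F] + leaves [hd G]"
      using tree_leaves_tree_expansion[OF that] by simp
    then have d: "deg [X] = deg [last F] + deg [hd G]"
      using leaves_pos[of "[last F]"] leaves_pos[of "[hd G]"] by simp
    show "v @ v' \<in> dwords [X]" using words_append[OF M l(3) r(3)] by (simp only: d)
    then show "(v @ v') @ u' \<in> dwords (X # tl G)"
      using r(2,5) tree_leaves_pos[of X] by (auto simp: words_def)
  qed
  have cl: "ev [X] (v @ v') \<in> carrier R" if "(i, X) \<in># tree_expansion (last F) (hd G)" for i X
    by (rule ev_closed[OF _ vv(1)[OF that]]) simp
  have eq: "ev (butlast F @ X # tl G) (w @ w') = l \<otimes>\<^bsub>R\<^esub> (ev [X] (v @ v') \<otimes>\<^bsub>R\<^esub> r)"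
    if "(i, X) \<in># tree_expansion (last F) (hd G)" for i X
    using evF[OF _ vv(2)[OF that]] evG[OF vv(1)[OF that]] by (simp add: l(1) r(1))
  have "ev F w = l \<otimes>\<^bsub>R\<^esub> ev [last F] v" using evF[OF _ l(3)] F by (simp add: l(1))
  moreover have "ev G w' = ev [hd G] v' \<otimes>\<^bsub>R\<^esub> r" using evG[OF r(3)] G by (simp add: r(1))
  ultimately have "ev F w \<otimes>\<^bsub>R\<^esub> ev G w' = l \<otimes>\<^bsub>R\<^esub> (ev [last F] v \<otimes>\<^bsub>R\<^esub> ev [hd G] v' \<otimes>\<^bsub>R\<^esub> r)"
    using l(3,4) r(3,4) by (simp add: R.m_assoc)
  also have "\<dots> = wsum K lam R (\<lambda>X. l \<otimes>\<^bsub>R\<^esub> (ev [X] (v @ v') \<otimes>\<^bsub>R\<^esub> r)) (tree_expansion (last F) (hd G))"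
    unfolding tree[OF l(3) r(3)]
    by (rule mod_hom_wsum[OF cring lam R_module R_module
          mod_hom_comp[OF R_mult_right_hom[OF l(4)] R_mult_left_hom[OF r(4)]]]) (rule cl)
  also have "\<dots> = wsum K lam R (\<lambda>X. ev (butlast F @ X # tl G) (w @ w')) (tree_expansion (last F) (hd G))"
    using cl l(4) r(4) by (intro wsum_cong[OF cring lam R_module]) (auto simp: eq)
  also have "\<dots> = wsum K lam R (\<lambda>X. ev X (w @ w')) (forest_expansion F G)"
    unfolding forest_expansion_def using cl l(4) r(4)
    by (intro wsum_wmap[OF cring lam R_module, symmetric]) (auto simp: eq)
  finally show ?thesis .
qed

text \<open>For grafted trees the left side is \<open>P x P y\<close> with \<open>x\<close>, \<open>y\<close> the values of the forests below
  the roots. The Rota--Baxter identity turns it into \<open>P\<close> of three products of smaller forests, and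
  these are the three parts of the recursion.\<close>

lemma ev_tree_expansion:
  "w \<in> dwords [S] \<Longrightarrow> v \<in> dwords [T] \<Longrightarrow>
    ev [S] w \<otimes>\<^bsub>R\<^esub> ev [T] v = wsum K lam R (\<lambda>X. ev [X] (w @ v)) (tree_expansion S T)"
proof (induction S T arbitrary: w v rule: tree_expansion.induct)
  case (1 F G)
  note single = wsum_single[OF cring lam R_module]
  show ?case
  proof (cases "F = [] \<or> G = []")
    case True
    then show ?thesis
    proof
      assume "F = []"
      then show ?thesis using 1(4,5) by (simp add: words_def single ev_closed[unfolded words_def])
    next
      assume "G = []"
      then show ?thesis using 1(4,5) by (simp add: words_def single ev_closed[unfolded words_def])
    qed
  next
    case False
    then have F: "F \<noteq> []" and G: "G \<noteq> []" by auto
    have w: "w \<in> dwords F" and v: "v \<in> dwords G"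
      using 1(4,5) by (simp_all only: leaves_graft[OF F] leaves_graft[OF G])
    let ?D = "forest_expansion [Node F] G + forest_expansion F [Node G] + wshift 1 (forest_expansion F G)"
    have D: "X \<noteq> []" "w @ v \<in> dwords X" if "(i, X) \<in># ?D" for i X
    proof -
      from that consider "(i, X) \<in># forest_expansion [Node F] G" | "(i, X) \<in># forest_expansion F [Node G]"
        | j where "(j, X) \<in># forest_expansion F G" by (auto simp: wshift_def)
      then have "X \<noteq> [] \<and> deg X = deg F + deg G"
        using F G forest_expansion_nonempty forest_expansion_deg[of "[Node F]" G] forest_expansion_deg[of F "[Node G]"] forest_expansion_deg[of F G]
        by cases (metis leaves_graft list.distinct(1))+
      then show "X \<noteq> []" "w @ v \<in> dwords X" using words_append[OF M w v] by simp_all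
    qed
    have cl: "ev X (w @ v) \<in> carrier R" if "(i, X) \<in># ?D" for i X
      using D[OF that] by (rule ev_closed)
    have m1: "ev [Node F] w \<otimes>\<^bsub>R\<^esub> ev G v = wsum K lam R (\<lambda>X. ev X (w @ v)) (forest_expansion [Node F] G)"
      using 1(1)[OF G F] by (intro ev_forest_expansion_aux G 1(4) v) simp_all
    have m2: "ev F w \<otimes>\<^bsub>R\<^esub> ev [Node G] v = wsum K lam R (\<lambda>X. ev X (w @ v)) (forest_expansion F [Node G])"
      using 1(2)[OF G F] by (intro ev_forest_expansion_aux F 1(5) w) simp_all
    have m3: "ev F w \<otimes>\<^bsub>R\<^esub> ev G v = wsum K lam R (\<lambda>X. ev X (w @ v)) (forest_expansion F G)"
      using 1(3)[OF G F] by (intro ev_forest_expansion_aux F G w v) simp_all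
    have "ev [Node F] w \<otimes>\<^bsub>R\<^esub> ev [Node G] v = P (ev [Node F] w \<otimes>\<^bsub>R\<^esub> ev G v
        \<oplus>\<^bsub>R\<^esub> ev F w \<otimes>\<^bsub>R\<^esub> ev [Node G] v \<oplus>\<^bsub>R\<^esub> lam \<odot>\<^bsub>R\<^esub> (ev F w \<otimes>\<^bsub>R\<^esub> ev G v))"
      unfolding ev_graft[OF F] ev_graft[OF G]
      by (rule R.rota_baxter[OF ev_closed[OF F w] ev_closed[OF G v]])
    also have "ev [Node F] w \<otimes>\<^bsub>R\<^esub> ev G v
        \<oplus>\<^bsub>R\<^esub> ev F w \<otimes>\<^bsub>R\<^esub> ev [Node G] v \<oplus>\<^bsub>R\<^esub> lam \<odot>\<^bsub>R\<^esub> (ev F w \<otimes>\<^bsub>R\<^esub> ev G v)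
        = wsum K lam R (\<lambda>X. ev X (w @ v)) ?D"
      unfolding m1 m2 m3 by (rule wsum_rota_baxter[OF cring lam R_module cl, symmetric])
    also have "P \<dots> = wsum K lam R (\<lambda>X. P (ev X (w @ v))) ?D"
      by (rule mod_hom_wsum[OF cring lam R_module R_module R.operator_linear cl])
    also have "\<dots> = wsum K lam R (\<lambda>X. ev [Node X] (w @ v)) ?D"
    proof (rule wsum_cong[OF cring lam R_module])
      fix i X assume X: "(i, X) \<in># ?D"
      show "P (ev X (w @ v)) \<in> carrier R" by (rule mod_hom_closed[OF R.operator_linear cl[OF X]])
      show "P (ev X (w @ v)) = ev [Node X] (w @ v)" using D(1)[OF X] by (simp add: ev_graft)
    qed
    also have "\<dots> = wsum K lam R (\<lambda>X. ev [X] (w @ v)) (tree_expansion (Node F) (Node G))"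
      unfolding tree_expansion_graft[OF F G]
    proof (rule wsum_wmap[OF cring lam R_module, symmetric])
      fix i X assume X: "(i, X) \<in># ?D"
      show "ev [Node X] (w @ v) \<in> carrier R"
        unfolding ev_graft[OF D(1)[OF X]] by (rule mod_hom_closed[OF R.operator_linear cl[OF X]])
    qed
    finally show ?thesis .
  qed
qed

lemma ev_forest_expansion:
  "F \<noteq> [] \<Longrightarrow> G \<noteq> [] \<Longrightarrow> w \<in> dwords F \<Longrightarrow> v \<in> dwords G \<Longrightarrow>
    ev F w \<otimes>\<^bsub>R\<^esub> ev G v = wsum K lam R (\<lambda>X. ev X (w @ v)) (forest_expansion F G)"
  by (intro ev_forest_expansion_aux ev_tree_expansion)

text \<open>On the summand of \<open>F\<close> this is the linear map on the tensor power that corresponds to the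
  multilinear map \<open>forest_eval R P f F\<close>.\<close>

definition induced :: "(pforest \<Rightarrow> ('m list \<Rightarrow> 'k) set) \<Rightarrow> 'r"
  where "induced = sum_lift forests (decorations K M) R (\<lambda>F. tensor_lift K M (deg F) R (ev F))"

lemma induced_hom: "induced \<in> mod_hom K Sh R"
  unfolding induced_def by (intro Sh_lift_hom R_module tensor_lift_hom M ev_multilinear)

lemma induced_gen:
  assumes "F \<noteq> []" "w \<in> dwords F" shows "induced (gen F w) = ev F w"
  unfolding induced_def
  by (rule trans[OF Sh_lift_decorated[OF R_module tensor_lift_hom[OF M R_module ev_multilinear]
          assms(1) pure_tensor_closed[OF M assms(2)]]
        tensor_lift_pure[OF M R_module ev_multilinear[OF assms(1)] assms(2)]])

lemma induced_mult:
  assumes x: "x \<in> carrier Sh" and y: "y \<in> carrier Sh"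
  shows "induced (shmult x y) = induced x \<otimes>\<^bsub>R\<^esub> induced y"
proof -
  note h = induced_hom and cl = mod_hom_closed[OF induced_hom]
  have gens: "induced (shmult (gen F w) (gen G v)) = induced (gen F w) \<otimes>\<^bsub>R\<^esub> induced (gen G v)"
    if "F \<noteq> []" "w \<in> dwords F" "G \<noteq> []" "v \<in> dwords G" for F w G v
  proof -
    have X: "X \<noteq> []" "w @ v \<in> dwords X" if "(i, X) \<in># forest_expansion F G" for i X
      using forest_expansion_nonempty[OF that] words_append[OF M \<open>w \<in> dwords F\<close> \<open>v \<in> dwords G\<close>]
        forest_expansion_deg[OF \<open>F \<noteq> []\<close> \<open>G \<noteq> []\<close> that] by simp_all
    have "induced (shmult (gen F w) (gen G v)) = wsum K lam R (\<lambda>X. induced (gen X (w @ v))) (forest_expansion F G)"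
      unfolding shmult_gen[OF that(1,3,2,4)]
      by (rule mod_hom_wsum[OF cring lam Sh_module R_module h gen_forest_expansion_closed[OF that(1,3,2,4)]])
    also have "\<dots> = wsum K lam R (\<lambda>X. ev X (w @ v)) (forest_expansion F G)"
    proof (rule wsum_cong[OF cring lam R_module])
      fix i X assume X': "(i, X) \<in># forest_expansion F G"
      show "induced (gen X (w @ v)) = ev X (w @ v)" using X[OF X'] by (rule induced_gen)
      then show "induced (gen X (w @ v)) \<in> carrier R" using X[OF X'] by simp
    qed
    finally show ?thesis using that by (simp add: ev_forest_expansion induced_gen)
  qed
  have 1: "induced (shmult (gen F w) y) = induced (gen F w) \<otimes>\<^bsub>R\<^esub> induced y"
    if "F \<noteq> []" "w \<in> dwords F" for F w
    by (rule Sh_hom_eq[OF R_module mod_hom_comp[OF h shmult_hom_right[OF gen_closed[OF that]]]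
          mod_hom_comp[OF R_mult_right_hom[OF cl[OF gen_closed[OF that]]] h] _ y])
      (rule gens[OF that])
  show ?thesis
    by (rule Sh_hom_eq[OF R_module mod_hom_comp[OF h shmult_hom_left[OF y]]
          mod_hom_comp[OF R_mult_left_hom[OF cl[OF y]] h] _ x]) (rule 1)
qed

lemma induced_op:
  assumes "x \<in> carrier Sh" shows "induced (shop x) = P (induced x)"
  by (rule Sh_hom_eq[OF R_module mod_hom_comp[OF induced_hom shop_hom]
        mod_hom_comp[OF R.operator_linear induced_hom] _ assms])
    (simp add: shop_gen induced_gen[of "[Node _]"] leaves_graft[simplified] induced_gen ev_graft)

lemma induced_one: "induced shone = \<one>\<^bsub>R\<^esub>"
  using induced_gen[of "[bullet]" "[]"] by simp

lemma induced_incl: "a \<in> carrier M \<Longrightarrow> induced (shNC_incl K M a) = f a"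
  using induced_gen[of "[bullet, bullet]" "[a]"]
  by (simp add: shNC_incl_def words_def ev_Cons)

abbreviation (input) "induced_mor \<equiv> restrict induced (carrier (shNC K lam M))"

lemma induced_mor_rb_hom: "induced_mor \<in> rb_hom K (shNC K lam M) shop R P"
proof -
  note cl = mod_hom_closed[OF induced_hom] and shcl = mod_hom_closed[OF shop_hom]
  have "induced_mor \<in> mod_hom K Sh R"
    by (rule mod_hom_cong[OF Sh_module _ induced_hom]) (simp add: shNC_simps)
  moreover have "induced_mor \<in> ring_hom (shNC K lam M) R"
    by (rule ring_hom_memI) (simp_all add: shNC_simps cl shmult_closed shone_closed induced_mult
        induced_one mod_hom_add[OF induced_hom])
  ultimately show ?thesis
    by (simp add: rb_hom_def mod_hom_shNC) (simp add: shNC_simps shcl induced_op)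
qed

text \<open>A morphism is determined on \<open>(F; w)\<close> by induction: the one-vertex tree is the identity,
  \<open>(\<lfloor>F\<rfloor>; w)\<close> is the operator applied to \<open>(F; w)\<close>, and \<open>(S G; uav)\<close> is the product of \<open>(S; u)\<close>, \<open>j
  a\<close> and \<open>(G; v)\<close>.\<close>

lemma rb_hom_gen:
  assumes h: "h \<in> rb_hom K (shNC K lam M) shop R P"
    and hf: "\<And>a. a \<in> carrier M \<Longrightarrow> f a = h (shNC_incl K M a)"
  shows "F \<noteq> [] \<Longrightarrow> w \<in> dwords F \<Longrightarrow> h (gen F w) = ev F w"
proof (induction F arbitrary: w rule: forest_induct)
  have mult: "h (shmult x y) = h x \<otimes>\<^bsub>R\<^esub> h y" if "x \<in> carrier Sh" "y \<in> carrier Sh" for x y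
    using h ring_hom_mult[of h "shNC K lam M" R x y] that by (simp add: rb_hom_def shNC_simps)
  {
    case bullet
    then have "w = []" by (simp add: words_def)
    then show ?case
      using h ring_hom_one[of h "shNC K lam M" R] by (simp add: rb_hom_def shNC_simps)
  next
    case (graft F)
    have w: "w \<in> dwords F" using graft(3) by (simp only: leaves_graft[OF graft(1)])
    have "h (shop (gen F w)) = P (h (gen F w))"
      using h gen_closed[OF graft(1) w] by (simp add: rb_hom_def shNC_simps)
    then show ?case
      using graft(2)[OF w] by (simp add: shop_gen[OF graft(1) w] ev_graft[OF graft(1)])
  next
    case (Cons S G)
    note w = words_Suc_split[OF Cons(4)[unfolded deg_Cons[OF Cons(1)]]]
    let ?u = "take (deg [S]) w" and ?a = "w ! deg [S]" and ?v = "drop (Suc (deg [S])) w"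
    have len: "deg [S] < length w"
      using Cons(4)[unfolded deg_Cons[OF Cons(1)]] by (simp add: words_def)
    have a: "[?a] \<in> dwords [bullet, bullet]" using w(2) by (simp add: words_def)
    \<comment> \<open>Since \<open>bullet\<close> is neutral for trees, multiplying by \<open>[bullet, bullet]\<close> on either side only
      inserts the linking letter.\<close>
    have S: "forest_expansion [S] [bullet, bullet] = {#(0, [S, bullet])#}"
      and G: "forest_expansion [S, bullet] G = {#(0, S # G)#}"
      using Cons(1) by (simp_all add: forest_expansion_def)
    have ua: "?u @ [?a] \<in> dwords [S, bullet]"
      using w(1,2) tree_leaves_pos[of S] by (simp add: words_def)
    have ne: "[S] \<noteq> []" "[bullet, bullet] \<noteq> []" "[S, bullet] \<noteq> []" "S # G \<noteq> []" by simp_all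
    have wa: "(?u @ [?a]) @ ?v = w" using len by (simp add: id_take_nth_drop[symmetric])
    note single = wsum_single[OF cring lam Sh_module]
    have "shmult (gen [S] ?u) (gen [bullet, bullet] [?a]) = gen [S, bullet] (?u @ [?a])"
      using shmult_gen[OF ne(1,2) w(1) a] single[of "\<lambda>X. gen X (?u @ [?a])", OF gen_closed[OF ne(3) ua]]
      by (simp only: S)
    moreover have "shmult (gen [S, bullet] (?u @ [?a])) (gen G ?v) = gen (S # G) w"
      using shmult_gen[OF ne(3) Cons(1) ua w(3)] single[of "\<lambda>X. gen X w", OF gen_closed[OF ne(4) Cons(4)]]
      by (simp only: G wa)
    ultimately have "h (gen (S # G) w) = h (gen [S] ?u) \<otimes>\<^bsub>R\<^esub> h (gen [bullet, bullet] [?a]) \<otimes>\<^bsub>R\<^esub> h (gen G ?v)"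
      using mult gen_closed[OF _ w(1)] gen_closed[OF _ a] gen_closed[OF Cons(1) w(3)] gen_closed[OF _ ua]
      by (metis list.distinct(1))
    also have "\<dots> = ev [S] ?u \<otimes>\<^bsub>R\<^esub> f ?a \<otimes>\<^bsub>R\<^esub> ev G ?v"
      using Cons(2)[OF w(1)] Cons(3)[OF w(3)] hf[OF w(2)] by (simp add: shNC_incl_def)
    also have "\<dots> = ev (S # G) w" by (rule ev_Cons[OF Cons(1), symmetric])
    finally show ?case .
  }
qed

lemma free_universal:
  "\<exists>!g. g \<in> extensional (carrier (shNC K lam M)) \<and> g \<in> rb_hom K (shNC K lam M) shop R P
    \<and> (\<forall>a\<in>carrier M. f a = g (shNC_incl K M a))"
proof (rule ex1I[of _ induced_mor], intro conjI ballI)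
  show "induced_mor \<in> extensional (carrier (shNC K lam M))" by simp
  show "induced_mor \<in> rb_hom K (shNC K lam M) shop R P" by (rule induced_mor_rb_hom)
  fix a assume "a \<in> carrier M"
  then show "f a = induced_mor (shNC_incl K M a)"
    using mod_hom_closed[OF incl_hom] by (simp add: induced_incl)
next
  fix g assume g: "g \<in> extensional (carrier (shNC K lam M)) \<and> g \<in> rb_hom K (shNC K lam M) shop R P
    \<and> (\<forall>a\<in>carrier M. f a = g (shNC_incl K M a))"
  then have hom: "g \<in> mod_hom K Sh R" by (simp add: rb_hom_def mod_hom_shNC)
  have "g x = induced_mor x" if "x \<in> carrier (shNC K lam M)" for x
    using Sh_hom_eq[OF R_module hom induced_hom, of x] rb_hom_gen[of g] g that
    by (simp add: shNC_simps induced_gen)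
  then show "g = induced_mor"
    using g by (intro extensionalityI[of _ "carrier (shNC K lam M)"]) auto
qed

end

end

theorem theorem3p4:
  fixes K :: "('k, 'a) ring_scheme" and M :: "('k, 'm, 'b) module_scheme" and lam :: 'k
  assumes "cring K" and "lam \<in> carrier K" and "module K M"
  shows "unital_algebra K (shNC K lam M)
    \<and> rota_baxter_algebra K lam (shNC K lam M) (shNC_op K M)
    \<and> shNC_incl K M \<in> mod_hom K M (shNC K lam M)
    \<and> (\<forall>(R :: ('k, 'r, 'c) module_scheme) P f.
         rota_baxter_algebra K lam R P \<longrightarrow> f \<in> mod_hom K M R \<longrightarrow>
         (\<exists>!g. g \<in> extensional (carrier (shNC K lam M))
            \<and> g \<in> rb_hom K (shNC K lam M) (shNC_op K M) R P
            \<and> (\<forall>a\<in>carrier M. f a = g (shNC_incl K M a))))"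
  using shNC_unital_algebra[OF assms] shNC_rota_baxter_algebra[OF assms] incl_hom[OF assms]
    free_universal[OF assms]
  by blast

end
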